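(* Let $G=(V=[n],E,w)$ be any finite weighted graph with positive edge weights $w_{ij}>0$, and let $$H=\sum_{(i,j)\in E} w_{ij}\,\frac{I-X_iX_j-Y_iY_j-Z_iZ_j}{4}$$ be the associated Quantum Max Cut Hamiltonian on $n$ qubits. Then the (randomized, classical) Algorithm A described in the context is a $0.595$-approximation algorithm for Quantum Max Cut on $G$: the density matrix $\sigma$ that it outputs on input $G$ satisfies $$\mathbb{E}\big[\mathrm{Tr}(\sigma H)\big]\;\ge\;0.595\,\lambda_{\max}(H),$$ where the expectation is over the algorithm's internal randomness and $\lambda_{\max}(H)$ is the largest eigenvalue of $H$.
   Context: Notation: $X,Y,Z$ are the single-qubit Pauli matrices; $X_i$ (resp. $Y_i,Z_i$) acts as $X$ (resp. $Y,Z$) on qubit $i$ and as the identity on the other qubits. For $k\ge 1$, $\mathcal P_k(n)$ is the set of $n$-qubit Pauli matrices, i.e. tensor products of $n$ factors from $\{I,X,Y,Z\}$ (no phases), with at most $k$ non-identity factors; it contains the identity $I$. Level-2 Quantum Lasserre SDP for $G$: maximize $$\sum_{(i,j)\in E} \tfrac{w_{ij}}{4}\, v(I)\cdot\big(v(I)-v(X_iX_j)-v(Y_iY_j)-v(Z_iZ_j)\big)$$ over families of real vectors $(v(P))_{P\in\mathcal P_2(n)}$, $v(P)\in\mathbb R^{|\mathcal P_2(n)|}$, subject to: (i) $v(P)\cdot v(P)=1$ for all $P\in\mathcal P_2(n)$; (ii) $v(P_1)\cdot v(Q_1)=s\,v(P_2)\cdot v(Q_2)$ for all $P_1,Q_1,P_2,Q_2\in\mathcal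 P_2(n)$ and $s\in\{+1,-1\}$ with $P_1Q_1=s\,P_2Q_2$; (iii) $v(P)\cdot v(Q)=0$ for all $P,Q\in\mathcal P_2(n)$ with $PQ+QP=0$. Algorithm A, on input $G=(V=[n],E,w)$: Step 1 (product state). (a) Take an optimal solution $(v(P))_{P\in\mathcal P_2(n)}$ of the level-2 Quantum Lasserre SDP for $G$. (b) Sample a random real matrix $R$ of size $3\times 3|\mathcal P_2(n)|$ with independent standard normal $\mathcal N(0,1)$ entries. (c) For each $i\in V$, let $v_i\in\mathbb R^{3|\mathcal P_2(n)|}$ be the concatenation of $v(X_i),v(Y_i),v(Z_i)$ divided by $\sqrt3$, and let $u_i=Rv_i/\|Rv_i\|\in\mathbb R^3$ (defined almost surely). (d) Let $\rho_1=\prod_{i\in V}\tfrac12\big(I+u_{i,1}X_i+u_{i,2}Y_i+u_{i,3}Z_i\big)$. Step 2 (matching state). (a) Find a maximum weight matching $M:E\to\{0,1\}$ of $G$. (b) Let $\rho_2=\prod_{(i,j)\in E:\,M_{(i,j)}=1}\tfrac14\big(I-X_iX_j-Y_iY_j-Z_iZ_j\big)\ \prod_{i\in U}\tfrac12 I$ (in the last product $\tfrac12 I$ denotes the maximally mixed state of qubit $i$), where $U$ is the set of vertices not covered by $M$. Step 3. Output $\sigma\in\{\rho_1,\rho_2\}$, whichever has the larger energy $\mathrm{Tr}(\sigma H)$. *)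

theory Defs
  imports "HOL-Probability.Probability"
begin

text \<open>
  The qubits are the elements of a finite type \<open>'n\<close>.  The computational basis of their joint
  state space is indexed by the functions \<open>'n \<Rightarrow> 2\<close>.
\<close>

type_synonym 'n qop = "complex ^ ('n \<Rightarrow> 2) ^ ('n \<Rightarrow> 2)"

definition pauli_X :: "complex ^ 2 ^ 2" where
  "pauli_X = vector [vector [0, 1], vector [1, 0]]"

definition pauli_Y :: "complex ^ 2 ^ 2" where
  "pauli_Y = vector [vector [0, - \<i>], vector [\<i>, 0]]"

definition pauli_Z :: "complex ^ 2 ^ 2" where
  "pauli_Z = vector [vector [1, 0], vector [0, - 1]]"

definition tensor :: "('n::finite \<Rightarrow> complex ^ 2 ^ 2) \<Rightarrow> 'n qop" where
  "tensor f = (\<chi> a b. \<Prod>i\<in>UNIV. f i $ a i $ b i)"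

definition on_qubit :: "complex ^ 2 ^ 2 \<Rightarrow> 'n::finite \<Rightarrow> 'n qop" where
  "on_qubit A i = tensor ((\<lambda>_. mat 1)(i := A))"

abbreviation X_at :: "'n::finite \<Rightarrow> 'n qop" where "X_at \<equiv> on_qubit pauli_X"
abbreviation Y_at :: "'n::finite \<Rightarrow> 'n qop" where "Y_at \<equiv> on_qubit pauli_Y"
abbreviation Z_at :: "'n::finite \<Rightarrow> 'n qop" where "Z_at \<equiv> on_qubit pauli_Z"

definition pauli_matrices :: "nat \<Rightarrow> ('n::finite) qop set" where
  "pauli_matrices k = {tensor f | f.
     (\<forall>i. f i \<in> {mat 1, pauli_X, pauli_Y, pauli_Z}) \<and> card {i. f i \<noteq> mat 1} \<le> k}"

text \<open>The order of the factors is left open, so this is meant for pairwise commuting factors only.\<close>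

definition op_prod :: "('a \<Rightarrow> ('n::finite) qop) \<Rightarrow> 'a set \<Rightarrow> 'n qop" where
  "op_prod f S = Finite_Set.fold (\<lambda>i A. f i ** A) (mat 1) S"

text \<open>For Hermitian \<open>\<sigma>\<close> and \<open>H\<close> the trace is real.\<close>

definition energy :: "('n::finite) qop \<Rightarrow> 'n qop \<Rightarrow> real" where
  "energy H \<sigma> = Re (trace (\<sigma> ** H))"

text \<open>Meant for Hermitian matrices, whose eigenvalues are all real.\<close>

definition lambda_max :: "('n::finite) qop \<Rightarrow> real" where
  "lambda_max A = Max {l :: real. \<exists>x. x \<noteq> 0 \<and> A *v x = complex_of_real l *s x}"

text \<open>
  An edge is stored once, as an ordered pair with an arbitrary orientation; nothing below depends
  on the orientation chosen.
\<close>

definition weighted_graph :: "('n \<times> 'n) set \<Rightarrow> ('n \<Rightarrow> 'n \<Rightarrow> real) \<Rightarrow> bool" where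
  "weighted_graph E w \<longleftrightarrow> finite E \<and> (\<forall>(i, j)\<in>E. i \<noteq> j \<and> (j, i) \<notin> E \<and> w i j > 0)"

text \<open>A quarter of this operator is the projector onto the singlet state of qubits \<open>i\<close> and \<open>j\<close>.\<close>

definition edge_op :: "'n::finite \<Rightarrow> 'n \<Rightarrow> 'n qop" where
  "edge_op i j = mat 1 - X_at i ** X_at j - Y_at i ** Y_at j - Z_at i ** Z_at j"

definition qmc_hamiltonian :: "('n::finite \<times> 'n) set \<Rightarrow> ('n \<Rightarrow> 'n \<Rightarrow> real) \<Rightarrow> 'n qop" where
  "qmc_hamiltonian E w = (\<Sum>(i, j)\<in>E. (w i j / 4) *\<^sub>R edge_op i j)"

lemma finite_pauli_matrices: "finite (pauli_matrices k :: ('n::finite) qop set)"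
proof -
  have "pauli_matrices k \<subseteq>
      tensor ` (UNIV \<rightarrow>\<^sub>E {mat 1, pauli_X, pauli_Y, pauli_Z}) " for k
    by (auto simp: pauli_matrices_def PiE_def)
  then show ?thesis
    by (rule finite_subset) (auto intro!: finite_imageI finite_PiE)
qed

lemma mat_1_in_pauli_matrices: "mat 1 \<in> (pauli_matrices k :: ('n::finite) qop set)"
proof -
  have "(\<Prod>i\<in>UNIV. (mat 1 :: complex ^ 2 ^ 2) $ a i $ b i) = (mat 1 :: 'n qop) $ a $ b" for a b
    by (cases "a = b") (auto simp: mat_def fun_eq_iff)
  then have "mat 1 = (tensor (\<lambda>_. mat 1) :: 'n qop)"
    by (simp add: tensor_def vec_eq_iff)
  then show ?thesis
    unfolding pauli_matrices_def by force
qed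

text \<open>
  The SDP vectors have one coordinate per Pauli matrix, so \<open>real ^ 'n pauli2\<close> below is the space
  of dimension \<open>card (pauli_matrices 2)\<close>.
\<close>

typedef ('n::finite) pauli2 = "pauli_matrices 2 :: 'n qop set"
  using mat_1_in_pauli_matrices by blast

instance pauli2 :: (finite) finite
proof
  have "range (Rep_pauli2 :: 'a pauli2 \<Rightarrow> _) \<subseteq> pauli_matrices 2"
    using Rep_pauli2 by blast
  then have "finite (range (Rep_pauli2 :: 'a pauli2 \<Rightarrow> _))"
    using finite_pauli_matrices finite_subset by blast
  then show "finite (UNIV :: 'a pauli2 set)"
    by (rule finite_imageD) (simp add: inj_on_def Rep_pauli2_inject)
qed

text \<open>Only the values of such a family on \<open>pauli_matrices 2\<close> are relevant.\<close>

type_synonym 'n sdp_family = "'n qop \<Rightarrow> real ^ 'n pauli2"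

definition lasserre2_feasible :: "('n::finite) sdp_family \<Rightarrow> bool" where
  "lasserre2_feasible v \<longleftrightarrow>
     (\<forall>P\<in>pauli_matrices 2. v P \<bullet> v P = 1) \<and>
     (\<forall>P\<^sub>1\<in>pauli_matrices 2. \<forall>Q\<^sub>1\<in>pauli_matrices 2.
      \<forall>P\<^sub>2\<in>pauli_matrices 2. \<forall>Q\<^sub>2\<in>pauli_matrices 2. \<forall>s\<in>{1, - 1 :: real}.
        P\<^sub>1 ** Q\<^sub>1 = s *\<^sub>R (P\<^sub>2 ** Q\<^sub>2) \<longrightarrow> v P\<^sub>1 \<bullet> v Q\<^sub>1 = s * (v P\<^sub>2 \<bullet> v Q\<^sub>2)) \<and>
     (\<forall>P\<in>pauli_matrices 2. \<forall>Q\<in>pauli_matrices 2. P ** Q + Q ** P = 0 \<longrightarrow> v P \<bullet> v Q = 0)"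

definition lasserre2_value ::
    "('n::finite \<times> 'n) set \<Rightarrow> ('n \<Rightarrow> 'n \<Rightarrow> real) \<Rightarrow> 'n sdp_family \<Rightarrow> real" where
  "lasserre2_value E w v = (\<Sum>(i, j)\<in>E. w i j / 4 *
     (v (mat 1) \<bullet>
       (v (mat 1) - v (X_at i ** X_at j) - v (Y_at i ** Y_at j) - v (Z_at i ** Z_at j))))"

definition lasserre2_optimal ::
    "('n::finite \<times> 'n) set \<Rightarrow> ('n \<Rightarrow> 'n \<Rightarrow> real) \<Rightarrow> 'n sdp_family \<Rightarrow> bool" where
  "lasserre2_optimal E w v \<longleftrightarrow> lasserre2_feasible v \<and>
     (\<forall>v'. lasserre2_feasible v' \<longrightarrow> lasserre2_value E w v' \<le> lasserre2_value E w v)"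

definition matching :: "('n \<times> 'n) set \<Rightarrow> ('n \<times> 'n \<Rightarrow> nat) \<Rightarrow> bool" where
  "matching E M \<longleftrightarrow> (\<forall>e\<in>E. M e \<in> {0, 1}) \<and>
     (\<forall>e\<in>E. \<forall>f\<in>E. M e = 1 \<and> M f = 1 \<and> e \<noteq> f \<longrightarrow>
        {fst e, snd e} \<inter> {fst f, snd f} = {})"

definition matching_weight ::
    "('n \<times> 'n) set \<Rightarrow> ('n \<Rightarrow> 'n \<Rightarrow> real) \<Rightarrow> ('n \<times> 'n \<Rightarrow> nat) \<Rightarrow> real" where
  "matching_weight E w M = (\<Sum>(i, j)\<in>E. w i j * real (M (i, j)))"

definition max_weight_matching ::
    "('n \<times> 'n) set \<Rightarrow> ('n \<Rightarrow> 'n \<Rightarrow> real) \<Rightarrow> ('n \<times> 'n \<Rightarrow> nat) \<Rightarrow> bool" where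
  "max_weight_matching E w M \<longleftrightarrow> matching E M \<and>
     (\<forall>M'. matching E M' \<longrightarrow> matching_weight E w M' \<le> matching_weight E w M)"

definition uncovered :: "('n \<times> 'n) set \<Rightarrow> ('n \<times> 'n \<Rightarrow> nat) \<Rightarrow> 'n set" where
  "uncovered E M = {i. \<forall>e\<in>E. M e = 1 \<longrightarrow> i \<notin> {fst e, snd e}}"

definition gaussian_matrix :: "'w measure \<Rightarrow> ('w \<Rightarrow> real ^ 'c::finite ^ 'r::finite) \<Rightarrow> bool" where
  "gaussian_matrix \<Omega> R \<longleftrightarrow>
     prob_space.indep_vars \<Omega> (\<lambda>_. borel) (\<lambda>(a, k) \<omega>. R \<omega> $ a $ k) UNIV \<and>
     (\<forall>a k. distributed \<Omega> lborel (\<lambda>\<omega>. R \<omega> $ a $ k) std_normal_density)"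

text \<open>The concatenation of \<open>v(X\<^sub>i)\<close>, \<open>v(Y\<^sub>i)\<close>, \<open>v(Z\<^sub>i)\<close>, scaled to a unit vector.\<close>

definition stacked :: "('n::finite) sdp_family \<Rightarrow> 'n \<Rightarrow> real ^ (3 \<times> 'n pauli2)" where
  "stacked v i = (\<chi> k.
     (vector [v (X_at i), v (Y_at i), v (Z_at i)] :: real ^ 'n pauli2 ^ 3) $ fst k $ snd k / sqrt 3)"

text \<open>On the null event that the projection \<open>R v\<^sub>i\<close> vanishes, this is the zero vector.\<close>

definition rounded ::
    "('n::finite) sdp_family \<Rightarrow> real ^ (3 \<times> 'n pauli2) ^ 3 \<Rightarrow> 'n \<Rightarrow> real ^ 3" where
  "rounded v R i = (R *v stacked v i) /\<^sub>R norm (R *v stacked v i)"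

definition product_state :: "('n::finite \<Rightarrow> real ^ 3) \<Rightarrow> 'n qop" where
  "product_state u = op_prod (\<lambda>i.
     (1 / 2) *\<^sub>R (mat 1 + (u i $ 1) *\<^sub>R X_at i + (u i $ 2) *\<^sub>R Y_at i + (u i $ 3) *\<^sub>R Z_at i)) UNIV"

text \<open>
  The maximally mixed state of an uncovered qubit contributes \<open>1/2\<close> times the identity of the
  whole space, so that the result has trace 1.
\<close>

definition matching_state :: "('n::finite \<times> 'n) set \<Rightarrow> ('n \<times> 'n \<Rightarrow> nat) \<Rightarrow> 'n qop" where
  "matching_state E M =
     op_prod (\<lambda>(i, j). (1 / 4) *\<^sub>R edge_op i j) {e \<in> E. M e = 1} **
     op_prod (\<lambda>_. (1 / 2) *\<^sub>R mat 1) (uncovered E M)"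

definition algorithm_output ::
    "('n::finite \<times> 'n) set \<Rightarrow> ('n \<Rightarrow> 'n \<Rightarrow> real) \<Rightarrow> 'n sdp_family \<Rightarrow> ('n \<times> 'n \<Rightarrow> nat) \<Rightarrow>
      real ^ (3 \<times> 'n pauli2) ^ 3 \<Rightarrow> 'n qop" where
  "algorithm_output E w v M R =
     (let H = qmc_hamiltonian E w;
          \<rho>\<^sub>1 = product_state (rounded v R);
          \<rho>\<^sub>2 = matching_state E M
      in if energy H \<rho>\<^sub>1 \<ge> energy H \<rho>\<^sub>2 then \<rho>\<^sub>1 else \<rho>\<^sub>2)"

end

theory Submission
  imports Defs
begin

text \<open>
  The maximum of the two energies is bounded below by the mixture with weight \<open>p = 0.6715\<close> on the product
  state.  Write \<open>t\<close> for the inner product of the two vectors of an edge that are rounded; its SDP energy is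
  \<open>h = (1 - 3 t) / 4\<close>, and \<open>x = 2 h - 1\<close> measures how entangled the SDP believes the edge to be.

  The SDP constraints imply the monogamy bounds \<open>\<Sum>x \<le> 1\<close> on every set of edges meeting in a vertex and
  \<open>\<Sum>x \<le> 0\<close> on triangles.  Hence the positive part of \<open>x\<close> is a fractional matching with triangle-free
  support.  Completed by a diagonal it becomes a doubly stochastic matrix, and some permutation in its
  support has at least the same weight; every odd cycle of that permutation other than a fixed point
  has length at least five, so passing from cycles to matchings costs a factor of at most \<open>4 / 5\<close>.

  For the Gaussian rounding, projecting \<open>g / |g|\<close> onto the Hermite polynomials of degree one and three
  shows that the correlation of the rounded vectors is at least \<open>8 / (3 \<pi>) (s + s\<^sup>3 / 10)\<close> for inner
  product \<open>s \<ge> 0\<close>, because the remainder contributes a nonnegative amount.  Comparing edge by edge leaves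
  a polynomial inequality in \<open>t\<close>.
\<close>

section \<open>Permutations and matchings\<close>

text \<open>Neither state suffices alone: on an edge of unit weight and SDP energy 1 a product state
  has energy at most 1/2, and the matching state gives only 1/4 outside the matching. Triangles are
  the obstacle for the matching: weight 1/2 on each edge of a triangle is a fractional matching of
  which an integral one retains only 2/3. Once triangles are excluded the five-cycle is the worst
  case, whence 4/5 and the coefficient 2.4 = 3 * 4/5 of the final inequality. Working with
  permutations avoids odd-set constraints.

  The map \<open>sgn\<close> is odd and commutes with rotations, so even degrees vanish and degrees
  one and three have a single relevant vector polynomial each. The linear term alone would leave the
  ratio below 0.594; the cubic term lifts it just above 0.595. The bounds for the two states meet
  near t = - 0.44, and 0.6715 is a weight for which the slack of the edge inequality on t <= - 1/3
  is smallest near that point.\<close>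

lemma two_fractional_entries:
  fixes f :: "'a::finite \<Rightarrow> real"
  assumes nonneg: "\<And>j. f j \<ge> 0" and sum: "sum f UNIV = 1" and frac: "0 < f j" "f j < 1"
  shows "2 \<le> card {j. 0 < f j \<and> f j < 1}"
proof -
  have s: "sum f (UNIV - {j}) = 1 - f j"
    using sum by (simp add: sum_diff1)
  \<comment> \<open>The other entries share the mass \<open>1 - f j\<close>, which lies strictly
    between 0 and 1, so a positive one among them is fractional too.\<close>
  have "\<exists>j'\<in>UNIV - {j}. f j' > 0"
  proof (rule ccontr)
    assume "\<not> ?thesis"
    then have "sum f (UNIV - {j}) \<le> 0" by (intro sum_nonpos) (auto simp: not_less)
    then show False using s frac by simp
  qed
  then obtain j' where j': "j' \<noteq> j" "f j' > 0" by auto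
  have "f j' \<le> sum f (UNIV - {j})" using j' nonneg by (intro member_le_sum) auto
  then have "{j, j'} \<subseteq> {j. 0 < f j \<and> f j < 1}" using s frac j' by auto
  then have "card {j, j'} \<le> card {j. 0 < f j \<and> f j < 1}" by (intro card_mono) auto
  then show ?thesis using j' by simp
qed

text \<open>Each row or column with a fractional entry has at least two of them, so the fractional entries
  outnumber the independent linear constraints on them.\<close>

lemma doubly_stochastic_support_dependency:
  fixes X :: "'n::finite \<Rightarrow> 'n \<Rightarrow> real"
  assumes nonneg: "\<And>i j. X i j \<ge> 0"
    and rows: "\<And>i. (\<Sum>j\<in>UNIV. X i j) = 1" and cols: "\<And>j. (\<Sum>i\<in>UNIV. X i j) = 1"
    and frac: "0 < X k l" "X k l < 1"
  shows "\<exists>D. (\<exists>i j. D i j \<noteq> 0) \<and> (\<forall>i j. D i j \<noteq> 0 \<longrightarrow> 0 < X i j) \<and>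
     (\<forall>i. (\<Sum>j\<in>UNIV. D i j) = (0::real)) \<and> (\<forall>j. (\<Sum>i\<in>UNIV. D i j) = 0)"
proof -
  define F where "F = {p. 0 < X (fst p) (snd p) \<and> X (fst p) (snd p) < 1}"
  define A where "A = fst ` F"
  define B where "B = snd ` F"
  define f :: "real ^ ('n \<times> 'n) \<Rightarrow> (real ^ 'n) \<times> (real ^ 'n)" where
    "f D = ((\<chi> i. \<Sum>j\<in>UNIV. D $ (i, j)), (\<chi> j. \<Sum>i\<in>UNIV. D $ (i, j)))" for D
  have lin: "linear f"
    by (rule linearI) (auto simp: f_def vec_eq_iff sum.distrib sum_distrib_left)
  define S where "S = {D :: real ^ ('n \<times> 'n). \<forall>p. p \<notin> F \<longrightarrow> D $ p = 0}"
  define SA where "SA = {a :: real ^ 'n. \<forall>i. i \<notin> A \<longrightarrow> a $ i = 0}"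
  define SB where "SB = {a :: real ^ 'n. \<forall>i. i \<notin> B \<longrightarrow> a $ i = 0}"
  \<comment> \<open>Row sums and column sums have the same total. This relation is decisive:
    \<open>card A + card B\<close> may equal \<open>card F\<close>, and only the properness of
    \<open>T\<close> in \<open>SA \<times> SB\<close>, witnessed by \<open>axis k 1\<close> below,
    makes the count strict.\<close>
  define T where "T = {q \<in> SA \<times> SB. (\<Sum>i\<in>UNIV. fst q $ i) = (\<Sum>i\<in>UNIV. snd q $ i)}"
  have subS: "subspace S" "subspace SA" "subspace SB"
    by (auto simp: subspace_def S_def SA_def SB_def)
  have subT: "subspace T"
    using subS by (auto simp: T_def subspace_def zero_prod_def sum.distrib sum_distrib_left[symmetric])
  have dims: "dim S = card F" "dim SA = card A" "dim SB = card B"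
    unfolding S_def SA_def SB_def
    using dim_substandard_cart[of F, where 'a=real] dim_substandard_cart[of A, where 'a=real] dim_substandard_cart[of B, where 'a=real]
    by (simp_all add: dim_vec_eq)
  have finF: "finite F" by simp
  have Fi: "(i, j) \<in> F \<longleftrightarrow> 0 < X i j \<and> X i j < 1" for i j by (simp add: F_def)
  have rowF: "2 \<le> card {j. (i, j) \<in> F}" if "i \<in> A" for i
  proof -
    from that obtain j where "(i, j) \<in> F" unfolding A_def by auto
    then show ?thesis using two_fractional_entries[of "X i" j] nonneg rows by (simp add: Fi)
  qed
  have colF: "2 \<le> card {i. (i, j) \<in> F}" if "j \<in> B" for j
  proof -
    from that obtain i where "(i, j) \<in> F" unfolding B_def by auto
    then show ?thesis using two_fractional_entries[of "\<lambda>i. X i j" i] nonneg cols by (simp add: Fi)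
  qed
  have "F = Sigma A (\<lambda>i. {j. (i, j) \<in> F})" by (auto simp: A_def image_iff) force
  then have "card F = card (Sigma A (\<lambda>i. {j. (i, j) \<in> F}))" by (rule arg_cong)
  then have "card F = (\<Sum>i\<in>A. card {j. (i, j) \<in> F})" by (simp add: card_SigmaI)
  then have cA: "2 * card A \<le> card F" using sum_mono[of A "\<lambda>_. 2" "\<lambda>i. card {j. (i, j) \<in> F}"] rowF by simp
  have "F = prod.swap ` Sigma B (\<lambda>j. {i. (i, j) \<in> F})" by (auto simp: B_def image_iff) force
  then have "card F = card (Sigma B (\<lambda>j. {i. (i, j) \<in> F}))" by (metis card_image inj_swap inj_on_subset subset_UNIV)
  then have "card F = (\<Sum>j\<in>B. card {i. (i, j) \<in> F})" by (simp add: card_SigmaI)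
  then have cB: "2 * card B \<le> card F" using sum_mono[of B "\<lambda>_. 2" "\<lambda>j. card {i. (i, j) \<in> F}"] colF by simp
  have kl: "(k, l) \<in> F" using frac by (simp add: F_def)
  have "(axis k 1, 0) \<in> SA \<times> SB"
    using kl by (force simp: SA_def SB_def axis_def A_def image_iff)
  moreover have "(axis k 1, 0) \<notin> T" 
    by (auto simp: T_def axis_def)
  moreover have "T \<subseteq> SA \<times> SB" by (auto simp: T_def)
  ultimately have "T \<subset> SA \<times> SB" by blast
  then have "dim T < dim (SA \<times> SB)"
    using subT subS subspace_Times[OF subS(2,3)] by (intro dim_psubset) (metis span_eq_iff)
  also have "\<dots> = card A + card B" using dim_Times[OF subS(2,3)] dims by simp
  also have "\<dots> \<le> dim S" using cA cB dims by simp
  finally have less: "dim T < dim S" .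
  have "f ` S \<subseteq> T"
  proof
    fix q assume "q \<in> f ` S"
    then obtain D where D: "D \<in> S" "q = f D" by auto
    have a: "D $ (i, j) = 0" if "i \<notin> A \<or> j \<notin> B" for i j
    proof -
      have "(i, j) \<notin> F" using that by (auto simp: A_def B_def image_iff)
      then show ?thesis using D by (auto simp: S_def)
    qed
    have "(\<Sum>i\<in>UNIV. \<Sum>j\<in>UNIV. D $ (i, j)) = (\<Sum>j\<in>UNIV. \<Sum>i\<in>UNIV. D $ (i, j))" by (rule sum.swap)
    then show "q \<in> T" using D a by (simp add: T_def f_def SA_def SB_def)
  qed
  then have le: "dim (f ` S) \<le> dim T" by (rule dim_subset)
  have "\<not> inj_on f S"
  proof
    assume "inj_on f S"
    then have "inj_on f (span S)" using subS by (metis span_eq_iff)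
    then have "dim (f ` S) = dim S" using lin by (intro dim_image_eq) auto
    then show False using le less by simp
  qed
  then obtain D where D: "D \<in> S" "f D = 0" "D \<noteq> 0"
    using linear_injective_on_subspace_0[OF lin subS(1)] by blast
  show ?thesis
  proof (intro exI[of _ "\<lambda>i j. D $ (i, j)"] conjI allI impI)
    show "\<exists>i j. D $ (i, j) \<noteq> 0" using D(3) by (auto simp: vec_eq_iff)
    show "0 < X i j" if "D $ (i, j) \<noteq> 0" for i j
      using that D(1) by (force simp: S_def F_def)
    show "(\<Sum>j\<in>UNIV. D $ (i, j)) = 0" for i using D(2) by (auto simp: f_def prod_eq_iff vec_eq_iff)
    show "(\<Sum>i\<in>UNIV. D $ (i, j)) = 0" for j using D(2) by (auto simp: f_def prod_eq_iff vec_eq_iff)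
  qed
qed
text \<open>A Birkhoff argument that respects the support: moving along a dependency that does not
  decrease the weight makes an entry vanish and creates no new one. Positivity of
  \<open>X i (\<pi> i)\<close> is what later turns the cycles of \<pi> into cycles of graph
  edges.\<close>

lemma doubly_stochastic_permutation:
  fixes X W :: "'n::finite \<Rightarrow> 'n \<Rightarrow> real"
  assumes "\<And>i j. X i j \<ge> 0"
    and "\<And>i. (\<Sum>j\<in>UNIV. X i j) = 1" and "\<And>j. (\<Sum>i\<in>UNIV. X i j) = 1"
  shows "\<exists>\<pi>. inj \<pi> \<and> (\<forall>i. 0 < X i (\<pi> i)) \<and>
    (\<Sum>i\<in>UNIV. \<Sum>j\<in>UNIV. W i j * X i j) \<le> (\<Sum>i\<in>UNIV. W i (\<pi> i))"
  using assms
proof (induction "card {p. X (fst p) (snd p) \<noteq> 0}" arbitrary: X rule: less_induct)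
  case less
  note nonneg = less.prems(1) and rows = less.prems(2) and cols = less.prems(3)
  have le1: "X i j \<le> 1" for i j
    using member_le_sum[of j UNIV "X i"] nonneg rows by simp
  show ?case
  proof (cases "\<exists>k l. 0 < X k l \<and> X k l < 1")
    case True
    then obtain k l where "0 < X k l" "X k l < 1" by blast
    from doubly_stochastic_support_dependency[OF nonneg rows cols this] obtain D0 :: "'n \<Rightarrow> 'n \<Rightarrow> real"
      where D0: "\<exists>i j. D0 i j \<noteq> 0" "\<forall>i j. D0 i j \<noteq> 0 \<longrightarrow> 0 < X i j"
        "\<forall>i. (\<Sum>j\<in>UNIV. D0 i j) = 0" "\<forall>j. (\<Sum>i\<in>UNIV. D0 i j) = 0"
      by blast
    \<comment> \<open>The negative of a dependency is again one, so its sign can be chosen such that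
      the weight does not drop.\<close>
    define c :: real where "c = (if (\<Sum>i\<in>UNIV. \<Sum>j\<in>UNIV. W i j * D0 i j) \<ge> 0 then 1 else - 1)"
    define D where "D i j = c * D0 i j" for i j
    have D: "\<exists>i j. D i j \<noteq> 0" "\<And>i j. D i j \<noteq> 0 \<Longrightarrow> 0 < X i j"
        "\<And>i. (\<Sum>j\<in>UNIV. D i j) = 0" "\<And>j. (\<Sum>i\<in>UNIV. D i j) = 0"
      using D0 by (auto simp: D_def c_def sum_negf)
    have "(\<Sum>i\<in>UNIV. \<Sum>j\<in>UNIV. W i j * D i j) = c * (\<Sum>i\<in>UNIV. \<Sum>j\<in>UNIV. W i j * D0 i j)"
      by (simp add: D_def sum_distrib_left mult_ac)
    then have WD: "(\<Sum>i\<in>UNIV. \<Sum>j\<in>UNIV. W i j * D i j) \<ge> 0"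
      by (auto simp: c_def)
    \<comment> \<open>Zero row sums force a nonzero \<open>D\<close> to have negative entries. The
      step \<open>t\<close> is the least ratio over them, hence the largest step that keeps all
      entries nonnegative, and its minimiser \<open>p\<close> leaves the support.\<close>
    define N where "N = {p. D (fst p) (snd p) < 0}"
    have "N \<noteq> {}"
    proof
      assume "N = {}"
      then have nn: "D i j \<ge> 0" for i j by (force simp: N_def not_less)
      then have "D i j = 0" for i j using D(3)[of i] sum_nonneg_eq_0_iff[of UNIV "D i"] by simp
      then show False using D(1) by simp
    qed
    define r where "r p = X (fst p) (snd p) / - D (fst p) (snd p)" for p
    define t where "t = Min (r ` N)"
    have "t \<in> r ` N" unfolding t_def using \<open>N \<noteq> {}\<close> by (intro Min_in) auto
    then obtain p where p: "p \<in> N" "t = r p" by auto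
    have tle: "t \<le> r q" if "q \<in> N" for q unfolding t_def using that by simp
    have tpos: "t > 0" using p D(2)[of "fst p" "snd p"] by (auto simp: r_def N_def divide_pos_neg)
    define X' where "X' i j = X i j + t * D i j" for i j
    have X'nn: "X' i j \<ge> 0" for i j
    proof (cases "D i j < 0")
      case True
      then have "t \<le> X i j / - D i j" using tle[of "(i, j)"] by (simp add: N_def r_def)
      then have "t * (- D i j) \<le> X i j" using True by (subst (asm) pos_le_divide_eq) auto
      then show ?thesis by (simp add: X'_def)
    next
      case False
      then show ?thesis using nonneg tpos by (simp add: X'_def)
    qed
    have X'0: "X' (fst p) (snd p) = 0" using p by (simp add: X'_def r_def N_def)
    have sub: "X i j \<noteq> 0" if "X' i j \<noteq> 0" for i j
    proof
      assume "X i j = 0"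
      then have "D i j = 0" using D(2)[of i j] by force
      then show False using \<open>X i j = 0\<close> that by (simp add: X'_def)
    qed
    have "{p. X' (fst p) (snd p) \<noteq> 0} \<subset> {p. X (fst p) (snd p) \<noteq> 0}"
    proof
      show "{p. X' (fst p) (snd p) \<noteq> 0} \<subseteq> {p. X (fst p) (snd p) \<noteq> 0}" using sub by auto
      have "X (fst p) (snd p) \<noteq> 0" using p D(2)[of "fst p" "snd p"] by (auto simp: N_def)
      then show "{p. X' (fst p) (snd p) \<noteq> 0} \<noteq> {p. X (fst p) (snd p) \<noteq> 0}" using X'0 by blast
    qed
    then have "card {p. X' (fst p) (snd p) \<noteq> 0} < card {p. X (fst p) (snd p) \<noteq> 0}"
      by (intro psubset_card_mono) auto
    then obtain \<pi> where pi: "inj \<pi>" "\<And>i. 0 < X' i (\<pi> i)"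
      "(\<Sum>i\<in>UNIV. \<Sum>j\<in>UNIV. W i j * X' i j) \<le> (\<Sum>i\<in>UNIV. W i (\<pi> i))"
      using less.hyps[of X'] X'nn rows cols D(3,4)
      by (auto simp: X'_def sum.distrib sum_distrib_left[symmetric])
    have "(\<Sum>i\<in>UNIV. \<Sum>j\<in>UNIV. W i j * X' i j) = (\<Sum>i\<in>UNIV. \<Sum>j\<in>UNIV. W i j * X i j)
       + t * (\<Sum>i\<in>UNIV. \<Sum>j\<in>UNIV. W i j * D i j)"
      by (simp add: X'_def sum.distrib sum_distrib_left algebra_simps)
    then have "(\<Sum>i\<in>UNIV. \<Sum>j\<in>UNIV. W i j * X i j) \<le> (\<Sum>i\<in>UNIV. W i (\<pi> i))"
      using pi(3) WD tpos by (smt (verit) mult_nonneg_nonneg)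
    moreover have "0 < X i (\<pi> i)" for i
      using sub[of i "\<pi> i"] pi(2)[of i] nonneg[of i "\<pi> i"] by linarith
    ultimately show ?thesis using pi(1) by blast
  next
    case False
    then have X01: "X i j = 0 \<or> X i j = 1" for i j using nonneg[of i j] le1[of i j] by (metis order_le_less)
    have "\<exists>j. X i j = 1" for i
      using X01[of i] rows[of i] by (metis sum.neutral zero_neq_one)
    then obtain \<pi> where pi: "\<And>i. X i (\<pi> i) = 1" by metis
    have Xeq: "X i j = (if j = \<pi> i then 1 else 0)" for i j
    proof (rule ccontr)
      assume "\<not> ?thesis"
      then have "j \<noteq> \<pi> i" "X i j = 1" using pi X01[of i j] by (auto split: if_splits)
      moreover have "(\<Sum>j'\<in>{j, \<pi> i}. X i j') \<le> (\<Sum>j'\<in>UNIV. X i j')"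
        using nonneg by (intro sum_mono2) auto
      ultimately show False using rows[of i] pi[of i] by simp
    qed
    have "inj \<pi>"
    proof (rule injI, rule ccontr)
      fix i i' assume "\<pi> i = \<pi> i'" "i \<noteq> i'"
      moreover have "(\<Sum>k\<in>{i, i'}. X k (\<pi> i)) \<le> (\<Sum>k\<in>UNIV. X k (\<pi> i))"
        using nonneg by (intro sum_mono2) auto
      ultimately show False using cols[of "\<pi> i"] pi[of i] pi[of i'] by simp
    qed
    moreover have "(\<Sum>i\<in>UNIV. \<Sum>j\<in>UNIV. W i j * X i j) = (\<Sum>i\<in>UNIV. W i (\<pi> i))"
      by (simp add: Xeq if_distrib[of "\<lambda>z. _ * z"] cong: if_cong)
    ultimately show ?thesis using pi by (intro exI[of _ \<pi>]) auto
  qed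
qed

text \<open>On a cycle of length \<open>L\<close>, the sets of \<open>L div 2\<close> alternate points starting at the various points of the
  cycle cover every point equally often; \<open>2 / 5\<close> is the ratio for a cycle of length five.\<close>

lemma permutation_alternating_set:
  fixes f :: "'a \<Rightarrow> real"
  assumes "finite A" "inj_on \<pi> A" "\<pi> ` A = A"
    and f: "\<And>i. i \<in> A \<Longrightarrow> f i \<ge> 0" "\<And>i. i \<in> A \<Longrightarrow> \<pi> i = i \<Longrightarrow> f i = 0"
    and no3: "\<And>i. i \<in> A \<Longrightarrow> \<pi> (\<pi> (\<pi> i)) = i \<Longrightarrow> \<pi> i = i"
  shows "\<exists>S\<subseteq>A. S \<inter> \<pi> ` S = {} \<and> 2 / 5 * sum f A \<le> sum f S"
  using assms
proof (induction "card A" arbitrary: A rule: less_induct)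
  case less
  note fin = less.prems(1) and inj = less.prems(2) and img = less.prems(3) and f = less.prems(4,5)
    and no3 = less.prems(6)
  show ?case
  proof (cases "A = {}")
    case True
    then show ?thesis by auto
  next
    case False
    then obtain a where a: "a \<in> A" by blast
    have bij: "bij_betw \<pi> A A" using inj img by (simp add: bij_betw_def)
    have bijk: "bij_betw (\<pi> ^^ k) A A" for k by (rule bij_betw_funpow[OF bij])
    have inA: "(\<pi> ^^ k) x \<in> A" if "x \<in> A" for k x using bijk[of k] that by (auto simp: bij_betw_def)
    have "\<not> inj (\<lambda>k. (\<pi> ^^ k) a)"
    proof
      assume "inj (\<lambda>k. (\<pi> ^^ k) a)"
      then have "infinite (range (\<lambda>k. (\<pi> ^^ k) a))" by (rule range_inj_infinite)
      then show False using fin inA[OF a] by (meson finite_subset image_subset_iff)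
    qed
    then obtain k l where kl: "k < l" "(\<pi> ^^ k) a = (\<pi> ^^ l) a"
      by (metis (no_types, lifting) injI linorder_neqE_nat)
    have "(\<pi> ^^ l) a = (\<pi> ^^ k) ((\<pi> ^^ (l - k)) a)"
      using kl by (metis comp_apply funpow_add le_add_diff_inverse less_or_eq_imp_le)
    then have "(\<pi> ^^ (l - k)) a = a"
      using kl bijk[of k] a inA[OF a] by (metis bij_betw_def inj_onD)
    then have ex: "\<exists>n. n > 0 \<and> (\<pi> ^^ n) a = a" using kl by (metis zero_less_diff)
    \<comment> \<open>\<open>L\<close> is the length of the cycle \<open>C\<close> through
      \<open>a\<close>. This cycle is treated by averaging, the rest \<open>B\<close> by the
      induction hypothesis.\<close>
    define L where "L = (LEAST n. n > 0 \<and> (\<pi> ^^ n) a = a)"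
    have L: "L > 0" "(\<pi> ^^ L) a = a" using LeastI_ex[OF ex] by (auto simp: L_def)
    have Lmin: "n \<ge> L" if "n > 0" "(\<pi> ^^ n) a = a" for n
      unfolding L_def using that by (intro Least_le) auto
    define C where "C = (\<lambda>k. (\<pi> ^^ k) a) ` {..<L}"
    have cmod: "(\<pi> ^^ k) a = (\<pi> ^^ (k mod L)) a" for k
      using L by (metis funpow_mod_eq)
    have inC: "(\<pi> ^^ k) a \<in> C" for k
      using L by (subst cmod) (auto simp: C_def)
    have CA: "C \<subseteq> A" using inA a by (auto simp: C_def)
    have finC: "finite C" by (simp add: C_def)
    have injc: "k = l" if "k < L" "l < L" "(\<pi> ^^ k) a = (\<pi> ^^ l) a" for k l
    proof -
      have *: False if "k < l" "l < L" "(\<pi> ^^ k) a = (\<pi> ^^ l) a" for k l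
      proof -
        have "(\<pi> ^^ l) a = (\<pi> ^^ k) ((\<pi> ^^ (l - k)) a)"
          using that by (metis comp_apply funpow_add le_add_diff_inverse less_or_eq_imp_le)
        then have "(\<pi> ^^ (l - k)) a = a"
          using that bijk[of k] a inA[OF a] by (metis bij_betw_def inj_onD)
        then show False using Lmin[of "l - k"] that by auto
      qed
      then show ?thesis using that by (metis linorder_neqE_nat)
    qed
    have perC: "(\<pi> ^^ L) x = x" if "x \<in> C" for x
      using that L by (auto simp: C_def) (metis comp_apply funpow_add add.commute)
    have minC: "L \<le> n" if "x \<in> C" "n > 0" "(\<pi> ^^ n) x = x" for n x
    proof -
      obtain k where "x = (\<pi> ^^ k) a" using \<open>x \<in> C\<close> by (auto simp: C_def)
      then have "(\<pi> ^^ k) ((\<pi> ^^ n) a) = (\<pi> ^^ k) a"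
        using that by (metis add.commute comp_apply funpow_add)
      then have "(\<pi> ^^ n) a = a" using bijk[of k] a inA[OF a] by (metis bij_betw_def inj_onD)
      then show ?thesis using Lmin that by blast
    qed
    have neqC: "(\<pi> ^^ k) x \<noteq> (\<pi> ^^ l) x" if x: "x \<in> C" "k < l" "l < k + L" for x k l
    proof
      assume e: "(\<pi> ^^ k) x = (\<pi> ^^ l) x"
      have xA: "x \<in> A" using x CA by blast
      have "(\<pi> ^^ l) x = (\<pi> ^^ k) ((\<pi> ^^ (l - k)) x)"
        using x by (metis comp_apply funpow_add le_add_diff_inverse less_or_eq_imp_le)
      then have "(\<pi> ^^ (l - k)) x = x"
        using e bijk[of k] xA inA[OF xA] by (metis bij_betw_def inj_onD)
      then show False using minC[of x "l - k"] x by auto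
    qed
    have bijC: "bij_betw (\<pi> ^^ m) C C" for m
    proof -
      have "(\<pi> ^^ m) ` C \<subseteq> C"
      proof
        fix y assume "y \<in> (\<pi> ^^ m) ` C"
        then obtain k where "y = (\<pi> ^^ m) ((\<pi> ^^ k) a)" by (auto simp: C_def)
        then have "y = (\<pi> ^^ (m + k)) a" by (simp add: funpow_add)
        then show "y \<in> C" using inC by simp
      qed
      moreover have i: "inj_on (\<pi> ^^ m) C" using bijk[of m] CA by (auto simp: bij_betw_def intro: inj_on_subset)
      ultimately have "(\<pi> ^^ m) ` C = C" using finC by (simp add: endo_inj_surj)
      then show ?thesis using i by (simp add: bij_betw_def)
    qed
    have imgC: "\<pi> ` C = C" using bijC[of 1] by (simp add: bij_betw_def)
    define B where "B = A - C"
    have aC: "a \<in> C" using inC[of 0] by simp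
    have imgB: "\<pi> ` B = B" unfolding B_def
      using inj img imgC CA by (metis inj_on_image_set_diff Diff_subset)
    have "card B < card A" unfolding B_def using aC a fin by (intro psubset_card_mono) auto
    then obtain SB where SB: "SB \<subseteq> B" "SB \<inter> \<pi> ` SB = {}" "2 / 5 * sum f B \<le> sum f SB"
      using less.hyps[of B] fin inj imgB f no3 by (auto simp: B_def inj_on_def)
    define h where "h = L div 2"
    \<comment> \<open>The points at even distance below \<open>2 * h\<close> from \<open>x\<close>.
      For odd \<open>L\<close> the last point of the cycle is left out, so no two chosen points are
      neighbours, even across the closing step.\<close>
    define T where "T x = (\<lambda>t. (\<pi> ^^ (2 * t)) x) ` {..<h}" for x
    have TC: "T x \<subseteq> C" if "x \<in> C" for x
      using bijC that by (auto simp: T_def bij_betw_def)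
    have Tdisj: "T x \<inter> \<pi> ` T x = {}" if x: "x \<in> C" for x
    proof -
      have "(\<pi> ^^ (2 * t)) x \<noteq> \<pi> ((\<pi> ^^ (2 * s)) x)" if "t < h" "s < h" for s t
      proof -
        have "(\<pi> ^^ (2 * t)) x \<noteq> (\<pi> ^^ Suc (2 * s)) x"
        proof (cases "2 * t < Suc (2 * s)")
          case True
          then show ?thesis using that neqC[OF x, of "2 * t" "Suc (2 * s)"] by (auto simp: h_def)
        next
          case False
          then have "Suc (2 * s) < 2 * t" by presburger
          moreover have "2 * t < Suc (2 * s) + L" using that unfolding h_def by linarith
          ultimately show ?thesis using neqC[OF x, of "Suc (2 * s)" "2 * t"] by metis
        qed
        then show ?thesis by simp
      qed
      then show ?thesis by (auto simp: T_def)
    qed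
    have Tsum: "sum f (T x) = (\<Sum>t<h. f ((\<pi> ^^ (2 * t)) x))" if x: "x \<in> C" for x
    proof -
      have "inj_on (\<lambda>t. (\<pi> ^^ (2 * t)) x) {..<h}"
      proof (rule inj_onI, rule ccontr)
        fix s t assume st: "s \<in> {..<h}" "t \<in> {..<h}" "(\<pi> ^^ (2 * s)) x = (\<pi> ^^ (2 * t)) x" "s \<noteq> t"
        have "2 * s < 2 * t + L" "2 * t < 2 * s + L" using st(1,2) L(1) unfolding h_def lessThan_iff by linarith+
        then show False
          using st(3,4) neqC[OF x, of "2 * s" "2 * t"] neqC[OF x, of "2 * t" "2 * s"]
          by (metis linorder_neqE_nat mult_less_mono2 zero_less_numeral)
      qed
      then show ?thesis by (simp add: T_def sum.reindex)
    qed
    have "(\<Sum>x\<in>C. sum f (T x)) = (\<Sum>x\<in>C. \<Sum>t<h. f ((\<pi> ^^ (2 * t)) x))" using Tsum by simp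
    also have "\<dots> = (\<Sum>t<h. \<Sum>x\<in>C. f ((\<pi> ^^ (2 * t)) x))" by (rule sum.swap)
    also have "\<dots> = (\<Sum>t<h. sum f C)" by (intro sum.cong refl sum.reindex_bij_betw bijC)
    finally have tot: "(\<Sum>x\<in>C. sum f (T x)) = h * sum f C" by simp
    have cardC: "card C = L" unfolding C_def using injc by (subst card_image) (auto simp: inj_on_def)
    \<comment> \<open>The average of \<open>sum f (T x)\<close> over the \<open>L\<close> starting
      points is \<open>h / L\<close> times the sum over the cycle, so some starting point attains
      it.\<close>
    have "\<exists>x\<in>C. h * sum f C \<le> L * sum f (T x)"
    proof (rule ccontr)
      assume "\<not> ?thesis"
      then have "L * sum f (T x) < h * sum f C" if "x \<in> C" for x using that by force
      then have "(\<Sum>x\<in>C. L * sum f (T x)) < (\<Sum>x\<in>C. h * sum f C)" using finC aC by (intro sum_strict_mono) auto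
      then show False using tot cardC by (simp add: sum_distrib_left[symmetric])
    qed
    then obtain x where x: "x \<in> C" "h * sum f C \<le> L * sum f (T x)" by blast
    have sumC: "sum f C \<ge> 0" using f CA by (intro sum_nonneg) auto
    have "2 / 5 * sum f C \<le> sum f (T x)"
    \<comment> \<open>At a fixed point \<open>h = 0\<close> and \<open>T x\<close> is empty; the
      claim survives because \<open>f\<close> vanishes there.\<close>
    proof (cases "L = 1")
      case True
      then have "\<pi> a = a" using L by simp
      moreover have "C = {a}" using True by (auto simp: C_def)
      ultimately show ?thesis using f(2)[OF a] True by (simp add: T_def h_def)
    next
      case False
      have "L \<noteq> 3"
      proof
        assume "L = 3"
        then have "\<pi> (\<pi> (\<pi> a)) = a" using L by (simp add: numeral_3_eq_3)
        then have "\<pi> a = a" using no3 a by blast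
        then show False using Lmin[of 1] \<open>L = 3\<close> by simp
      qed
      \<comment> \<open>\<open>L div 2\<close> is at least two fifths of \<open>L\<close> for every
        positive length other than 1 and 3, with equality at 5.\<close>
      then have "2 * L \<le> 5 * h" using False L(1) unfolding h_def by presburger
      then have "2 * real L \<le> 5 * real h" by linarith
      then have "2 * real L * sum f C \<le> 5 * (h * sum f C)" using sumC mult_right_mono by fastforce
      also have "\<dots> \<le> 5 * (L * sum f (T x))" using x by simp
      finally have "L * (2 * sum f C) \<le> L * (5 * sum f (T x))" by (simp add: mult_ac)
      then have "2 * sum f C \<le> 5 * sum f (T x)" using L(1) by simp
      then show ?thesis by simp
    qed
    moreover have "T x \<subseteq> C" using TC x by blast
    moreover have "sum f A = sum f C + sum f B" unfolding B_def using fin CA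
      by (metis add.commute sum.subset_diff)
    moreover have "sum f (T x \<union> SB) = sum f (T x) + sum f SB"
      using \<open>T x \<subseteq> C\<close> SB(1) finC fin by (intro sum.union_disjoint) (auto simp: B_def intro: finite_subset)
    ultimately have "2 / 5 * sum f A \<le> sum f (T x \<union> SB)" using SB(3) by (simp add: algebra_simps)
    moreover have "\<pi> ` T x \<subseteq> C" "\<pi> ` SB \<subseteq> B" using TC[OF x(1)] imgC imgB SB(1) by blast+
    then have "(T x \<union> SB) \<inter> \<pi> ` (T x \<union> SB) = {}"
      using Tdisj[OF x(1)] SB(1,2) TC[OF x(1)] by (auto simp: B_def)
    moreover have "T x \<union> SB \<subseteq> A" using TC[OF x(1)] CA SB(1) by (auto simp: B_def)
    ultimately show ?thesis by blast
  qed
qed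

text \<open>Loops of weight 0 absorb the missing degree. Since the matrix lists every edge in both
  orientations, its weight is twice that of the fractional matching, which turns the 2/5 of the
  alternating set into 4/5.\<close>

lemma fractional_matching_rounding:
  fixes E :: "('n::finite \<times> 'n) set" and y :: "'n \<Rightarrow> 'n \<Rightarrow> real"
  assumes G: "weighted_graph E w"
    and nonneg: "\<And>i j. y i j \<ge> 0" and sym: "\<And>i j. y i j = y j i"
    and supp: "\<And>i j. y i j > 0 \<Longrightarrow> (i, j) \<in> E \<or> (j, i) \<in> E"
    and deg: "\<And>i. (\<Sum>j\<in>UNIV. y i j) \<le> 1"
    and triangle_free: "\<And>i j k. y i j > 0 \<Longrightarrow> y j k > 0 \<Longrightarrow> y k i > 0 \<Longrightarrow> False"
  shows "\<exists>M. matching E M \<and> 4 / 5 * (\<Sum>(i, j)\<in>E. w i j * y i j) \<le> matching_weight E w M"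
proof -
  have noloop: "(i, i) \<notin> E" for i using G by (auto simp: weighted_graph_def)
  have oneway: "(j, i) \<notin> E" if "(i, j) \<in> E" for i j using G that by (auto simp: weighted_graph_def)
  have y0: "y i j = 0" if "(i, j) \<notin> E" "(j, i) \<notin> E" for i j
    using supp[of i j] nonneg[of i j] that by (metis order_le_less)
  define W where "W i j = (if (i, j) \<in> E then w i j else if (j, i) \<in> E then w j i else 0)" for i j
  define X where "X i j = (if i = j then 1 - (\<Sum>k\<in>UNIV. y i k) else y i j)" for i j
  have rows: "(\<Sum>j\<in>UNIV. X i j) = 1" for i
  proof -
    have "(\<Sum>j\<in>UNIV. X i j) = X i i + (\<Sum>j\<in>UNIV - {i}. y i j)"
      by (subst sum.remove[of UNIV i]) (auto simp: X_def intro!: sum.cong)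
    also have "(\<Sum>j\<in>UNIV - {i}. y i j) = (\<Sum>j\<in>UNIV. y i j)"
      using y0[of i i] noloop by (simp add: sum_diff1)
    finally show ?thesis by (simp add: X_def)
  qed
  have "X i j = X j i" for i j using sym by (simp add: X_def)
  then have cols: "(\<Sum>i\<in>UNIV. X i j) = 1" for j using rows[of j] by simp
  have Xnn: "X i j \<ge> 0" for i j using deg[of i] nonneg by (auto simp: X_def)
  obtain \<pi> where pi: "inj \<pi>" "\<And>i. 0 < X i (\<pi> i)"
    "(\<Sum>i\<in>UNIV. \<Sum>j\<in>UNIV. W i j * X i j) \<le> (\<Sum>i\<in>UNIV. W i (\<pi> i))"
    using doubly_stochastic_permutation[of X W] Xnn rows cols by blast
  have Wii: "W i i = 0" for i using noloop by (simp add: W_def)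
  have Wnn: "W i j \<ge> 0" for i j using G by (auto simp: W_def weighted_graph_def)
  have ypi: "y i (\<pi> i) > 0" if "\<pi> i \<noteq> i" for i using pi(2)[of i] that by (simp add: X_def split: if_splits)
  \<comment> \<open>A three-cycle of \<pi> would lie in the support of \<open>y\<close> and form a
    triangle.\<close>
  have tri: "\<pi> i = i" if "\<pi> (\<pi> (\<pi> i)) = i" for i
  proof (rule ccontr)
    assume n: "\<pi> i \<noteq> i"
    then have "\<pi> (\<pi> i) \<noteq> \<pi> i" "\<pi> (\<pi> (\<pi> i)) \<noteq> \<pi> (\<pi> i)" using pi(1) by (auto simp: inj_eq)
    then show False using triangle_free[of i "\<pi> i" "\<pi> (\<pi> i)"] ypi n that by metis
  qed
  have "\<pi> ` UNIV = UNIV" using pi(1) by (metis finite finite_UNIV_inj_surj)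
  then obtain S where S: "S \<inter> \<pi> ` S = {}" "2 / 5 * (\<Sum>i\<in>UNIV. W i (\<pi> i)) \<le> (\<Sum>i\<in>S. W i (\<pi> i))"
    using permutation_alternating_set[of UNIV \<pi> "\<lambda>i. W i (\<pi> i)"] pi(1) Wnn Wii tri by auto
  have nofix: "\<pi> i \<noteq> i" if "i \<in> S" for i using S(1) that by force
  \<comment> \<open>\<open>g\<close> picks the stored orientation of the edge between
    \<open>i\<close> and \<open>\<pi> i\<close>. Injectivity of \<pi> and disjointness of
    \<open>S\<close> from its image make these edges pairwise disjoint.\<close>
  define g where "g i = (if (i, \<pi> i) \<in> E then (i, \<pi> i) else (\<pi> i, i))" for i
  have gE: "g i \<in> E" if "i \<in> S" for i using supp[OF ypi[OF nofix[OF that]]] by (auto simp: g_def)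
  have gset: "{fst (g i), snd (g i)} = {i, \<pi> i}" for i by (auto simp: g_def)
  have disj: "{i, \<pi> i} \<inter> {j, \<pi> j} = {}" if "i \<in> S" "j \<in> S" "i \<noteq> j" for i j
    using S(1) that pi(1) by (auto simp: inj_eq)
  have ginj: "inj_on g S"
  proof (rule inj_onI, rule ccontr)
    fix i j assume ij: "i \<in> S" "j \<in> S" "g i = g j" "i \<noteq> j"
    then show False using disj[of i j] gset[of i] gset[of j] by auto
  qed
  define M :: "'n \<times> 'n \<Rightarrow> nat" where "M e = (if e \<in> g ` S then 1 else 0)" for e
  have "matching E M"
    unfolding matching_def
  proof (intro conjI ballI impI)
    fix e f assume "M e = 1 \<and> M f = 1 \<and> e \<noteq> f"
    then obtain i j where "i \<in> S" "j \<in> S" "e = g i" "f = g j" "i \<noteq> j"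
      by (auto simp: M_def split: if_splits)
    then show "{fst e, snd e} \<inter> {fst f, snd f} = {}" using disj gset by simp
  qed (auto simp: M_def)
  moreover have "matching_weight E w M = (\<Sum>i\<in>S. W i (\<pi> i))"
  proof -
    have "matching_weight E w M = (\<Sum>e\<in>g ` S. w (fst e) (snd e))"
      unfolding matching_weight_def using gE
      by (intro sum.mono_neutral_cong_right) (auto simp: M_def case_prod_unfold)
    also have "\<dots> = (\<Sum>i\<in>S. w (fst (g i)) (snd (g i)))"
      using ginj by (simp add: sum.reindex)
    also have "\<dots> = (\<Sum>i\<in>S. W i (\<pi> i))"
    proof (rule sum.cong[OF refl])
      show "w (fst (g i)) (snd (g i)) = W i (\<pi> i)" if "i \<in> S" for i
        using gE[OF that] by (auto simp: g_def W_def split: if_splits)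
    qed
    finally show ?thesis .
  qed
  moreover have "(\<Sum>i\<in>UNIV. \<Sum>j\<in>UNIV. W i j * X i j) = 2 * (\<Sum>(i, j)\<in>E. w i j * y i j)"
  proof -
    have "(\<Sum>i\<in>UNIV. \<Sum>j\<in>UNIV. W i j * X i j) = (\<Sum>(i, j)\<in>UNIV. W i j * y i j)"
      unfolding sum.cartesian_product UNIV_Times_UNIV using Wii
      by (intro sum.cong) (auto simp: X_def)
    also have "\<dots> = (\<Sum>(i, j)\<in>E \<union> E\<inverse>. W i j * y i j)"
      by (intro sum.mono_neutral_right) (auto simp: W_def split: if_splits)
    also have "\<dots> = (\<Sum>(i, j)\<in>E. W i j * y i j) + (\<Sum>(i, j)\<in>E\<inverse>. W i j * y i j)"
      using oneway by (intro sum.union_disjoint) auto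
    also have "(\<Sum>(i, j)\<in>E\<inverse>. W i j * y i j) = (\<Sum>(i, j)\<in>E. W j i * y j i)"
      by (intro sum.reindex_bij_witness[of _ prod.swap prod.swap]) auto
    also have "\<dots> = (\<Sum>(i, j)\<in>E. w i j * y i j)"
      using oneway sym by (intro sum.cong) (auto simp: W_def)
    also have "(\<Sum>(i, j)\<in>E. W i j * y i j) = (\<Sum>(i, j)\<in>E. w i j * y i j)"
      by (intro sum.cong) (auto simp: W_def)
    finally show ?thesis by simp
  qed
  ultimately show ?thesis using S(2) pi(3) by (intro exI[of _ M]) simp
qed

section \<open>Pauli matrices\<close>

lemma tensor_mult: "tensor f ** tensor g = tensor (\<lambda>i. f i ** g i)"
proof -
  have "(\<Sum>k\<in>UNIV. (\<Prod>i\<in>UNIV. f i $ a i $ k i) * (\<Prod>i\<in>UNIV. g i $ k i $ b i)) =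
    (\<Prod>i\<in>UNIV. \<Sum>k\<in>UNIV. f i $ a i $ k * g i $ k $ b i)" for a b :: "'a \<Rightarrow> 2"
    by (simp add: prod_sum_PiE prod.distrib[symmetric] PiE_UNIV_domain)
  then show ?thesis by (simp add: tensor_def matrix_matrix_mult_def vec_eq_iff)
qed

lemma trace_tensor: "trace (tensor f) = (\<Prod>i\<in>UNIV. trace (f i))"
  by (simp add: tensor_def trace_def prod_sum_PiE PiE_UNIV_domain)

lemma tensor_mat_1: "tensor (\<lambda>_. mat 1) = (mat 1 :: ('n::finite) qop)"
proof -
  have "(\<Prod>i\<in>UNIV. (mat 1 :: complex ^ 2 ^ 2) $ a i $ b i) = (mat 1 :: 'n qop) $ a $ b" for a b
    by (cases "a = b") (auto simp: mat_def fun_eq_iff)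
  then show ?thesis
    by (simp add: tensor_def vec_eq_iff)
qed

lemma trace_mat_1: "trace (mat 1 :: ('n::finite) qop) = 2 ^ CARD('n)"
  unfolding tensor_mat_1[symmetric] trace_tensor by (simp add: trace_def mat_def)

lemma on_qubit_mult: "on_qubit A i ** on_qubit B i = on_qubit (A ** B) i"
  unfolding on_qubit_def tensor_mult by (rule arg_cong[where f=tensor]) (auto simp: fun_eq_iff)

lemma on_qubit_commute:
  assumes "i \<noteq> j"
  shows "on_qubit A i ** on_qubit B j = on_qubit B j ** on_qubit A i"
  unfolding on_qubit_def tensor_mult using assms by (intro arg_cong[where f=tensor]) (auto simp: fun_eq_iff)

lemma on_qubit_mat_1: "on_qubit (mat 1) i = mat 1"
  unfolding on_qubit_def by (simp add: fun_upd_idem tensor_mat_1)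

lemma tensor_upd_entry:
  "tensor (f(i := A)) $ a $ b = A $ a i $ b i * (\<Prod>j\<in>UNIV - {i}. f j $ a j $ b j)"
  by (auto simp: tensor_def prod.remove[of UNIV i] intro!: prod.cong)

lemma tensor_upd_add: "tensor (f(i := A + B)) = tensor (f(i := A)) + tensor (f(i := B))"
  by (simp only: vec_eq_iff tensor_upd_entry vector_add_component) (simp add: algebra_simps)

lemma tensor_upd_scaleR: "tensor (f(i := c *\<^sub>R A)) = c *\<^sub>R tensor (f(i := A))"
  by (simp only: vec_eq_iff tensor_upd_entry vector_scaleR_component) (simp add: algebra_simps)

lemma on_qubit_add: "on_qubit (A + B) i = on_qubit A i + on_qubit B i"
  by (simp add: on_qubit_def tensor_upd_add)

lemma on_qubit_scaleR: "on_qubit (c *\<^sub>R A) i = c *\<^sub>R on_qubit A i"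
  by (simp add: on_qubit_def tensor_upd_scaleR)


section \<open>Bilinearity of matrix products and linearity of the trace\<close>

lemma matrix_mult_distribs:
  fixes A B :: "complex ^ 'n ^ 'm" and C D :: "complex ^ 'p ^ 'n"
  shows "(A + B) ** C = A ** C + B ** C" "A ** (C + D) = A ** C + A ** D"
    "(A - B) ** C = A ** C - B ** C" "A ** (C - D) = A ** C - A ** D"
    "(- A) ** C = - (A ** C)" "A ** (- C) = - (A ** C)"
    "(r *\<^sub>R A) ** C = r *\<^sub>R (A ** C)" "A ** (r *\<^sub>R C) = r *\<^sub>R (A ** C)"
  by (simp_all add: matrix_matrix_mult_def vec_eq_iff sum.distrib sum_subtractf sum_negf
      scaleR_sum_right algebra_simps)

lemma matrix_mult_sum_right:
  fixes A :: "complex ^ 'n ^ 'm" and B :: "'a \<Rightarrow> complex ^ 'p ^ 'n"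
  shows "A ** sum B S = (\<Sum>x\<in>S. A ** B x)"
proof (cases "finite S")
  case True
  then show ?thesis
    by induct (simp_all add: matrix_mult_distribs matrix_matrix_mult_def[of _ 0] vec_eq_iff)
next
  case False
  then show ?thesis by (simp add: matrix_matrix_mult_def vec_eq_iff)
qed

lemma trace_linear:
  fixes A B :: "complex ^ 'n ^ 'n"
  shows "trace (- A) = - trace A" "trace (r *\<^sub>R A) = r *\<^sub>R trace A"
  by (simp_all add: trace_def sum_negf scaleR_sum_right)

lemma trace_sum:
  fixes B :: "'a \<Rightarrow> complex ^ 'n ^ 'n"
  shows "trace (sum B S) = (\<Sum>x\<in>S. trace (B x))"
proof (cases "finite S")
  case True
  then show ?thesis by induct (simp_all add: trace_add trace_def[of 0])
next
  case False
  then show ?thesis by (simp add: trace_def)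
qed

text \<open>Complex phases are written as scalar matrices \<open>mat s\<close>, because the scaling
  used for operators is by reals only; these rules move and merge the phases.\<close>

lemma mat_mult_commute: "mat s ** A = A ** mat (s :: complex)" for A :: "complex ^ 'n ^ 'n"
  by (simp add: matrix_matrix_mult_def mat_def vec_eq_iff if_distrib[of "\<lambda>z. z * _"]
      if_distrib[of "\<lambda>z. _ * z"] mult.commute cong: if_cong)

lemma mat_mult_mat: "mat s ** mat t = (mat (s * t) :: complex ^ 'n ^ 'n)"
  by (simp add: matrix_matrix_mult_def mat_def vec_eq_iff if_distrib[of "\<lambda>z. z * _"] cong: if_cong)

lemma mat_minus_1_mult: "mat (- 1) ** A = - A" for A :: "complex ^ 'n ^ 'n"
  by (simp add: matrix_matrix_mult_def mat_def vec_eq_iff if_distrib[of "\<lambda>z. z * _"] cong: if_cong)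

lemma on_qubit_mat: "on_qubit (mat s) i = mat s"
proof -
  have "on_qubit (mat s) i $ a $ b = (mat s :: 'a qop) $ a $ b" for a b
    unfolding on_qubit_def tensor_upd_entry by (cases "a = b") (auto simp: mat_def fun_eq_iff)
  then show ?thesis by (simp add: vec_eq_iff)
qed

text \<open>Indexing by the type \<open>3\<close> makes the interaction of an edge a sum over
  \<open>c\<close> and aligns it with the components of a Bloch vector.\<close>

definition pauli :: "3 \<Rightarrow> complex ^ 2 ^ 2" where
  "pauli c = vector [pauli_X, pauli_Y, pauli_Z] $ c"

lemma pauli_simps: "pauli 1 = pauli_X" "pauli 2 = pauli_Y" "pauli 3 = pauli_Z"
  by (simp_all add: pauli_def)

text \<open>Meant for distinct arguments, where it is the remaining index.\<close>

definition third_index :: "3 \<Rightarrow> 3 \<Rightarrow> 3" where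
  "third_index c d = (if c \<noteq> 1 \<and> d \<noteq> 1 then 1 else if c \<noteq> 2 \<and> d \<noteq> 2 then 2 else 3)"

text \<open>The phase is \<i> or its negative, depending on the order of the factors. Only its
  square is recorded, since on a pair of qubits the phase occurs twice.\<close>

lemma pauli_mult:
  "pauli c ** pauli c = mat 1"
  "c \<noteq> d \<Longrightarrow> \<exists>s. s * s = - 1 \<and> pauli c ** pauli d = mat s ** pauli (third_index c d)"
  "c \<noteq> d \<Longrightarrow> pauli c ** pauli d = - (pauli d ** pauli c)"
proof -
  have XYZ: "pauli_X ** pauli_X = mat 1" "pauli_Y ** pauli_Y = mat 1" "pauli_Z ** pauli_Z = mat 1"
    "pauli_X ** pauli_Y = mat \<i> ** pauli_Z" "pauli_Y ** pauli_Z = mat \<i> ** pauli_X"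
    "pauli_Z ** pauli_X = mat \<i> ** pauli_Y" "pauli_Y ** pauli_X = mat (- \<i>) ** pauli_Z"
    "pauli_Z ** pauli_Y = mat (- \<i>) ** pauli_X" "pauli_X ** pauli_Z = mat (- \<i>) ** pauli_Y"
    "mat (- \<i>) ** A = - (mat \<i> ** A)" for A :: "complex ^ 2 ^ 2"
    by (auto simp: pauli_X_def pauli_Y_def pauli_Z_def matrix_matrix_mult_def vec_eq_iff forall_2
      sum_2 mat_def)
  show "pauli c ** pauli c = mat 1"
    using exhaust_3[of c] XYZ by (auto simp: pauli_simps)
  show "\<exists>s. s * s = - 1 \<and> pauli c ** pauli d = mat s ** pauli (third_index c d)" if "c \<noteq> d"
    using exhaust_3[of c] exhaust_3[of d] XYZ that
    by (auto simp: pauli_simps third_index_def)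
      ((rule exI[of _ \<i>], simp; fail | rule exI[of _ "- \<i>"], simp; fail)+)
  show "pauli c ** pauli d = - (pauli d ** pauli c)" if "c \<noteq> d"
    using exhaust_3[of c] exhaust_3[of d] that by (auto simp: pauli_simps XYZ)
qed

lemma trace_pauli: "trace (pauli c) = 0"
  using exhaust_3[of c]
  by (auto simp: pauli_simps pauli_X_def pauli_Y_def pauli_Z_def trace_def sum_2)

definition pauli_at :: "3 \<Rightarrow> 'n \<Rightarrow> ('n::finite) qop" where
  "pauli_at c i = on_qubit (pauli c) i"

definition pauli_pair :: "3 \<Rightarrow> 'n \<Rightarrow> 'n \<Rightarrow> ('n::finite) qop" where
  "pauli_pair c i j = pauli_at c i ** pauli_at c j"

lemma edge_op_eq: "edge_op i j = mat 1 - (\<Sum>c\<in>UNIV. pauli_pair c i j)"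
  by (simp add: edge_op_def pauli_pair_def pauli_at_def pauli_simps sum_3 algebra_simps)

lemma pauli_at_square: "pauli_at c i ** pauli_at c i = mat 1"
  by (simp add: pauli_at_def on_qubit_mult pauli_mult on_qubit_mat_1)

lemma pauli_at_commute: "i \<noteq> j \<Longrightarrow> pauli_at c i ** pauli_at d j = pauli_at d j ** pauli_at c i"
  by (simp add: pauli_at_def on_qubit_commute)

lemma on_qubit_minus: "on_qubit (- A) i = - on_qubit A i"
  using on_qubit_scaleR[of "- 1" A i] by simp

lemma pauli_at_anticommute: "c \<noteq> d \<Longrightarrow> pauli_at c i ** pauli_at d i = - (pauli_at d i ** pauli_at c i)"
  using pauli_mult(3)[of c d] by (simp add: pauli_at_def on_qubit_mult on_qubit_minus)

lemma pauli_pair_sym: "i \<noteq> j \<Longrightarrow> pauli_pair c i j = pauli_pair c j i"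
  by (simp add: pauli_pair_def pauli_at_commute)

lemma pauli_pair_square:
  assumes "i \<noteq> j" shows "pauli_pair c i j ** pauli_pair c i j = mat 1"
proof -
  have "pauli_pair c i j ** pauli_pair c i j = pauli_at c i ** (pauli_at c j ** pauli_at c i) ** pauli_at c j"
    by (simp add: pauli_pair_def matrix_mul_assoc)
  also have "\<dots> = (pauli_at c i ** pauli_at c i) ** (pauli_at c j ** pauli_at c j)"
    using assms by (simp add: pauli_at_commute[of j i] matrix_mul_assoc)
  finally show ?thesis by (simp add: pauli_at_square)
qed

text \<open>Both qubits contribute the same phase, whose square is - 1. The result is symmetric in
  \<open>c\<close> and \<open>d\<close>, so pairs on the same two qubits commute although their
  single-qubit factors do not.\<close>

lemma pauli_pair_mult:
  assumes "i \<noteq> j" "c \<noteq> d"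
  shows "pauli_pair c i j ** pauli_pair d i j = - pauli_pair (third_index c d) i j"
proof -
  obtain s where s: "s * s = - 1" "pauli c ** pauli d = mat s ** pauli (third_index c d)"
    using pauli_mult(2)[OF assms(2)] by blast
  have *: "pauli_at c k ** pauli_at d k = mat s ** pauli_at (third_index c d) k" for k :: 'a
    by (simp add: pauli_at_def on_qubit_mult s(2)) (simp add: on_qubit_mult[symmetric] on_qubit_mat)
  have "pauli_pair c i j ** pauli_pair d i j = pauli_at c i ** (pauli_at c j ** pauli_at d i) ** pauli_at d j"
    by (simp add: pauli_pair_def matrix_mul_assoc)
  also have "\<dots> = (pauli_at c i ** pauli_at d i) ** (pauli_at c j ** pauli_at d j)"
    using assms by (simp add: pauli_at_commute[of j i] matrix_mul_assoc)
  also have "\<dots> = mat s ** (pauli_at (third_index c d) i ** mat s) ** pauli_at (third_index c d) j"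
    by (simp add: * matrix_mul_assoc)
  also have "\<dots> = (mat s ** mat s) ** pauli_pair (third_index c d) i j"
    by (simp only: mat_mult_commute[of s "pauli_at (third_index c d) i", symmetric] matrix_mul_assoc pauli_pair_def)
  finally show ?thesis by (simp add: mat_mult_mat s mat_minus_1_mult)
qed

text \<open>With A the sum of the three pairs, the product rule gives A^2 = 3 - 2 A and hence (1 -
  A)^2 = 4 (1 - A).\<close>

lemma edge_op_square:
  assumes "i \<noteq> j"
  shows "edge_op i j ** edge_op i j = 4 *\<^sub>R edge_op i j"
  by (simp add: edge_op_eq sum_3 matrix_mult_distribs pauli_pair_square[OF assms]
      pauli_pair_mult[OF assms] third_index_def algebra_simps) (simp add: vec_eq_iff scaleR_conv_of_real)

lemma pauli_at_commute_edge_op: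
  assumes "k \<noteq> i" "k \<noteq> j"
  shows "pauli_at c k ** edge_op i j = edge_op i j ** pauli_at c k"
proof -
  have "pauli_at c k ** pauli_pair d i j = pauli_pair d i j ** pauli_at c k" for d
  proof -
    have "pauli_at c k ** pauli_pair d i j = (pauli_at c k ** pauli_at d i) ** pauli_at d j"
      by (simp add: pauli_pair_def matrix_mul_assoc)
    also have "\<dots> = pauli_at d i ** (pauli_at c k ** pauli_at d j)"
      by (simp only: pauli_at_commute[OF assms(1)] matrix_mul_assoc)
    also have "\<dots> = pauli_pair d i j ** pauli_at c k"
      by (simp only: pauli_at_commute[OF assms(2)] matrix_mul_assoc pauli_pair_def)
    finally show ?thesis .
  qed
  then show ?thesis by (simp add: edge_op_eq sum_3 matrix_mult_distribs)
qed

lemma pauli_pair_commute_edge_op: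
  assumes "i \<noteq> j"
  shows "pauli_pair c i j ** edge_op i j = edge_op i j ** pauli_pair c i j"
proof -
  have "pauli_pair c i j ** pauli_pair d i j = pauli_pair d i j ** pauli_pair c i j" for d
    using assms by (cases "c = d") (simp_all add: pauli_pair_mult third_index_def)
  then show ?thesis by (simp add: edge_op_eq sum_3 matrix_mult_distribs)
qed

text \<open>Conjugation by the involution \<open>U\<close> preserves the trace, fixes
  \<open>\<rho>\<close> and negates \<open>T\<close>. This evaluates the matching state without
  multiplying out its singlets.\<close>

lemma trace_zero_by_symmetry:
  fixes U \<rho> T :: "complex ^ 'n ^ 'n"
  assumes "U ** U = mat 1" "U ** \<rho> = \<rho> ** U" "U ** T = - (T ** U)"
  shows "trace (\<rho> ** T) = 0"
proof -
  have "trace (\<rho> ** T) = trace ((\<rho> ** T ** U) ** U)"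
    by (simp add: matrix_mul_assoc[symmetric] assms(1))
  also have "\<dots> = trace (U ** \<rho> ** (T ** U))"
    by (subst trace_mul_sym) (simp add: matrix_mul_assoc)
  also have "\<dots> = trace (\<rho> ** (U ** T) ** U)"
    by (simp add: assms(2) matrix_mul_assoc)
  also have "\<dots> = - trace (\<rho> ** T ** U ** U)"
    by (simp add: assms(3) matrix_mult_distribs trace_linear matrix_mul_assoc)
  also have "\<dots> = - trace (\<rho> ** T)"
    by (simp add: matrix_mul_assoc[symmetric] assms(1))
  finally show ?thesis by simp
qed

lemma pauli_at_anticommute_pair:
  assumes "i \<noteq> j" "c \<noteq> d"
  shows "pauli_at d i ** pauli_pair c i j = - (pauli_pair c i j ** pauli_at d i)"
proof -
  have "pauli_at d i ** pauli_pair c i j = - (pauli_at c i ** (pauli_at d i ** pauli_at c j))"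
    using pauli_at_anticommute[of d c i] assms by (simp add: pauli_pair_def matrix_mul_assoc matrix_mult_distribs)
  also have "\<dots> = - (pauli_pair c i j ** pauli_at d i)"
    by (simp only: pauli_at_commute[OF assms(1)] pauli_pair_def matrix_mul_assoc)
  finally show ?thesis .
qed

text \<open>Qubit \<open>i\<close> is the only shared one, and two distinct Pauli matrices meet
  there, so exactly one sign arises.\<close>

lemma pauli_pair_anticommute:
  assumes "i \<noteq> j" "i \<noteq> k" "j \<noteq> k" "c \<noteq> d"
  shows "pauli_pair d i k ** pauli_pair c i j = - (pauli_pair c i j ** pauli_pair d i k)"
proof -
  have "pauli_at d k ** pauli_pair c i j = pauli_at d k ** pauli_at c i ** pauli_at c j"
    by (simp add: pauli_pair_def matrix_mul_assoc)
  also have "\<dots> = pauli_at c i ** (pauli_at d k ** pauli_at c j)"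
    by (simp only: pauli_at_commute[OF assms(2)[symmetric]] matrix_mul_assoc)
  also have "\<dots> = pauli_pair c i j ** pauli_at d k"
    by (simp only: pauli_at_commute[OF assms(3)[symmetric]] matrix_mul_assoc pauli_pair_def)
  finally have k: "pauli_at d k ** pauli_pair c i j = pauli_pair c i j ** pauli_at d k" .
  have "pauli_pair d i k ** pauli_pair c i j = pauli_at d i ** (pauli_at d k ** pauli_pair c i j)"
    by (simp add: pauli_pair_def matrix_mul_assoc)
  also have "\<dots> = pauli_at d i ** pauli_pair c i j ** pauli_at d k"
    by (simp add: k matrix_mul_assoc)
  also have "\<dots> = - (pauli_pair c i j ** (pauli_at d i ** pauli_at d k))"
    by (simp add: pauli_at_anticommute_pair[OF assms(1,4)] matrix_mult_distribs matrix_mul_assoc)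
  finally show ?thesis by (simp add: pauli_pair_def)
qed

section \<open>Energies of the two candidate states\<close>

lemma op_prod_empty: "op_prod f {} = mat 1"
  by (simp add: op_prod_def)

text \<open>Pairwise commutation makes the fold independent of the order, so that any chosen factor
  can be put in front.\<close>

lemma op_prod_insert:
  assumes comm: "\<And>x y. x \<in> insert e S \<Longrightarrow> y \<in> insert e S \<Longrightarrow> f x ** f y = f y ** f x"
    and "finite S" "e \<notin> S"
  shows "op_prod f (insert e S) = f e ** op_prod f S"
proof -
  interpret comp_fun_commute_on "insert e S" "\<lambda>i A. f i ** A"
    by unfold_locales (auto simp: fun_eq_iff matrix_mul_assoc comm)
  show ?thesis unfolding op_prod_def using assms by (intro fold_insert) auto
qed

lemma op_prod_commute:
  assumes comm: "\<And>x y. x \<in> S \<Longrightarrow> y \<in> S \<Longrightarrow> f x ** f y = f y ** f x" and "finite S"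
    and U: "\<And>x. x \<in> S \<Longrightarrow> U ** f x = f x ** U"
  shows "U ** op_prod f S = op_prod f S ** U"
  using assms(2,1,3)
proof (induction S)
  case empty
  then show ?case by (simp add: op_prod_empty)
next
  case (insert e S)
  have "U ** (f e ** op_prod f S) = f e ** (U ** op_prod f S)"
    using insert.prems(2)[of e] by (simp add: matrix_mul_assoc)
  also have "\<dots> = f e ** op_prod f S ** U"
    using insert by (simp add: matrix_mul_assoc)
  finally have "U ** (f e ** op_prod f S) = f e ** op_prod f S ** U" .
  moreover have "op_prod f (insert e S) = f e ** op_prod f S"
    using insert by (intro op_prod_insert) auto
  ultimately show ?case by simp
qed

lemma op_prod_on_qubit:
  assumes "finite S"
  shows "op_prod (\<lambda>i. on_qubit (B i) i) S = tensor (\<lambda>i. if i \<in> S then B i else mat 1)"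
  using assms
proof induction
  case empty
  then show ?case by (simp add: op_prod_empty tensor_mat_1)
next
  case (insert e S)
  have comm: "on_qubit (B i) i ** on_qubit (B j) j = on_qubit (B j) j ** on_qubit (B i) i" for i j
    by (cases "i = j") (auto simp: on_qubit_commute)
  have "op_prod (\<lambda>i. on_qubit (B i) i) (insert e S) =
      on_qubit (B e) e ** tensor (\<lambda>i. if i \<in> S then B i else mat 1)"
    using insert comm by (simp add: op_prod_insert)
  also have "\<dots> = tensor (\<lambda>i. if i \<in> insert e S then B i else mat 1)"
    unfolding on_qubit_def tensor_mult using insert(2) by (intro arg_cong[where f=tensor]) (auto simp: fun_eq_iff)
  finally show ?case .
qed

definition bloch :: "real ^ 3 \<Rightarrow> complex ^ 2 ^ 2" where
  "bloch u = (1 / 2) *\<^sub>R (mat 1 + (\<Sum>c\<in>UNIV. (u $ c) *\<^sub>R pauli c))"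

lemma product_state_eq: "product_state u = tensor (\<lambda>i. bloch (u i))"
proof -
  have "(1 / 2) *\<^sub>R (mat 1 + (u i $ 1) *\<^sub>R X_at i + (u i $ 2) *\<^sub>R Y_at i + (u i $ 3) *\<^sub>R Z_at i)
      = on_qubit (bloch (u i)) i" for i
    by (simp add: bloch_def sum_3 pauli_simps on_qubit_scaleR on_qubit_add on_qubit_mat_1 add.assoc)
  then show ?thesis by (simp add: product_state_def op_prod_on_qubit)
qed

lemma trace_bloch: "trace (bloch u) = 1"
  by (simp add: bloch_def trace_linear trace_add trace_sum trace_pauli)
     (simp add: trace_def mat_def scaleR_conv_of_real)

lemma trace_bloch_pauli: "trace (bloch u ** pauli c) = of_real (u $ c)"
proof -
  have "trace (pauli d ** pauli c) = (if c = d then 2 else 0)" for d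
  proof (cases "c = d")
    case True
    then show ?thesis by (simp add: pauli_mult(1)) (simp add: trace_def mat_def)
  next
    case False
    \<comment> \<open>Anticommutation reverses the sign of the product, cyclicity of the trace does
      not.\<close>
    have "trace (pauli d ** pauli c) = - trace (pauli d ** pauli c)"
      using pauli_mult(3)[of d c] False by (metis trace_linear(1) trace_mul_sym)
    then show ?thesis using False by simp
  qed
  then have "trace ((\<Sum>d\<in>UNIV. (u $ d) *\<^sub>R pauli d) ** pauli c) = 2 * of_real (u $ c)"
    using exhaust_3[of c] by (auto simp: sum_3 matrix_mult_distribs trace_add trace_linear)
      (simp_all add: scaleR_conv_of_real)
  then show ?thesis
    by (simp add: bloch_def matrix_mult_distribs trace_linear trace_add trace_pauli)
qed

lemma trace_product_state_pauli_pair: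
  assumes "i \<noteq> j"
  shows "trace (product_state u ** pauli_pair c i j) = of_real (u i $ c * u j $ c)"
proof -
  have "trace (product_state u ** pauli_pair c i j) =
    (\<Prod>k\<in>UNIV. trace (bloch (u k) ** (((\<lambda>_. mat 1)(i := pauli c)) k ** ((\<lambda>_. mat 1)(j := pauli c)) k)))"
    by (simp add: product_state_eq pauli_pair_def pauli_at_def on_qubit_def tensor_mult trace_tensor)
  \<comment> \<open>Every other qubit contributes the trace of its Bloch matrix, which is 1.\<close>
  also have "\<dots> = (\<Prod>k\<in>{i, j}. trace (bloch (u k) ** pauli c))"
    using assms by (intro prod.mono_neutral_cong_right) (auto simp: trace_bloch)
  also have "\<dots> = of_real (u i $ c * u j $ c)"
    using assms by (simp add: trace_bloch_pauli)
  finally show ?thesis .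
qed

lemma trace_product_state_edge_op:
  assumes "i \<noteq> j"
  shows "trace (product_state u ** edge_op i j) = of_real (1 - u i \<bullet> u j)"
proof -
  have "trace (product_state u) = 1"
    by (simp add: product_state_eq trace_tensor trace_bloch)
  then show ?thesis
    by (simp add: edge_op_eq matrix_mult_distribs matrix_mult_sum_right trace_sub trace_sum
        trace_product_state_pauli_pair[OF assms] inner_vec_def)
qed

lemma energy_eq:
  "energy (qmc_hamiltonian E w) \<rho> = (\<Sum>(i, j)\<in>E. w i j / 4 * Re (trace (\<rho> ** edge_op i j)))"
  by (simp add: energy_def qmc_hamiltonian_def matrix_mult_sum_right trace_sum case_prod_unfold
      matrix_mult_distribs trace_linear)

lemma energy_product_state:
  assumes "weighted_graph E w"
  shows "energy (qmc_hamiltonian E w) (product_state u) = (\<Sum>(i, j)\<in>E. w i j / 4 * (1 - u i \<bullet> u j))"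
  unfolding energy_eq using assms
  by (intro sum.cong) (auto simp: weighted_graph_def trace_product_state_edge_op)

lemma pauli_pair_commute_edge_op_disjoint:
  assumes "{i, j} \<inter> {k, l} = {}"
  shows "pauli_pair c i j ** edge_op k l = edge_op k l ** pauli_pair c i j"
proof -
  have "pauli_pair c i j ** edge_op k l = pauli_at c i ** (pauli_at c j ** edge_op k l)"
    by (simp add: pauli_pair_def matrix_mul_assoc)
  also have "\<dots> = pauli_at c i ** edge_op k l ** pauli_at c j"
    using assms pauli_at_commute_edge_op[of j k l c] by (auto simp: matrix_mul_assoc[symmetric])
  also have "\<dots> = edge_op k l ** pauli_at c i ** pauli_at c j"
    using assms pauli_at_commute_edge_op[of i k l c] by auto
  finally show ?thesis by (simp add: pauli_pair_def matrix_mul_assoc)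
qed

lemma edge_op_commute_disjoint:
  assumes "{i, j} \<inter> {k, l} = {}"
  shows "edge_op i j ** edge_op k l = edge_op k l ** edge_op i j"
  by (simp add: edge_op_eq[of i j] sum_3 matrix_mult_distribs pauli_pair_commute_edge_op_disjoint[OF assms])

lemma ex_other_index: "\<exists>d::3. d \<noteq> c"
  by (rule exI[of _ "if c = 1 then 2 else 1"]) auto

section \<open>Traces of products of singlet projectors\<close>

abbreviation singlets :: "('n \<times> 'n) set \<Rightarrow> ('n::finite) qop" where
  "singlets F \<equiv> op_prod (\<lambda>(i, j). (1 / 4) *\<^sub>R edge_op i j) F"

definition disjoint_edges :: "('n \<times> 'n) set \<Rightarrow> bool" where
  "disjoint_edges F \<longleftrightarrow> (\<forall>e\<in>F. fst e \<noteq> snd e) \<and>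
     (\<forall>e\<in>F. \<forall>f\<in>F. e \<noteq> f \<longrightarrow> {fst e, snd e} \<inter> {fst f, snd f} = {})"

lemma singlet_factors_commute:
  assumes "disjoint_edges F" "x \<in> F" "y \<in> F"
  shows "(case x of (i, j) \<Rightarrow> (1 / 4) *\<^sub>R edge_op i j) ** (case y of (i, j) \<Rightarrow> (1 / 4) *\<^sub>R edge_op i j) =
     (case y of (i, j) \<Rightarrow> (1 / 4) *\<^sub>R edge_op i j) ** (case x of (i, j) \<Rightarrow> (1 / 4) *\<^sub>R edge_op i j)"
proof (cases "x = y")
  case False
  then have "{fst x, snd x} \<inter> {fst y, snd y} = {}" using assms by (auto simp: disjoint_edges_def)
  then show ?thesis by (auto simp: case_prod_unfold matrix_mult_distribs edge_op_commute_disjoint)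
qed simp

lemma singlets_commute_pauli_at:
  fixes F :: "('n::finite \<times> 'n) set"
  assumes "disjoint_edges F" "\<And>e. e \<in> F \<Longrightarrow> k \<notin> {fst e, snd e}"
  shows "pauli_at c k ** singlets F = singlets F ** pauli_at c k"
  using assms
  by (intro op_prod_commute singlet_factors_commute)
     (auto simp: case_prod_unfold matrix_mult_distribs pauli_at_commute_edge_op)

lemma singlets_commute_pauli_pair:
  fixes F :: "('n::finite \<times> 'n) set"
  assumes "disjoint_edges F" "e \<in> F"
  shows "pauli_pair c (fst e) (snd e) ** singlets F = singlets F ** pauli_pair c (fst e) (snd e)"
proof -
  have "pauli_pair c (fst e) (snd e) ** edge_op (fst f) (snd f) =
     edge_op (fst f) (snd f) ** pauli_pair c (fst e) (snd e)" if "f \<in> F" for f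
  proof (cases "f = e")
    case True
    then show ?thesis using assms by (auto simp: disjoint_edges_def intro!: pauli_pair_commute_edge_op)
  next
    case False
    then show ?thesis using assms that
      by (intro pauli_pair_commute_edge_op_disjoint) (auto simp: disjoint_edges_def)
  qed
  then show ?thesis using assms
    by (intro op_prod_commute singlet_factors_commute) (auto simp: case_prod_unfold matrix_mult_distribs)
qed

text \<open>No factor touches qubit \<open>i\<close>, so a Pauli matrix on \<open>i\<close> other
  than \<open>pauli c\<close> commutes with the product but anticommutes with the pair.\<close>

lemma trace_singlets_uncovered:
  fixes F :: "('n::finite \<times> 'n) set"
  assumes F: "disjoint_edges F" and "i \<noteq> j" and i: "\<And>e. e \<in> F \<Longrightarrow> i \<notin> {fst e, snd e}"
  shows "trace (singlets F ** pauli_pair c i j) = 0"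
proof -
  obtain d where "d \<noteq> c" using ex_other_index by blast
  then show ?thesis
    using singlets_commute_pauli_at[OF F i] pauli_at_anticommute_pair[OF assms(2)]
    by (intro trace_zero_by_symmetry[of "pauli_at d i"] pauli_at_square) auto
qed

text \<open>If \<open>i\<close> is matched to some \<open>k\<close> other than \<open>j\<close>, the
  symmetry is \<open>pauli_pair d i k\<close> with \<open>d\<close> different from \<open>c\<close>:
  it commutes with every singlet factor and anticommutes with the pair at \<open>i\<close> and
  \<open>j\<close>.\<close>

lemma trace_singlets_not_partner:
  fixes F :: "('n::finite \<times> 'n) set"
  assumes F: "disjoint_edges F" and "i \<noteq> j" and ij: "(i, j) \<notin> F" "(j, i) \<notin> F"
  shows "trace (singlets F ** pauli_pair c i j) = 0"
proof (cases "\<forall>e\<in>F. i \<notin> {fst e, snd e}")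
  case True
  then show ?thesis using trace_singlets_uncovered[OF F \<open>i \<noteq> j\<close>] by blast
next
  case False
  then obtain e where e: "e \<in> F" "i \<in> {fst e, snd e}" by blast
  obtain d where d: "d \<noteq> c" using ex_other_index by blast
  define k where "k = (if i = fst e then snd e else fst e)"
  have ne: "fst e \<noteq> snd e" using e F by (auto simp: disjoint_edges_def)
  then have k: "i \<noteq> k" "j \<noteq> k" using e ij \<open>i \<noteq> j\<close> by (auto simp: k_def)
  have "pauli_pair d (fst e) (snd e) = pauli_pair d i k"
    using e(2) pauli_pair_sym[OF ne] by (auto simp: k_def)
  then have "pauli_pair d i k ** singlets F = singlets F ** pauli_pair d i k"
    using singlets_commute_pauli_pair[OF F e(1)] by metis
  then show ?thesis
    using pauli_pair_anticommute[OF \<open>i \<noteq> j\<close> k, of c d] d k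
    by (intro trace_zero_by_symmetry[of "pauli_pair d i k"] pauli_pair_square) auto
qed

text \<open>Once an edge is split off, its endpoints are uncovered by the remaining factors. Hence
  only the identity inside \<open>edge_op\<close> contributes, and each edge costs a factor
  1/4.\<close>

lemma trace_singlets:
  fixes F :: "('n::finite \<times> 'n) set"
  assumes "disjoint_edges F"
  shows "trace (singlets F) = 2 ^ CARD('n) / 4 ^ card F"
proof -
  have "finite F" by simp
  then show ?thesis using assms
  proof induction
    case empty
    then show ?case by (simp add: op_prod_empty trace_mat_1)
  next
    case (insert e F)
    have F: "disjoint_edges F" using insert.prems by (auto simp: disjoint_edges_def)
    have ne: "fst e \<noteq> snd e" using insert.prems by (auto simp: disjoint_edges_def)
    have un: "fst e \<notin> {fst f, snd f}" if "f \<in> F" for f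
      using insert.prems insert.hyps that by (auto simp: disjoint_edges_def)
    have "singlets (insert e F) = (case e of (i, j) \<Rightarrow> (1 / 4) *\<^sub>R edge_op i j) ** singlets F"
      using insert singlet_factors_commute[OF insert.prems] by (intro op_prod_insert) auto
    then have "trace (singlets (insert e F)) = (1 / 4) *\<^sub>R trace (singlets F ** edge_op (fst e) (snd e))"
      by (simp add: case_prod_unfold matrix_mult_distribs trace_linear
          trace_mul_sym[of "edge_op (fst e) (snd e)"])
    also have "trace (singlets F ** edge_op (fst e) (snd e)) = trace (singlets F)"
      using trace_singlets_uncovered[OF F ne un]
      by (simp add: edge_op_eq matrix_mult_distribs matrix_mult_sum_right trace_sub trace_sum)
    also have "trace (singlets F) = 2 ^ CARD('n) / 4 ^ card F" by (rule insert.IH[OF F])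
    also have "(1 / 4) *\<^sub>R (2 ^ CARD('n) / 4 ^ card F) = (2 ^ CARD('n) / 4 ^ card (insert e F) :: complex)"
      using insert.hyps by (simp add: scaleR_conv_of_real)
    finally show ?case .
  qed
qed

lemma op_prod_half_mat_1:
  assumes "finite S"
  shows "op_prod (\<lambda>_. (1 / 2) *\<^sub>R mat 1) S = (1 / 2) ^ card S *\<^sub>R mat 1"
  using assms by induction (simp_all add: op_prod_empty op_prod_insert matrix_mult_distribs)

lemma card_uncovered:
  fixes E :: "('n::finite \<times> 'n) set"
  assumes "disjoint_edges {e \<in> E. M e = 1}"
  shows "CARD('n) = 2 * card {e \<in> E. M e = 1} + card (uncovered E M)"
proof -
  let ?F = "{e \<in> E. M e = 1}"
  have "card (\<Union>e\<in>?F. {fst e, snd e}) = (\<Sum>e\<in>?F. card {fst e, snd e})"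
    using assms unfolding disjoint_edges_def by (intro card_UN_disjoint) (simp, simp, blast)
  also have "\<dots> = 2 * card ?F"
    using assms by (simp add: disjoint_edges_def)
  finally have "card (\<Union>e\<in>?F. {fst e, snd e}) = 2 * card ?F" .
  moreover have "uncovered E M = UNIV - (\<Union>e\<in>?F. {fst e, snd e})"
    by (auto simp: uncovered_def)
  then have "card (uncovered E M) = CARD('n) - card (\<Union>e\<in>?F. {fst e, snd e})"
    by (simp add: card_Diff_subset)
  moreover have "card (\<Union>e\<in>?F. {fst e, snd e}) \<le> CARD('n)" by (intro card_mono) auto
  ultimately show ?thesis by simp
qed

text \<open>On a matched edge the state is an eigenoperator of \<open>edge_op\<close> with
  eigenvalue 4; on any other edge all Pauli pairs have trace 0 and only the identity
  remains.\<close>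

lemma energy_matching_state:
  fixes E :: "('n::finite \<times> 'n) set"
  assumes G: "weighted_graph E w" and M: "matching E M"
  shows "energy (qmc_hamiltonian E w) (matching_state E M) =
    (\<Sum>(i, j)\<in>E. w i j * (1 / 4 + 3 / 4 * M (i, j)))"
proof -
  define F where "F = {e \<in> E. M e = 1}"
  have F: "disjoint_edges F"
    unfolding disjoint_edges_def
  proof (intro conjI ballI impI)
    show "fst e \<noteq> snd e" if "e \<in> F" for e using that G by (auto simp: F_def weighted_graph_def)
    show "{fst e, snd e} \<inter> {fst f, snd f} = {}" if "e \<in> F" "f \<in> F" "e \<noteq> f" for e f
      using that M unfolding matching_def F_def by blast
  qed
  define r :: real where "r = (1 / 2) ^ card (uncovered E M)"
  have \<rho>: "matching_state E M = r *\<^sub>R singlets F"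
    by (simp add: matching_state_def F_def[symmetric] op_prod_half_mat_1 matrix_mult_distribs r_def
        del: One_nat_def)
  \<comment> \<open>The state has trace 1: the quotient equals 2 to the number of uncovered qubits,
    which \<open>r\<close> compensates.\<close>
  have "r * (2 ^ CARD('n) / 4 ^ card F) = 1"
    using card_uncovered[of E M] F unfolding F_def[symmetric]
    by (simp add: r_def power_add power_mult power_one_over)
  then have "complex_of_real (r * (2 ^ CARD('n) / 4 ^ card F)) = 1"
    by (simp only: of_real_1)
  then have tr1: "r *\<^sub>R trace (singlets F) = 1"
    by (simp only: trace_singlets[OF F] scaleR_conv_of_real[of r "_ / _"] of_real_mult of_real_divide
        of_real_power of_real_numeral)
  have "Re (trace (matching_state E M ** edge_op i j)) = 1 + 3 * M (i, j)" if e: "(i, j) \<in> E" for i j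
  proof (cases "M (i, j) = 1")
    case True
    then have iF: "(i, j) \<in> F" and ne: "i \<noteq> j" using e F by (auto simp: F_def disjoint_edges_def)
    \<comment> \<open>Exposes the factor of this edge at the front, where
      \<open>edge_op_square\<close> applies.\<close>
    have iF': "insert (i, j) (F - {(i, j)}) = F" using iF by blast
    have "singlets (insert (i, j) (F - {(i, j)})) =
        (case (i, j) of (i, j) \<Rightarrow> (1 / 4) *\<^sub>R edge_op i j) ** singlets (F - {(i, j)})"
      unfolding iF' by (intro op_prod_insert[of "(i, j)" "F - {(i, j)}", unfolded iF'] singlet_factors_commute[OF F]) auto
    then have s: "singlets F = (1 / 4) *\<^sub>R edge_op i j ** singlets (F - {(i, j)})"
      unfolding iF' by simp
    have "trace (singlets F ** edge_op i j) = trace (edge_op i j ** singlets F)"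
      by (rule trace_mul_sym)
    also have "edge_op i j ** singlets F = 4 *\<^sub>R singlets F"
      unfolding s by (simp add: matrix_mul_assoc matrix_mult_distribs edge_op_square[OF ne])
    finally have "trace (singlets F ** edge_op i j) = 4 *\<^sub>R trace (singlets F)"
      by (simp add: trace_linear)
    then have "trace (matching_state E M ** edge_op i j) = 4 *\<^sub>R (r *\<^sub>R trace (singlets F))"
      by (simp add: \<rho> matrix_mult_distribs trace_linear)
    then show ?thesis using True tr1 by simp
  next
    case False
    then have M0: "M (i, j) = 0" using M e by (force simp: matching_def)
    have "(i, j) \<notin> F" "(j, i) \<notin> F" "i \<noteq> j"
      using False e G by (auto simp: F_def weighted_graph_def)
    then have "trace (singlets F ** edge_op i j) = trace (singlets F)"
      using trace_singlets_not_partner[OF F, of i j]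
      by (simp add: edge_op_eq matrix_mult_distribs matrix_mult_sum_right trace_sub trace_sum)
    then have "trace (matching_state E M ** edge_op i j) = r *\<^sub>R trace (singlets F)"
      by (simp add: \<rho> matrix_mult_distribs trace_linear)
    then show ?thesis using M0 tr1 by simp
  qed
  then show ?thesis unfolding energy_eq
    by (intro sum.cong) (auto simp: field_simps)
qed

section \<open>Monogamy of entanglement for feasible families\<close>

lemma pauli_at_mem: "pauli_at c i \<in> pauli_matrices 2"
proof -
  have "card {k. ((\<lambda>_. mat 1)(i := pauli c)) k \<noteq> mat 1} \<le> card {i}"
    by (intro card_mono) auto
  moreover have "pauli c \<in> {mat 1, pauli_X, pauli_Y, pauli_Z}" for c
    using exhaust_3[of c] by (auto simp: pauli_simps)
  ultimately show ?thesis
    unfolding pauli_matrices_def pauli_at_def on_qubit_def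
    by (intro CollectI exI[of _ "(\<lambda>_. mat 1)(i := pauli c)"]) auto
qed

lemma pauli_pair_mem:
  assumes "i \<noteq> j" shows "pauli_pair c i j \<in> pauli_matrices 2"
proof -
  define f where "f k = (if k = i \<or> k = j then pauli c else mat 1)" for k
  have "pauli_pair c i j = tensor f"
    unfolding pauli_pair_def pauli_at_def on_qubit_def tensor_mult using assms
    by (intro arg_cong[where f=tensor]) (auto simp: fun_eq_iff f_def)
  moreover have "card {k. f k \<noteq> mat 1} \<le> card {i, j}"
    by (intro card_mono) (auto simp: f_def)
  moreover have "pauli c \<in> {mat 1, pauli_X, pauli_Y, pauli_Z}" for c
    using exhaust_3[of c] by (auto simp: pauli_simps)
  ultimately show ?thesis
    using assms unfolding pauli_matrices_def by (intro CollectI exI[of _ f]) (auto simp: f_def)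
qed

lemma feasible_norm: "lasserre2_feasible v \<Longrightarrow> P \<in> pauli_matrices 2 \<Longrightarrow> v P \<bullet> v P = 1"
  unfolding lasserre2_feasible_def by blast

lemma feasible_zero:
  assumes "lasserre2_feasible v" "P \<in> pauli_matrices 2" "Q \<in> pauli_matrices 2" "P ** Q + Q ** P = 0"
  shows "v P \<bullet> v Q = 0"
  using assms unfolding lasserre2_feasible_def by blast

lemma feasible_eq:
  assumes "lasserre2_feasible v" "P\<^sub>1 \<in> pauli_matrices 2" "Q\<^sub>1 \<in> pauli_matrices 2"
    "P\<^sub>2 \<in> pauli_matrices 2" "Q\<^sub>2 \<in> pauli_matrices 2" "P\<^sub>1 ** Q\<^sub>1 = P\<^sub>2 ** Q\<^sub>2"
  shows "v P\<^sub>1 \<bullet> v Q\<^sub>1 = v P\<^sub>2 \<bullet> v Q\<^sub>2"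
proof -
  have "P\<^sub>1 ** Q\<^sub>1 = 1 *\<^sub>R (P\<^sub>2 ** Q\<^sub>2)" using assms by simp
  then have "v P\<^sub>1 \<bullet> v Q\<^sub>1 = 1 * (v P\<^sub>2 \<bullet> v Q\<^sub>2)"
    using assms(1-5) unfolding lasserre2_feasible_def by blast
  then show ?thesis by simp
qed

lemma feasible_eq_minus:
  assumes "lasserre2_feasible v" "P\<^sub>1 \<in> pauli_matrices 2" "Q\<^sub>1 \<in> pauli_matrices 2"
    "P\<^sub>2 \<in> pauli_matrices 2" "Q\<^sub>2 \<in> pauli_matrices 2" "P\<^sub>1 ** Q\<^sub>1 = - (P\<^sub>2 ** Q\<^sub>2)"
  shows "v P\<^sub>1 \<bullet> v Q\<^sub>1 = - (v P\<^sub>2 \<bullet> v Q\<^sub>2)"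
proof -
  have "P\<^sub>1 ** Q\<^sub>1 = (- 1) *\<^sub>R (P\<^sub>2 ** Q\<^sub>2)" using assms by simp
  then have "v P\<^sub>1 \<bullet> v Q\<^sub>1 = (- 1) * (v P\<^sub>2 \<bullet> v Q\<^sub>2)"
    using assms(1-5) unfolding lasserre2_feasible_def by blast
  then show ?thesis by simp
qed

text \<open>The vector standing for the operator XX + YY + ZZ on the two qubits.\<close>

definition heis :: "('n::finite) sdp_family \<Rightarrow> 'n \<Rightarrow> 'n \<Rightarrow> real ^ 'n pauli2" where
  "heis v i j = (\<Sum>c\<in>UNIV. v (pauli_pair c i j))"

text \<open>The pseudo-expectation of XX + YY + ZZ: three times the t of the overview, - 3 on a
  singlet.\<close>

definition corr :: "('n::finite) sdp_family \<Rightarrow> 'n \<Rightarrow> 'n \<Rightarrow> real" where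
  "corr v i j = v (mat 1) \<bullet> heis v i j"

lemma heis_sym: "i \<noteq> j \<Longrightarrow> heis v i j = heis v j i"
  by (simp add: heis_def pauli_pair_sym)

lemma corr_sym: "i \<noteq> j \<Longrightarrow> corr v i j = corr v j i"
  by (simp add: corr_def heis_sym)

lemma corr_eq_sum: "corr v i j = (\<Sum>c\<in>UNIV. v (mat 1) \<bullet> v (pauli_pair c i j))"
  by (simp add: corr_def heis_def inner_sum_right)

context
  fixes v :: "('n::finite) sdp_family"
  assumes feas: "lasserre2_feasible v"
begin

lemma inner_pauli_pair_same:
  assumes "i \<noteq> j" "c \<noteq> d"
  shows "v (pauli_pair c i j) \<bullet> v (pauli_pair d i j) = - (v (mat 1) \<bullet> v (pauli_pair (third_index c d) i j))"
  using pauli_pair_mult[OF assms] assms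
  by (intro feasible_eq_minus[OF feas] pauli_pair_mem mat_1_in_pauli_matrices) auto

text \<open>Equal Pauli matrices cancel on the shared qubit and leave the pair on \<open>j\<close>
  and \<open>k\<close>, so constraint (ii) applies. Distinct ones anticommute, so constraint (iii)
  applies.\<close>

lemma inner_pauli_pair_adjacent:
  assumes "i \<noteq> j" "i \<noteq> k" "j \<noteq> k"
  shows "v (pauli_pair c i j) \<bullet> v (pauli_pair d i k) = (if c = d then v (mat 1) \<bullet> v (pauli_pair c j k) else 0)"
proof (cases "c = d")
  case True
  have "pauli_pair c i j ** pauli_pair c i k = pauli_pair c j i ** pauli_pair c i k"
    using pauli_pair_sym[OF assms(1)] by simp
  also have "\<dots> = pauli_at c j ** (pauli_at c i ** pauli_at c i) ** pauli_at c k"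
    by (simp add: pauli_pair_def matrix_mul_assoc)
  also have "\<dots> = mat 1 ** pauli_pair c j k"
    by (simp add: pauli_at_square pauli_pair_def)
  finally show ?thesis using assms True
    by (auto intro!: feasible_eq[OF feas] pauli_pair_mem mat_1_in_pauli_matrices)
next
  case False
  have "pauli_pair c i j ** pauli_pair d i k = - (pauli_pair d i k ** pauli_pair c i j)"
    using pauli_pair_anticommute[OF assms(2,1) assms(3)[symmetric], of d c] False by simp
  then have "pauli_pair c i j ** pauli_pair d i k + pauli_pair d i k ** pauli_pair c i j = 0"
    by simp
  then show ?thesis using False assms by (auto intro: feasible_zero[OF feas] pauli_pair_mem)
qed

text \<open>The pseudo-expectation of the operator identity A^2 = 3 - 2 A behind
  \<open>edge_op_square\<close>.\<close>

lemma heis_square: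
  assumes "i \<noteq> j" shows "heis v i j \<bullet> heis v i j = 3 - 2 * corr v i j"
proof -
  have "v (pauli_pair c i j) \<bullet> v (pauli_pair c i j) = 1" for c
    using feas assms by (intro feasible_norm pauli_pair_mem) auto
  then show ?thesis
    by (simp add: corr_eq_sum heis_def sum_3 inner_add_left inner_add_right
        inner_pauli_pair_same[OF assms] third_index_def)
qed

lemma heis_adjacent:
  assumes "i \<noteq> j" "i \<noteq> k" "j \<noteq> k" shows "heis v i j \<bullet> heis v i k = corr v j k"
  by (simp add: corr_eq_sum heis_def sum_3 inner_add_left inner_add_right
        inner_pauli_pair_adjacent[OF assms])

lemma inner_one: "v (mat 1) \<bullet> v (mat 1) = 1"
  by (rule feasible_norm[OF feas mat_1_in_pauli_matrices])

lemma norm_one: "norm (v (mat 1)) = 1"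
  using inner_one by (simp add: norm_eq_sqrt_inner)

text \<open>The squared norm of the vector of \<open>edge_op\<close> is four times the
  pseudo-expectation of \<open>edge_op\<close>, which is therefore nonnegative.\<close>

lemma corr_le_1: assumes "i \<noteq> j" shows "corr v i j \<le> 1"
proof -
  have "0 \<le> (v (mat 1) - heis v i j) \<bullet> (v (mat 1) - heis v i j)" by simp
  also have "\<dots> = 4 - 4 * corr v i j"
    using heis_square[OF assms] inner_one by (simp add: inner_diff_left inner_diff_right corr_def inner_commute)
  finally show ?thesis by simp
qed

text \<open>Cauchy-Schwarz against the unit vector \<open>v (mat 1)\<close> gives corr^2 <= 3 - 2
  corr, a quadratic inequality with endpoints - 3 and 1.\<close>

lemma corr_ge: assumes "i \<noteq> j" shows "corr v i j \<ge> - 3"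
proof -
  have "\<bar>corr v i j\<bar> \<le> norm (heis v i j)"
    using Cauchy_Schwarz_ineq2[of "v (mat 1)" "heis v i j"] norm_one by (simp add: corr_def)
  then have "(corr v i j)\<^sup>2 \<le> heis v i j \<bullet> heis v i j"
    by (metis abs_ge_zero abs_le_square_iff abs_norm_cancel power2_norm_eq_inner)
  then have "(corr v i j + 3) * (corr v i j - 1) \<le> 0"
    using heis_square[OF assms] by (simp add: power2_eq_square algebra_simps)
  then show ?thesis using corr_le_1[OF assms]
    by (smt (verit) mult_neg_neg)
qed

text \<open>With \<open>A\<close> the sum of the Heisenberg terms of the star, \<open>(A + 1)\<^sup>2\<close> equals one plus the square of the
  total spin vector of the leaves, which is at most \<open>(d + 1)\<^sup>2\<close>.\<close>

lemma star_bound: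
  assumes "i \<notin> J"
  shows "(\<Sum>j\<in>J. corr v i j) \<ge> - (real (card J) + 2)"
proof -
  define h where "h = (\<Sum>j\<in>J. heis v i j)"
  define a where "a = (\<Sum>j\<in>J. corr v i j)"
  define d where "d = real (card J)"
  have fin: "finite J" by simp
  have "h \<bullet> h = (\<Sum>j\<in>J. \<Sum>k\<in>J. heis v i j \<bullet> heis v i k)"
    by (simp add: h_def inner_sum_left inner_sum_right) (rule sum.swap)
  also have "\<dots> \<le> (\<Sum>j\<in>J. \<Sum>k\<in>J. if k = j then 3 - 2 * corr v i j else 1)"
  proof (intro sum_mono)
    fix j k assume "j \<in> J" "k \<in> J"
    then have "i \<noteq> j" "i \<noteq> k" using assms by auto
    then show "heis v i j \<bullet> heis v i k \<le> (if k = j then 3 - 2 * corr v i j else 1)"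
      by (auto simp: heis_square heis_adjacent corr_le_1)
  qed
  also have "\<dots> = (\<Sum>j\<in>J. (3 - 2 * corr v i j) + (d - 1))"
  proof (rule sum.cong[OF refl])
    fix j assume j: "j \<in> J"
    have "(\<Sum>k\<in>J. if k = j then 3 - 2 * corr v i j else 1) =
      (3 - 2 * corr v i j) + (\<Sum>k\<in>J - {j}. if k = j then 3 - 2 * corr v i j else 1)"
      using j by (simp add: sum.remove)
    also have "(\<Sum>k\<in>J - {j}. if k = j then 3 - 2 * corr v i j else 1) = (\<Sum>k\<in>J - {j}. 1)"
      by (rule sum.cong) auto
    also have "\<dots> = d - 1"
    proof -
      have "card J = Suc (card (J - {j}))" using card_Suc_Diff1[OF fin j] by simp
      then show ?thesis by (simp add: d_def)
    qed
    finally show "(\<Sum>k\<in>J. if k = j then 3 - 2 * corr v i j else 1) = (3 - 2 * corr v i j) + (d - 1)" .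
  qed
  also have "\<dots> = d * (d + 2) - 2 * a"
    by (simp add: sum.distrib sum_subtractf a_def d_def sum_distrib_left[symmetric] algebra_simps)
  finally have hh: "h \<bullet> h \<le> d * (d + 2) - 2 * a" .
  have ha: "v (mat 1) \<bullet> h = a"
    by (simp add: h_def a_def corr_def inner_sum_right)
  \<comment> \<open>Adding \<open>v (mat 1)\<close> contributes 2 a + 1, which cancels the term - 2
    a and leaves a bound free of a.\<close>
  have "(v (mat 1) + h) \<bullet> (v (mat 1) + h) \<le> (d + 1)\<^sup>2"
    using hh ha inner_one by (simp add: inner_add_left inner_add_right inner_commute power2_eq_square algebra_simps)
  then have n: "norm (v (mat 1) + h) \<le> d + 1"
    by (simp add: norm_le_square d_def)
  have "\<bar>v (mat 1) \<bullet> (v (mat 1) + h)\<bar> \<le> norm (v (mat 1) + h)"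
    using Cauchy_Schwarz_ineq2[of "v (mat 1)" "v (mat 1) + h"] norm_one by simp
  then have "- (d + 1) \<le> 1 + a"
    using n ha inner_one by (simp add: inner_add_right)
  then show ?thesis by (simp add: a_def d_def)
qed

text \<open>In the squared norm of the sum of the three Heisenberg vectors each square contributes 3
  - 2 corr, and the cross terms add 2 corr for every edge. The correlations cancel, the norm is
  exactly 3, and Cauchy-Schwarz finishes.\<close>

lemma triangle_bound:
  assumes "i \<noteq> j" "i \<noteq> k" "j \<noteq> k"
  shows "corr v i j + corr v j k + corr v k i \<ge> - 3"
proof -
  define h where "h = heis v i j + heis v j k + heis v k i"
  have "heis v i j \<bullet> heis v j k = corr v k i" "heis v j k \<bullet> heis v k i = corr v i j"
      "heis v k i \<bullet> heis v i j = corr v j k"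
    using heis_adjacent[of j i k] heis_adjacent[of k j i] heis_adjacent[of i k j] assms
    by (simp_all add: heis_sym[of j i] heis_sym[of k j] heis_sym[of i k] corr_sym[of i k] corr_sym[of j i]
       corr_sym[of k j])
  then have "h \<bullet> h = 9"
    using assms heis_square by (simp add: h_def inner_add_left inner_add_right inner_commute)
  then have "norm h = 3"
    by (simp add: norm_eq_sqrt_inner)
  then have "\<bar>v (mat 1) \<bullet> h\<bar> \<le> 3"
    using Cauchy_Schwarz_ineq2[of "v (mat 1)" h] norm_one by simp
  then show ?thesis by (simp add: h_def corr_def inner_add_right)
qed

lemma stacked_inner: "stacked v i \<bullet> stacked v j = (\<Sum>c\<in>UNIV. v (pauli_at c i) \<bullet> v (pauli_at c j)) / 3"
proof -
  have s: "(vector [v (X_at i), v (Y_at i), v (Z_at i)] :: real ^ 'n pauli2 ^ 3) $ c = v (pauli_at c i)" for c i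
    using exhaust_3[of c] by (auto simp: pauli_at_def pauli_simps)
  have "stacked v i \<bullet> stacked v j = (\<Sum>(c, k)\<in>UNIV. (v (pauli_at c i) $ k / sqrt 3) * (v (pauli_at c j) $ k / sqrt 3))"
    by (simp add: stacked_def s inner_vec_def case_prod_unfold)
  also have "\<dots> = (\<Sum>c\<in>UNIV. \<Sum>k\<in>UNIV. (v (pauli_at c i) $ k / sqrt 3) * (v (pauli_at c j) $ k / sqrt 3))"
    unfolding UNIV_Times_UNIV[symmetric] by (rule sum.cartesian_product[symmetric])
  also have "\<dots> = (\<Sum>c\<in>UNIV. v (pauli_at c i) \<bullet> v (pauli_at c j)) / 3"
    by (simp add: inner_vec_def sum_divide_distrib)
  finally show ?thesis .
qed

lemma stacked_norm: "norm (stacked v i) = 1"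
proof -
  have "v (pauli_at c i) \<bullet> v (pauli_at c i) = 1" for c
    using feas by (intro feasible_norm pauli_at_mem)
  then have "stacked v i \<bullet> stacked v i = 1" by (simp add: stacked_inner)
  then show ?thesis by (simp add: norm_eq_sqrt_inner)
qed

text \<open>Constraint (ii) for the factorisations of a Pauli pair into two single-qubit matrices
  and into the identity times the pair. This links the rounded vectors to the SDP objective.\<close>

lemma stacked_inner_eq_corr:
  assumes "i \<noteq> j" shows "stacked v i \<bullet> stacked v j = corr v i j / 3"
proof -
  have "v (pauli_at c i) \<bullet> v (pauli_at c j) = v (mat 1) \<bullet> v (pauli_pair c i j)" for c
    using assms by (intro feasible_eq[OF feas] pauli_at_mem pauli_pair_mem mat_1_in_pauli_matrices)
      (simp_all add: pauli_pair_def)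
  then show ?thesis by (simp add: stacked_inner corr_eq_sum)
qed

end

lemma lasserre2_value_eq:
  assumes "lasserre2_feasible v"
  shows "lasserre2_value E w v = (\<Sum>(i, j)\<in>E. w i j / 4 * (1 - corr v i j))"
proof -
  have eq: "v (mat 1) - v (X_at i ** X_at j) - v (Y_at i ** Y_at j) - v (Z_at i ** Z_at j) = v (mat 1) - heis v i j" for i j
    by (simp add: heis_def sum_3 pauli_pair_def pauli_at_def pauli_simps)
  then show ?thesis
    by (simp only: lasserre2_value_def eq) (simp add: inner_diff_right inner_one[OF assms] corr_def)
qed

section \<open>The semidefinite program is a relaxation\<close>

text \<open>A maximiser of the Rayleigh quotient is an eigenvector. Together with the next lemma
  this shows that the set inside \<open>lambda_max\<close> is nonempty and finite, so that its
  \<open>Max\<close> is attained.\<close>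

lemma self_adjoint_has_eigenvector:
  fixes f :: "'a::euclidean_space \<Rightarrow> 'a"
  assumes lin: "linear f" and sa: "\<And>x y. f x \<bullet> y = x \<bullet> f y"
  shows "\<exists>l x. x \<noteq> 0 \<and> f x = l *\<^sub>R x"
proof -
  have cont: "continuous_on (sphere 0 1) (\<lambda>x. f x \<bullet> x)"
    by (intro continuous_intros linear_continuous_on linear_linear[THEN iffD2] lin)
  have "(SOME b. b \<in> (Basis :: 'a set)) \<in> sphere 0 1"
    by (simp add: some_in_eq)
  then obtain x where x: "x \<in> sphere 0 1" and max: "\<And>y. y \<in> sphere 0 1 \<Longrightarrow> f y \<bullet> y \<le> f x \<bullet> x"
    using continuous_attains_sup[OF _ _ cont] by (metis compact_sphere empty_iff)
  define l where "l = f x \<bullet> x"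
  have xx: "x \<bullet> x = 1" using x by (simp add: dot_square_norm)
  define b where "b y = l *\<^sub>R y - f y" for y
  have add: "f (y + z) = f y + f z" and scale: "f (r *\<^sub>R y) = r *\<^sub>R f y" for y z r
    using lin by (simp_all add: linear_add linear_scale)
  have pos: "b y \<bullet> y \<ge> 0" for y
  proof (cases "y = 0")
    case False
    define u where "u = y /\<^sub>R norm y"
    have "f u \<bullet> u \<le> l" unfolding l_def by (rule max) (use False in \<open>simp add: u_def\<close>)
    moreover have "f u \<bullet> u = (f y \<bullet> y) / (norm y)\<^sup>2"
      by (simp add: u_def scale power2_eq_square divide_inverse)
    ultimately have "f y \<bullet> y \<le> l * (norm y)\<^sup>2" using False by (simp add: divide_le_eq)
    then show ?thesis by (simp add: b_def inner_diff_left power2_norm_eq_inner)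
  qed simp
  define y where "y = b x"
  define a where "a = b x \<bullet> y"
  define c where "c = b y \<bullet> y"
  \<comment> \<open>The form of \<open>b\<close> is nonnegative and vanishes at \<open>x\<close>.
    Moving from \<open>x\<close> by \<open>t\<close> times \<open>b x\<close> would make it negative
    unless \<open>a\<close>, the squared norm of \<open>b x\<close>, is 0. The 1 in the denominator
    covers \<open>c = 0\<close>.\<close>
  define t where "t = - a / (c + 1)"
  have c: "c \<ge> 0" using pos by (simp add: c_def)
  have bxx: "b x \<bullet> x = 0" using xx by (simp add: b_def inner_diff_left l_def)
  have "b z \<bullet> u = z \<bullet> b u" for z u by (simp add: b_def inner_diff_left inner_diff_right sa)
  then have byx: "b y \<bullet> x = a" by (simp add: a_def inner_commute)
  have "b (x + t *\<^sub>R y) = b x + t *\<^sub>R b y"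
    by (simp add: b_def add scale algebra_simps)
  then have "b (x + t *\<^sub>R y) \<bullet> (x + t *\<^sub>R y) = 2 * t * a + t * t * c"
    using bxx byx by (simp add: inner_add_left inner_add_right a_def[symmetric] c_def[symmetric] algebra_simps)
  then have "0 \<le> (2 * t * a + t * t * c) * ((c + 1) * (c + 1))" using c pos[of "x + t *\<^sub>R y"] by simp
  also have "\<dots> = - (a * a * (c + 2))"
  proof -
    have "t * (c + 1) = - a" using c by (simp add: t_def)
    then show ?thesis by algebra
  qed
  finally have "a * a * (c + 2) \<le> 0" by simp
  then have "a = 0" using c by (smt (verit) mult_pos_pos not_real_square_gt_zero)
  then have "b x = 0" by (simp add: a_def y_def)
  then have "f x = l *\<^sub>R x" by (simp add: b_def)
  moreover have "x \<noteq> 0" using xx by auto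
  ultimately show ?thesis by blast
qed

text \<open>Eigenvectors for distinct eigenvalues are orthogonal, hence independent, so there are
  only finitely many eigenvalues.\<close>

lemma self_adjoint_finite_eigenvalues:
  fixes f :: "'a::euclidean_space \<Rightarrow> 'a"
  assumes sa: "\<And>x y. f x \<bullet> y = x \<bullet> f y"
  shows "finite {l :: real. \<exists>x. x \<noteq> 0 \<and> f x = l *\<^sub>R x}"
proof -
  define S where "S = {l :: real. \<exists>x. x \<noteq> 0 \<and> f x = l *\<^sub>R x}"
  have "\<forall>l\<in>S. \<exists>x. x \<noteq> 0 \<and> f x = l *\<^sub>R x" by (simp add: S_def)
  then obtain e where e: "\<And>l. l \<in> S \<Longrightarrow> e l \<noteq> 0 \<and> f (e l) = l *\<^sub>R e l" by metis
  have orth: "e l \<bullet> e m = 0" if "l \<in> S" "m \<in> S" "l \<noteq> m" for l m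
  proof -
    have "l * (e l \<bullet> e m) = m * (e l \<bullet> e m)"
      using sa[of "e l" "e m"] e that by simp
    then show ?thesis using that by simp
  qed
  have "inj_on e S"
    using orth e by (metis inj_onI inner_eq_zero_iff)
  moreover have "independent (e ` S)"
    using orth e by (intro pairwise_orthogonal_independent) (auto simp: pairwise_def orthogonal_def)
  then have "finite (e ` S)" by (rule independent_imp_finite)
  ultimately show ?thesis by (simp add: finite_image_iff S_def)
qed

lemma lambda_max_eigenvalue:
  fixes A :: "('n::finite) qop"
  assumes sa: "\<And>x y. (A *v x) \<bullet> y = x \<bullet> (A *v y)"
  shows "\<exists>x. norm x = 1 \<and> A *v x = lambda_max A *\<^sub>R x"
proof -
  \<comment> \<open>Real multiples agree with real scaling, so the complex state space can be
    treated as a real Euclidean space.\<close>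
  have sc: "complex_of_real l *s x = l *\<^sub>R x" for l and x :: "complex ^ ('n \<Rightarrow> 2)"
    by (simp add: vec_eq_iff) (simp add: scaleR_conv_of_real)
  have "linear ((*v) A)"
    by (rule linearI) (auto simp: vec_eq_iff matrix_vector_mult_def scaleR_sum_right algebra_simps sum.distrib)
  then have "{l :: real. \<exists>x. x \<noteq> 0 \<and> A *v x = l *\<^sub>R x} \<noteq> {}"
    using self_adjoint_has_eigenvector[of "(*v) A"] sa by blast
  moreover have "finite {l :: real. \<exists>x. x \<noteq> 0 \<and> A *v x = l *\<^sub>R x}"
    by (rule self_adjoint_finite_eigenvalues) (rule sa)
  ultimately have "lambda_max A \<in> {l :: real. \<exists>x. x \<noteq> 0 \<and> A *v x = l *\<^sub>R x}"
    unfolding lambda_max_def sc by (intro Max_in)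
  then obtain x where x: "x \<noteq> 0" "A *v x = lambda_max A *\<^sub>R x" by blast
  have "A *v (x /\<^sub>R norm x) = lambda_max A *\<^sub>R (x /\<^sub>R norm x)"
    using x(2) \<open>linear ((*v) A)\<close> by (simp add: linear_scale[of "(*v) A"])
  then show ?thesis using x(1) by (intro exI[of _ "x /\<^sub>R norm x"]) simp
qed

text \<open>The inner product here is the real part of the Hermitian form, for which a Hermitian
  matrix is still self-adjoint.\<close>

lemma hermitian_self_adjoint:
  fixes A :: "complex ^ 'n ^ 'n"
  assumes "\<And>a b. A $ a $ b = cnj (A $ b $ a)"
  shows "(A *v x) \<bullet> y = x \<bullet> (A *v y)"
proof -
  have c: "(s * z) \<bullet> u = z \<bullet> (cnj s * u)" for s z u :: complex
    by (simp add: inner_complex_def algebra_simps)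
  have "(A *v x) \<bullet> y = (\<Sum>a\<in>UNIV. \<Sum>b\<in>UNIV. (A $ a $ b * x $ b) \<bullet> y $ a)"
    by (simp add: inner_vec_def matrix_vector_mult_def inner_sum_left)
  also have "\<dots> = (\<Sum>a\<in>UNIV. \<Sum>b\<in>UNIV. x $ b \<bullet> (A $ b $ a * y $ a))"
    by (simp only: c assms[symmetric])
  also have "\<dots> = (\<Sum>b\<in>UNIV. \<Sum>a\<in>UNIV. x $ b \<bullet> (A $ b $ a * y $ a))" by (rule sum.swap)
  also have "\<dots> = x \<bullet> (A *v y)"
    by (simp add: inner_vec_def matrix_vector_mult_def inner_sum_right)
  finally show ?thesis .
qed

lemma pauli_matrices_self_adjoint:
  assumes "P \<in> pauli_matrices k"
  shows "(P *v x) \<bullet> y = x \<bullet> (P *v y)"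
proof (rule hermitian_self_adjoint)
  fix a b
  obtain f where f: "P = tensor f" "\<And>i. f i \<in> {mat 1, pauli_X, pauli_Y, pauli_Z}"
    using assms by (auto simp: pauli_matrices_def)
  have herm: "f i $ s $ t = cnj (f i $ t $ s)" for i s t
    using f(2)[of i] exhaust_2[of s] exhaust_2[of t]
    by (auto simp: pauli_X_def pauli_Y_def pauli_Z_def mat_def)
  have "(\<Prod>i\<in>UNIV. f i $ a i $ b i) = (\<Prod>i\<in>UNIV. cnj (f i $ b i $ a i))"
    by (rule prod.cong[OF refl]) (rule herm)
  then show "P $ a $ b = cnj (P $ b $ a)"
    by (simp add: f(1) tensor_def)
qed

lemma pauli_matrices_square:
  assumes "P \<in> pauli_matrices k" shows "P ** P = mat 1"
proof -
  obtain f where f: "P = tensor f" "\<And>i. f i \<in> {mat 1, pauli_X, pauli_Y, pauli_Z}"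
    using assms by (auto simp: pauli_matrices_def)
  have "f i ** f i = mat 1" for i
    using f(2)[of i] pauli_mult(1)[of 1] pauli_mult(1)[of 2] pauli_mult(1)[of 3]
    by (auto simp: pauli_simps)
  then show ?thesis by (simp add: f(1) tensor_mult tensor_mat_1)
qed

lemma matrix_vector_mult_distribs:
  fixes A B :: "complex ^ 'n ^ 'm"
  shows "(A - B) *v x = A *v x - B *v x" "(r *\<^sub>R A) *v x = r *\<^sub>R (A *v x)" "(0 :: complex ^ 'n ^ 'm) *v x = 0"
    "(A + B) *v x = A *v x + B *v x"
  by (simp_all add: vec_eq_iff matrix_vector_mult_def sum_subtractf sum.distrib scaleR_sum_right algebra_simps)

lemma matrix_vector_mult_sum:
  fixes A :: "'a \<Rightarrow> complex ^ 'n ^ 'm"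
  shows "sum A S *v x = (\<Sum>e\<in>S. A e *v x)"
  by (induction S rule: infinite_finite_induct) (simp_all add: matrix_vector_mult_distribs)

lemma card_pauli2: "CARD(('n::finite) pauli2) = card (pauli_matrices 2 :: 'n qop set)"
  using type_definition.card[OF type_definition_pauli2] by simp

text \<open>The vectors \<open>P *v \<psi>\<close> satisfy all constraints but live in the wrong
  space. Their real span has at most as many dimensions as there are matrices \<open>P\<close>, so
  it embeds isometrically into the space of SDP vectors.\<close>

lemma state_gives_feasible_family:
  fixes \<psi> :: "complex ^ (('n::finite) \<Rightarrow> 2)"
  assumes "norm \<psi> = 1"
  shows "\<exists>v :: 'n sdp_family. lasserre2_feasible v \<and>
    (\<forall>P\<in>pauli_matrices 2. \<forall>Q\<in>pauli_matrices 2. v P \<bullet> v Q = (P *v \<psi>) \<bullet> (Q *v \<psi>))"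
proof -
  define S where "S = span ((\<lambda>P :: 'n qop. P *v \<psi>) ` pauli_matrices 2)"
  have "dim S \<le> card ((\<lambda>P :: 'n qop. P *v \<psi>) ` pauli_matrices 2)"
    unfolding S_def dim_span by (intro dim_le_card' finite_imageI finite_pauli_matrices)
  also have "\<dots> \<le> card (pauli_matrices 2 :: 'n qop set)"
    by (intro card_image_le finite_pauli_matrices)
  also have "\<dots> = dim (UNIV :: (real ^ 'n pauli2) set)"
    by (simp add: card_pauli2)
  finally obtain f :: "complex ^ ('n \<Rightarrow> 2) \<Rightarrow> real ^ 'n pauli2"
    where f: "linear f" "\<And>x. x \<in> S \<Longrightarrow> norm (f x) = norm x"
    using isometry_subset_subspace[of S "UNIV :: (real ^ 'n pauli2) set"]
    by (metis S_def subspace_UNIV subspace_span)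
  have iso: "f x \<bullet> f y = x \<bullet> y" if "x \<in> S" "y \<in> S" for x y
  proof -
    have "x + y \<in> S" using that unfolding S_def by (rule span_add)
    then have "norm (f x + f y) = norm (x + y)" using f by (metis linear_add)
    then show ?thesis using f(2) that by (simp add: dot_norm)
  qed
  define v where "v P = f (P *v \<psi>)" for P :: "'n qop"
  have v: "v P \<bullet> v Q = (P *v \<psi>) \<bullet> (Q *v \<psi>)" if "P \<in> pauli_matrices 2" "Q \<in> pauli_matrices 2" for P Q
    unfolding v_def using that by (intro iso) (auto simp: S_def span_base)
  have vPQ: "v P \<bullet> v Q = \<psi> \<bullet> ((P ** Q) *v \<psi>)" if "P \<in> pauli_matrices 2" "Q \<in> pauli_matrices 2" for P Q
    using that by (simp add: v pauli_matrices_self_adjoint matrix_vector_mul_assoc)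
  have "lasserre2_feasible v"
    unfolding lasserre2_feasible_def
  proof (intro conjI ballI impI)
    fix P :: "'n qop" assume "P \<in> pauli_matrices 2"
    then have "v P \<bullet> v P = \<psi> \<bullet> \<psi>"
      using vPQ[of P P] by (simp only: pauli_matrices_square matrix_vector_mul_lid)
    then show "v P \<bullet> v P = 1"
      using assms by (simp only: dot_square_norm) simp
  next
    fix P\<^sub>1 Q\<^sub>1 P\<^sub>2 Q\<^sub>2 :: "'n qop" and s :: real
    assume "P\<^sub>1 \<in> pauli_matrices 2" "Q\<^sub>1 \<in> pauli_matrices 2" "P\<^sub>2 \<in> pauli_matrices 2" "Q\<^sub>2 \<in> pauli_matrices 2"
      "P\<^sub>1 ** Q\<^sub>1 = s *\<^sub>R (P\<^sub>2 ** Q\<^sub>2)"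
    then show "v P\<^sub>1 \<bullet> v Q\<^sub>1 = s * (v P\<^sub>2 \<bullet> v Q\<^sub>2)"
      by (simp add: vPQ matrix_vector_mult_distribs)
  next
    fix P Q :: "'n qop" assume PQ: "P \<in> pauli_matrices 2" "Q \<in> pauli_matrices 2" "P ** Q + Q ** P = 0"
    \<comment> \<open>The real inner product is symmetric, so the anticommutator computes twice the
      wanted value.\<close>
    have "v P \<bullet> v Q + v Q \<bullet> v P = \<psi> \<bullet> ((P ** Q + Q ** P) *v \<psi>)"
      using PQ(1,2) by (simp only: vPQ matrix_vector_mult_distribs inner_add_right)
    then show "v P \<bullet> v Q = 0" using PQ(3) by (simp add: inner_commute matrix_vector_mult_distribs)
  qed
  then show ?thesis using v by blast
qed

text \<open>A unit eigenvector for the largest eigenvalue yields a feasible family whose objective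
  value is that eigenvalue.\<close>

lemma lambda_max_le_lasserre2_value:
  fixes E :: "('n::finite \<times> 'n) set"
  assumes G: "weighted_graph E w" and opt: "lasserre2_optimal E w v"
  shows "lambda_max (qmc_hamiltonian E w) \<le> lasserre2_value E w v"
proof -
  let ?H = "qmc_hamiltonian E w"
  have edge: "(edge_op i j *v x) \<bullet> y = x \<bullet> (edge_op i j *v y)" if "i \<noteq> j" for i j :: 'n and x y
    using pauli_matrices_self_adjoint[OF pauli_pair_mem[OF that]]
    by (simp add: edge_op_eq matrix_vector_mult_distribs matrix_vector_mult_sum inner_diff_left inner_diff_right
        inner_sum_left inner_sum_right)
  have H: "?H *v x = (\<Sum>e\<in>E. (w (fst e) (snd e) / 4) *\<^sub>R (edge_op (fst e) (snd e) *v x))" for x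
    by (simp add: qmc_hamiltonian_def matrix_vector_mult_sum matrix_vector_mult_distribs case_prod_unfold)
  have ne: "fst e \<noteq> snd e" if "e \<in> E" for e using that G by (auto simp: weighted_graph_def)
  have "(?H *v x) \<bullet> y = x \<bullet> (?H *v y)" for x y
    unfolding H inner_sum_left inner_sum_right
    by (intro sum.cong refl) (simp add: edge ne)
  then obtain \<psi> where \<psi>: "norm \<psi> = 1" "?H *v \<psi> = lambda_max ?H *\<^sub>R \<psi>"
    using lambda_max_eigenvalue by blast
  obtain v' :: "'n sdp_family" where v': "lasserre2_feasible v'"
    "\<And>P Q. P \<in> pauli_matrices 2 \<Longrightarrow> Q \<in> pauli_matrices 2 \<Longrightarrow> v' P \<bullet> v' Q = (P *v \<psi>) \<bullet> (Q *v \<psi>)"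
    using state_gives_feasible_family[OF \<psi>(1)] by blast
  have "1 - corr v' i j = \<psi> \<bullet> (edge_op i j *v \<psi>)" if "i \<noteq> j" for i j
    using \<psi>(1) by (simp add: corr_eq_sum v'(2) mat_1_in_pauli_matrices pauli_pair_mem[OF that] edge_op_eq
        matrix_vector_mult_distribs matrix_vector_mult_sum inner_diff_right inner_sum_right dot_square_norm)
  then have "lasserre2_value E w v' = \<psi> \<bullet> (?H *v \<psi>)"
    unfolding lasserre2_value_eq[OF v'(1)] H inner_sum_right
    by (intro sum.cong refl) (simp add: case_prod_unfold ne)
  also have "\<dots> = lambda_max ?H" using \<psi> by (simp add: dot_square_norm)
  finally show ?thesis using opt v'(1) by (metis lasserre2_optimal_def)
qed

section \<open>Standard Gaussian measures\<close>

lemma nn_integral_lborel_translate: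
  fixes f :: "'a::euclidean_space \<Rightarrow> ennreal"
  assumes [measurable]: "f \<in> borel_measurable borel"
  shows "(\<integral>\<^sup>+x. f (c + x) \<partial>lborel) = (\<integral>\<^sup>+x. f x \<partial>lborel)"
proof -
  have "(\<integral>\<^sup>+x. f x \<partial>lborel) = (\<integral>\<^sup>+x. f x \<partial>distr lborel borel ((+) c))"
    by (simp add: lborel_distr_plus)
  also have "\<dots> = (\<integral>\<^sup>+x. f (c + x) \<partial>lborel)"
    by (subst nn_integral_distr) simp_all
  finally show ?thesis by simp
qed

text \<open>Translation invariance of the pushforward under \<open>T\<close> forces it to be a multiple of Lebesgue
  measure; both agree on the unit ball.\<close>

lemma nn_integral_lborel_isometry:
  fixes f :: "'a::euclidean_space \<Rightarrow> ennreal" and T :: "'a \<Rightarrow> 'a"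
  assumes f [measurable]: "f \<in> borel_measurable borel"
    and T: "linear T" "\<And>x. norm (T x) = norm x"
  shows "(\<integral>\<^sup>+x. f (T x) \<partial>lborel) = (\<integral>\<^sup>+x. f x \<partial>lborel)"
proof -
  have [measurable]: "T \<in> borel_measurable borel"
    using T(1) by (intro borel_measurable_continuous_onI linear_continuous_on linear_linear[THEN iffD2])
  have "inj T" using T by (auto simp: linear_injective_0) (metis norm_eq_zero)
  then have "surj T" using T(1) linear_injective_imp_surjective by blast
  then obtain T' where T': "\<And>y. T (T' y) = y" by (metis surjD)
  have Tadd: "T (x + y) = T x + T y" and Tdiff: "T (x - y) = T x - T y" for x y
    using T(1) by (simp_all add: linear_add linear_diff)
  \<comment> \<open>\<open>g\<close> is the averaging weight. For each y the integrand is translated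
    by \<open>T' y\<close>, which adds y inside \<open>f\<close>. After exchanging the integrals the
    translation moves over to \<open>g\<close>, whose integral along \<open>T\<close> is again
    \<open>C\<close>.\<close>
  define g :: "'a \<Rightarrow> ennreal" where "g = indicator (ball 0 1)"
  have [measurable]: "g \<in> borel_measurable borel"
    unfolding g_def by (intro borel_measurable_indicator) simp
  define C where "C = emeasure lborel (ball (0 :: 'a) 1)"
  have "unit_ball_vol (real DIM('a)) > 0" by (rule unit_ball_vol_pos) simp
  then have "unit_ball_vol (real DIM('a)) \<noteq> 0" by linarith
  then have C: "C \<noteq> 0" "C < \<infinity>"
    by (simp_all add: C_def emeasure_ball)
  have intg: "(\<integral>\<^sup>+x. g (y - T x) \<partial>lborel) = C" for y
  proof -
    have "norm (y - T x) = dist (T' y) x" for x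
      using T(2)[of "T' y - x"] by (simp add: Tdiff T' dist_norm)
    then have "g (y - T x) = indicator (ball (T' y) 1) x" for x
      by (simp add: g_def indicator_def)
    then show ?thesis by (simp add: C_def emeasure_ball)
  qed
  have gC: "(\<integral>\<^sup>+y. g y \<partial>lborel) = C"
    by (simp add: g_def C_def)
  have "(\<integral>\<^sup>+x. f (T x) \<partial>lborel) * C = (\<integral>\<^sup>+y. (\<integral>\<^sup>+x. f (T x) \<partial>lborel) * g y \<partial>lborel)"
    by (subst nn_integral_cmult) (simp_all add: gC)
  also have "\<dots> = (\<integral>\<^sup>+y. \<integral>\<^sup>+x. f (y + T x) * g y \<partial>lborel \<partial>lborel)"
  proof (rule nn_integral_cong)
    fix y :: 'a
    have "(\<integral>\<^sup>+x. f (T x) \<partial>lborel) = (\<integral>\<^sup>+x. f (T (T' y + x)) \<partial>lborel)"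
      by (rule nn_integral_lborel_translate[symmetric]) simp
    then show "(\<integral>\<^sup>+x. f (T x) \<partial>lborel) * g y = (\<integral>\<^sup>+x. f (y + T x) * g y \<partial>lborel)"
      by (simp add: Tadd T' nn_integral_multc)
  qed
  also have "\<dots> = (\<integral>\<^sup>+x. \<integral>\<^sup>+y. f (y + T x) * g y \<partial>lborel \<partial>lborel)"
    by (rule lborel_pair.Fubini') simp
  also have "\<dots> = (\<integral>\<^sup>+x. \<integral>\<^sup>+y. f y * g (y - T x) \<partial>lborel \<partial>lborel)"
  proof (rule nn_integral_cong)
    fix x :: 'a
    show "(\<integral>\<^sup>+y. f (y + T x) * g y \<partial>lborel) = (\<integral>\<^sup>+y. f y * g (y - T x) \<partial>lborel)"
      using nn_integral_lborel_translate[of "\<lambda>y. f (y + T x) * g y" "- T x"]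
      by simp
  qed
  also have "\<dots> = (\<integral>\<^sup>+y. \<integral>\<^sup>+x. f y * g (y - T x) \<partial>lborel \<partial>lborel)"
    by (rule lborel_pair.Fubini') simp
  also have "\<dots> = (\<integral>\<^sup>+y. f y * C \<partial>lborel)"
    by (simp add: nn_integral_cmult intg)
  also have "\<dots> = (\<integral>\<^sup>+y. f y \<partial>lborel) * C"
    by (simp add: nn_integral_multc)
  finally show ?thesis
    using C ennreal_mult_divide_eq[of C] by (metis infinity_ennreal_def order_less_irrefl)
qed

abbreviation std_normal :: "real measure" where
  "std_normal \<equiv> density lborel std_normal_density"

lemma prob_space_std_normal: "prob_space std_normal"
  by (rule prob_space_normal_density) simp

text \<open>As a pushforward of a product measure it has independent coordinates by construction;
  rotation invariance will come from its density, which depends on the norm only.\<close>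

definition std_gauss :: "'a::euclidean_space measure" where
  "std_gauss = distr (\<Pi>\<^sub>M b\<in>Basis. std_normal) borel (\<lambda>f. \<Sum>b\<in>Basis. f b *\<^sub>R b)"

lemma sets_std_gauss [measurable_cong, simp]: "sets std_gauss = sets borel"
  and space_std_gauss [simp]: "space std_gauss = UNIV"
  by (simp_all add: std_gauss_def)

lemma prob_space_std_gauss: "prob_space (std_gauss :: 'a::euclidean_space measure)"
  unfolding std_gauss_def
  by (intro prob_space.prob_space_distr prob_space_PiM prob_space_std_normal) simp

lemma std_gauss_eq_density:
  "(std_gauss :: 'a::euclidean_space measure) =
     density lborel (\<lambda>x. ennreal ((1 / sqrt (2 * pi)) ^ DIM('a) * exp (- (norm x)\<^sup>2 / 2)))"
proof -
  interpret L: product_sigma_finite "\<lambda>_ :: 'a. lborel :: real measure" ..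
  interpret N: product_sigma_finite "\<lambda>_ :: 'a. std_normal"
    by (intro product_sigma_finite.intro prob_space_imp_sigma_finite prob_space_std_normal)
  have sets: "sets (\<Pi>\<^sub>M b\<in>(Basis :: 'a set). std_normal) = sets (\<Pi>\<^sub>M b\<in>(Basis :: 'a set). lborel)"
    by (rule sets_PiM_cong) simp_all
  have "density (\<Pi>\<^sub>M b\<in>Basis. lborel) (\<lambda>f. \<Prod>b\<in>(Basis :: 'a set). ennreal (std_normal_density (f b)))
      = (\<Pi>\<^sub>M b\<in>Basis. std_normal)"
  proof (rule N.PiM_eqI)
    fix A :: "'a \<Rightarrow> real set" assume A: "\<And>b. b \<in> Basis \<Longrightarrow> A b \<in> sets std_normal"
    then have A' [measurable]: "b \<in> Basis \<Longrightarrow> A b \<in> sets borel" for b by simp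
    have PA: "Pi\<^sub>E Basis A \<in> sets (\<Pi>\<^sub>M b\<in>(Basis :: 'a set). lborel)"
      using A' by (intro sets_PiM_I_finite) auto
    have "emeasure (density (\<Pi>\<^sub>M b\<in>Basis. lborel) (\<lambda>f. \<Prod>b\<in>(Basis :: 'a set). ennreal (std_normal_density (f b)))) (Pi\<^sub>E Basis A)
      = (\<integral>\<^sup>+f. (\<Prod>b\<in>Basis. ennreal (std_normal_density (f b))) * indicator (Pi\<^sub>E Basis A) f \<partial>(\<Pi>\<^sub>M b\<in>(Basis :: 'a set). lborel))"
      using PA by (intro emeasure_density) simp_all
    also have "\<dots> = (\<integral>\<^sup>+f. (\<Prod>b\<in>Basis. ennreal (std_normal_density (f b)) * indicator (A b) (f b)) \<partial>(\<Pi>\<^sub>M b\<in>(Basis :: 'a set). lborel))"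
    proof (rule nn_integral_cong)
      fix f :: "'a \<Rightarrow> real" assume "f \<in> space (\<Pi>\<^sub>M b\<in>(Basis :: 'a set). lborel)"
      then have "f \<in> Pi\<^sub>E Basis A \<longleftrightarrow> (\<forall>b\<in>Basis. f b \<in> A b)"
        by (auto simp: space_PiM PiE_iff)
      then have "(\<Prod>b\<in>Basis. indicator (A b) (f b)) = (indicator (Pi\<^sub>E Basis A) f :: ennreal)"
        by (auto simp: indicator_def prod_zero_iff)
      then show "(\<Prod>b\<in>Basis. ennreal (std_normal_density (f b))) * indicator (Pi\<^sub>E Basis A) f =
         (\<Prod>b\<in>Basis. ennreal (std_normal_density (f b)) * indicator (A b) (f b))"
        by (simp add: prod.distrib)
    qed
    also have "\<dots> = (\<Prod>b\<in>Basis. \<integral>\<^sup>+x. ennreal (std_normal_density x) * indicator (A b) x \<partial>lborel)"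
      by (rule L.product_nn_integral_prod) simp_all
    also have "\<dots> = (\<Prod>b\<in>Basis. emeasure std_normal (A b))"
      by (intro prod.cong refl emeasure_density[symmetric]) simp_all
    finally show "emeasure (density (\<Pi>\<^sub>M b\<in>Basis. lborel) (\<lambda>f. \<Prod>b\<in>(Basis :: 'a set). ennreal (std_normal_density (f b)))) (Pi\<^sub>E Basis A)
      = (\<Prod>b\<in>Basis. emeasure std_normal (A b))" .
  qed (simp_all add: sets)
  then have "(std_gauss :: 'a measure) = distr (density (\<Pi>\<^sub>M b\<in>Basis. lborel) (\<lambda>f. \<Prod>b\<in>(Basis :: 'a set). ennreal (std_normal_density (f b))))
      borel (\<lambda>f. \<Sum>b\<in>Basis. f b *\<^sub>R b)"
    by (simp add: std_gauss_def)
  also have "\<dots> = distr (density (\<Pi>\<^sub>M b\<in>Basis. lborel)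
      (\<lambda>f. (\<lambda>x. \<Prod>b\<in>(Basis :: 'a set). ennreal (std_normal_density (x \<bullet> b))) (\<Sum>b\<in>Basis. f b *\<^sub>R b)))
      borel (\<lambda>f. \<Sum>b\<in>Basis. f b *\<^sub>R b)"
    by simp
  also have "\<dots> = density lborel (\<lambda>x :: 'a. \<Prod>b\<in>(Basis :: 'a set). ennreal (std_normal_density (x \<bullet> b)))"
    unfolding lborel_eq[where 'a='a] by (rule density_distr[symmetric]) simp_all
  also have "(\<lambda>x :: 'a. \<Prod>b\<in>(Basis :: 'a set). ennreal (std_normal_density (x \<bullet> b))) =
     (\<lambda>x. ennreal ((1 / sqrt (2 * pi)) ^ DIM('a) * exp (- (norm x)\<^sup>2 / 2)))"
  proof
    fix x :: 'a
    have "(\<Prod>b\<in>Basis. std_normal_density (x \<bullet> b)) =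
       (1 / sqrt (2 * pi)) ^ DIM('a) * exp (\<Sum>b\<in>Basis. - (x \<bullet> b)\<^sup>2 / 2)"
      by (simp only: std_normal_density_def prod.distrib prod_constant exp_sum[OF finite_Basis])
    also have "(\<Sum>b\<in>Basis. - (x \<bullet> b)\<^sup>2 / 2) = - (norm x)\<^sup>2 / 2"
    proof -
      have "(norm x)\<^sup>2 = (\<Sum>b\<in>Basis. (x \<bullet> b)\<^sup>2)"
        unfolding power2_norm_eq_inner by (subst euclidean_inner) (simp add: power2_eq_square)
      then show ?thesis by (simp add: sum_negf sum_divide_distrib)
    qed
    finally show "(\<Prod>b\<in>Basis. ennreal (std_normal_density (x \<bullet> b))) =
       ennreal ((1 / sqrt (2 * pi)) ^ DIM('a) * exp (- (norm x)\<^sup>2 / 2))"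
      by (simp add: prod_ennreal)
  qed
  finally show ?thesis .
qed

text \<open>Selecting distinct coordinates of a standard Gaussian gives a standard Gaussian
  again.\<close>

lemma std_gauss_reindex:
  assumes "finite K" "inj_on k (Basis :: 'a::euclidean_space set)" "k \<in> Basis \<rightarrow> K"
  shows "distr (\<Pi>\<^sub>M i\<in>K. std_normal) borel (\<lambda>f. \<Sum>b\<in>Basis. f (k b) *\<^sub>R b) = (std_gauss :: 'a measure)"
proof -
  have [measurable]: "(\<lambda>\<omega>. \<lambda>b\<in>Basis. \<omega> (k b)) \<in> measurable (\<Pi>\<^sub>M i\<in>K. std_normal) (\<Pi>\<^sub>M b\<in>Basis. std_normal)"
    using assms(3) by (intro measurable_restrict measurable_component_singleton) auto
  have "distr (\<Pi>\<^sub>M i\<in>K. std_normal) borel (\<lambda>f. \<Sum>b\<in>Basis. f (k b) *\<^sub>R b) =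
    distr (\<Pi>\<^sub>M i\<in>K. std_normal) borel ((\<lambda>f. \<Sum>b\<in>Basis. f b *\<^sub>R b) \<circ> (\<lambda>\<omega>. \<lambda>b\<in>Basis. \<omega> (k b)))"
    by (intro distr_cong) simp_all
  also have "\<dots> = distr (distr (\<Pi>\<^sub>M i\<in>K. std_normal) (\<Pi>\<^sub>M b\<in>Basis. std_normal) (\<lambda>\<omega>. \<lambda>b\<in>Basis. \<omega> (k b))) borel
      (\<lambda>f. \<Sum>b\<in>Basis. f b *\<^sub>R b)"
    by (rule distr_distr[symmetric]) simp_all
  also have "\<dots> = std_gauss"
    unfolding std_gauss_def
    using distr_PiM_reindex[of K "\<lambda>_. std_normal" k Basis] assms prob_space_std_normal by simp
  finally show ?thesis .
qed

lemma distr_std_gauss_isometry: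
  fixes T :: "'a::euclidean_space \<Rightarrow> 'a"
  assumes T: "linear T" "\<And>x. norm (T x) = norm x"
  shows "distr std_gauss borel T = std_gauss"
proof (rule measure_eqI)
  have [measurable]: "T \<in> borel_measurable borel"
    using T(1) by (intro borel_measurable_continuous_onI linear_continuous_on linear_linear[THEN iffD2])
  fix A assume "A \<in> sets (distr std_gauss borel T)"
  then have A [measurable]: "A \<in> sets borel" by simp
  define \<phi> where "\<phi> x = ennreal ((1 / sqrt (2 * pi)) ^ DIM('a) * exp (- (norm x)\<^sup>2 / 2))" for x :: 'a
  have [measurable]: "\<phi> \<in> borel_measurable borel" unfolding \<phi>_def by measurable
  have dens: "std_gauss = density lborel \<phi>" unfolding \<phi>_def by (rule std_gauss_eq_density)
  have "emeasure (distr std_gauss borel T) A = (\<integral>\<^sup>+x. indicator A (T x) \<partial>std_gauss)"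
    by (subst nn_integral_distr[symmetric, of T std_gauss borel "indicator A"]) simp_all
  also have "\<dots> = (\<integral>\<^sup>+x. \<phi> (T x) * indicator A (T x) \<partial>lborel)"
    unfolding dens by (subst nn_integral_density) (simp_all add: \<phi>_def T)
  also have "\<dots> = (\<integral>\<^sup>+x. \<phi> x * indicator A x \<partial>lborel)"
    by (rule nn_integral_lborel_isometry[of "\<lambda>x. \<phi> x * indicator A x", OF _ T]) simp
  also have "\<dots> = emeasure std_gauss A"
    unfolding dens by (simp add: emeasure_density)
  finally show "emeasure (distr std_gauss borel T) A = emeasure std_gauss A" .
qed simp

text \<open>The image under \<open>J\<close> of the standard basis is orthonormal; extend it to an
  orthonormal basis and let \<open>T\<close> map that basis to the standard one. Inner products with
  \<open>J b\<close> then become plain coordinates of \<open>T x\<close>.\<close>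

lemma orthonormal_extension_isometry:
  fixes J :: "'b::euclidean_space \<Rightarrow> 'a::euclidean_space"
  assumes J: "linear J" "\<And>x. norm (J x) = norm x"
  shows "\<exists>T k. linear T \<and> (\<forall>x. norm (T x) = norm x) \<and> inj_on k Basis \<and> k \<in> Basis \<rightarrow> (Basis :: 'a set) \<and>
    (\<forall>x. \<forall>b\<in>Basis. x \<bullet> J b = T x \<bullet> (k b :: 'a))"
proof -
  have Jinner: "J x \<bullet> J y = x \<bullet> y" for x y
    using J(2)[of "x + y"] J by (simp add: dot_norm linear_add)
  have injJ: "inj J" using J by (auto simp: linear_injective_0) (metis norm_eq_zero)
  define A where "A = J ` Basis"
  have A: "pairwise orthogonal A" "\<And>u. u \<in> A \<Longrightarrow> norm u = 1" "finite A"
    using J by (auto simp: A_def pairwise_def orthogonal_def Jinner) (metis inner_not_same_Basis)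
  have "0 \<notin> A" using A(2) by force
  then have "independent A" using A(1) pairwise_orthogonal_independent by blast
  define P where "P = {y :: 'a. \<forall>x\<in>span A. orthogonal x y}"
  have "subspace P" unfolding P_def by (rule subspace_orthogonal_to_vectors)
  then obtain B where B: "B \<subseteq> P" "pairwise orthogonal B" "\<And>x. x \<in> B \<Longrightarrow> norm x = 1"
    "independent B" "card B = dim P" using orthonormal_basis_subspace by metis
  have finB: "finite B" using B(4) independent_imp_finite by blast
  have "dim P + dim (span A) = dim (UNIV :: 'a set)"
    using dim_subspace_orthogonal_to_vectors[of "span A" UNIV] by (simp add: P_def)
  then have cards: "card B + card A = DIM('a)"
    using B(5) \<open>independent A\<close> by (simp add: dim_eq_card_independent)
  have AB: "orthogonal a b" if "a \<in> A" "b \<in> B" for a b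
    using that B(1) by (auto simp: P_def span_base)
  have disj: "A \<inter> B = {}"
    using AB A(2) by (metis disjoint_iff norm_zero orthogonal_self zero_neq_one)
  define U where "U = A \<union> B"
  have U: "pairwise orthogonal U" "\<And>u. u \<in> U \<Longrightarrow> norm u = 1" "finite U"
    using A B(2,3) finB AB by (auto simp: U_def pairwise_def) (metis orthogonal_commute)
  have "0 \<notin> U" using U(2) by force
  then have indU: "independent U" using U(1) pairwise_orthogonal_independent by blast
  have cardU: "card U = DIM('a)" unfolding U_def using cards disj A(3) finB by (simp add: card_Un_disjoint)
  have "UNIV \<subseteq> span U"
    using indU cardU by (intro card_ge_dim_independent) auto
  then have expand: "(\<Sum>u\<in>U. (x \<bullet> u) *\<^sub>R u) = x" for x
    using orthonormal_basis_expand[OF U(1,2) _ U(3)] by blast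
  obtain h where h: "bij_betw h U (Basis :: 'a set)"
    using cardU U(3) finite_same_card_bij by (metis finite_Basis)
  define T where "T x = (\<Sum>u\<in>U. (x \<bullet> u) *\<^sub>R h u)" for x
  have Th: "T x \<bullet> h u = x \<bullet> u" if "u \<in> U" for x u
  proof -
    have "T x \<bullet> h u = (\<Sum>u'\<in>U. if u' = u then x \<bullet> u else 0)"
      unfolding T_def inner_sum_left
    proof (rule sum.cong[OF refl])
      fix u' assume "u' \<in> U"
      then have "h u' \<in> Basis" "h u \<in> Basis" "h u' = h u \<longleftrightarrow> u' = u"
        using h that by (auto simp: bij_betw_def inj_on_eq_iff)
      then show "(x \<bullet> u') *\<^sub>R h u' \<bullet> h u = (if u' = u then x \<bullet> u else 0)"
        by (simp add: inner_Basis)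
    qed
    then show ?thesis using U(3) that by simp
  qed
  have "linear T"
    by (rule linearI) (simp_all add: T_def inner_add_left scaleR_add_left sum.distrib scaleR_sum_right)
  moreover have "norm (T x) = norm x" for x
  proof -
    have "T x \<bullet> T x = (\<Sum>u\<in>U. (x \<bullet> u) * (T x \<bullet> h u))"
      by (subst (2) T_def) (simp add: inner_sum_right)
    also have "\<dots> = (\<Sum>u\<in>U. (x \<bullet> u) * (x \<bullet> u))" by (simp add: Th)
    also have "\<dots> = x \<bullet> (\<Sum>u\<in>U. (x \<bullet> u) *\<^sub>R u)" by (simp add: inner_sum_right)
    also have "\<dots> = x \<bullet> x" by (simp add: expand)
    finally show ?thesis by (simp add: norm_eq_sqrt_inner)
  qed
  moreover have "inj_on (h \<circ> J) Basis"
  proof (rule comp_inj_on)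
    show "inj_on J Basis" using injJ by (rule inj_on_subset) simp
    show "inj_on h (J ` Basis)" using h by (auto simp: bij_betw_def U_def A_def intro: inj_on_subset)
  qed
  moreover have "h \<circ> J \<in> Basis \<rightarrow> Basis"
    using h by (auto simp: bij_betw_def U_def A_def)
  moreover have "\<forall>x. \<forall>b\<in>Basis. x \<bullet> J b = T x \<bullet> (h \<circ> J) b"
    using Th by (simp add: U_def A_def)
  ultimately show ?thesis by blast
qed

text \<open>\<open>L\<close> is the adjoint of the isometry \<open>J\<close>. Up to the rotation
  \<open>T\<close>, which preserves the Gaussian, it merely selects coordinates.\<close>

lemma distr_std_gauss_coisometry:
  fixes L :: "'a::euclidean_space \<Rightarrow> 'b::euclidean_space"
  assumes J: "linear J" "\<And>x. norm (J x) = norm x" and L: "\<And>x y. L x \<bullet> y = x \<bullet> J y"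
  shows "distr std_gauss borel L = std_gauss"
proof -
  obtain T and k :: "'b \<Rightarrow> 'a" where T: "linear T" "\<And>x. norm (T x) = norm x"
    and k: "inj_on k Basis" "k \<in> Basis \<rightarrow> (Basis :: 'a set)"
    and Tk: "\<And>x b. b \<in> Basis \<Longrightarrow> x \<bullet> J b = T x \<bullet> k b"
    using orthonormal_extension_isometry[OF J] by metis
  have [measurable]: "T \<in> borel_measurable borel"
    using T(1) by (intro borel_measurable_continuous_onI linear_continuous_on linear_linear[THEN iffD2])
  define S where "S x = (\<Sum>b\<in>Basis. (x \<bullet> k b) *\<^sub>R b)" for x
  have [measurable]: "S \<in> borel_measurable borel" unfolding S_def by measurable
  have "L x = (S \<circ> T) x" for x
  proof -
    have "L x = (\<Sum>b\<in>Basis. (L x \<bullet> b) *\<^sub>R b)" by (simp add: euclidean_representation)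
    also have "\<dots> = (S \<circ> T) x" by (simp add: S_def L Tk)
    finally show ?thesis .
  qed
  then have "distr std_gauss borel L = distr std_gauss borel (S \<circ> T)"
    by (intro distr_cong) simp_all
  also have "\<dots> = distr (distr std_gauss borel T) borel S"
    by (rule distr_distr[symmetric]) simp_all
  also have "\<dots> = distr std_gauss borel S"
    by (simp add: distr_std_gauss_isometry[OF T])
  also have "\<dots> = distr (\<Pi>\<^sub>M b\<in>Basis. std_normal) borel (S \<circ> (\<lambda>f. \<Sum>b\<in>Basis. f b *\<^sub>R b))"
    unfolding std_gauss_def by (rule distr_distr) simp_all
  also have "\<dots> = distr (\<Pi>\<^sub>M b\<in>Basis. std_normal) borel (\<lambda>f. \<Sum>b\<in>Basis. f (k b) *\<^sub>R b)"
    using k(2) by (intro distr_cong) (auto simp: S_def Pi_iff inner_sum_left_Basis intro!: sum.cong)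
  also have "\<dots> = std_gauss"
    using k by (intro std_gauss_reindex) simp_all
  finally show ?thesis .
qed

lemma std_gauss_prod: "(std_gauss :: ('a::euclidean_space \<times> 'b::euclidean_space) measure) = std_gauss \<Otimes>\<^sub>M std_gauss"
proof -
  have "std_gauss \<Otimes>\<^sub>M std_gauss = density ((lborel :: 'a measure) \<Otimes>\<^sub>M (lborel :: 'b measure))
     (\<lambda>(x, y). ennreal ((1 / sqrt (2 * pi)) ^ DIM('a) * exp (- (norm x)\<^sup>2 / 2)) *
       ennreal ((1 / sqrt (2 * pi)) ^ DIM('b) * exp (- (norm y)\<^sup>2 / 2)))"
    unfolding std_gauss_eq_density
  proof (rule pair_measure_density)
    show "sigma_finite_measure (density (lborel :: 'b measure) (\<lambda>x. ennreal ((1 / sqrt (2 * pi)) ^ DIM('b) * exp (- (norm x)\<^sup>2 / 2))))"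
      unfolding std_gauss_eq_density[symmetric] by (rule prob_space_imp_sigma_finite[OF prob_space_std_gauss])
  qed (simp_all add: lborel.sigma_finite_measure_axioms)
  also have "(\<lambda>(x :: 'a, y :: 'b). ennreal ((1 / sqrt (2 * pi)) ^ DIM('a) * exp (- (norm x)\<^sup>2 / 2)) *
       ennreal ((1 / sqrt (2 * pi)) ^ DIM('b) * exp (- (norm y)\<^sup>2 / 2))) =
     (\<lambda>z. ennreal ((1 / sqrt (2 * pi)) ^ DIM('a \<times> 'b) * exp (- (norm z)\<^sup>2 / 2)))"
    by (auto simp: fun_eq_iff ennreal_mult[symmetric] power_add norm_Pair exp_add[symmetric] add_divide_distrib[symmetric]
      mult_ac simp flip: exp_add) (simp add: field_simps exp_add[symmetric])
  finally show ?thesis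
    unfolding std_gauss_eq_density[where 'a="'a \<times> 'b"] lborel_prod by simp
qed

lemma gaussian_matrix_std_gauss:
  fixes R :: "'w \<Rightarrow> real ^ 'c::finite ^ 'r::finite"
  assumes "prob_space \<Omega>" "gaussian_matrix \<Omega> R"
  shows "R \<in> borel_measurable \<Omega>" "distr \<Omega> borel R = std_gauss"
proof -
  interpret prob_space \<Omega> by fact
  define X where "X p \<omega> = R \<omega> $ fst p $ snd p" for p \<omega>
  have ind: "indep_vars (\<lambda>_. borel) X UNIV"
    using assms(2) unfolding gaussian_matrix_def X_def by (simp add: case_prod_unfold)
  have d: "distr \<Omega> borel (X p) = std_normal" for p
  proof -
    have "distributed \<Omega> lborel (X p) std_normal_density"
      using assms(2) by (simp add: gaussian_matrix_def X_def[abs_def])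
    then have "distr \<Omega> lborel (X p) = std_normal" by (simp add: distributed_def)
    then show ?thesis by (simp cong: distr_cong)
  qed
  have X [measurable]: "X p \<in> borel_measurable \<Omega>" for p
    using ind unfolding indep_vars_def2 by blast
  \<comment> \<open>A basis vector of the matrix space singles out one entry, and \<open>k\<close>
    records its position.\<close>
  have bas: "\<exists>p. b = axis (fst p) (axis (snd p) 1)" if "b \<in> Basis" for b :: "real ^ 'c ^ 'r"
    using that by (auto simp: Basis_vec_def)
  then obtain k where k: "\<And>b :: real ^ 'c ^ 'r. b \<in> Basis \<Longrightarrow> b = axis (fst (k b)) (axis (snd (k b)) 1)"
    by metis
  have inj: "inj_on k Basis" by (rule inj_onI) (metis k)
  have Rk: "R \<omega> \<bullet> b = X (k b) \<omega>" if "b \<in> Basis" for b \<omega>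
    using k[OF that] by (metis X_def inner_axis inner_real_def mult.right_neutral)
  then have R: "R \<omega> = (\<Sum>b\<in>Basis. X (k b) \<omega> *\<^sub>R b)" for \<omega>
    using euclidean_representation[of "R \<omega>"] by simp
  show [measurable]: "R \<in> borel_measurable \<Omega>"
    unfolding R[abs_def] by measurable
  have [measurable]: "(\<lambda>\<omega>. \<lambda>p\<in>UNIV. X p \<omega>) \<in> measurable \<Omega> (\<Pi>\<^sub>M p\<in>UNIV. borel)"
    by (intro measurable_restrict X)
  have "distr \<Omega> borel R = distr \<Omega> borel ((\<lambda>f. \<Sum>b\<in>Basis. f (k b) *\<^sub>R b) \<circ> (\<lambda>\<omega>. \<lambda>p\<in>UNIV. X p \<omega>))"
    by (intro distr_cong) (simp_all add: R)
  also have "\<dots> = distr (distr \<Omega> (\<Pi>\<^sub>M p\<in>UNIV. borel) (\<lambda>\<omega>. \<lambda>p\<in>UNIV. X p \<omega>)) borel (\<lambda>f. \<Sum>b\<in>Basis. f (k b) *\<^sub>R b)"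
    by (rule distr_distr[symmetric]) simp_all
  also have "distr \<Omega> (\<Pi>\<^sub>M p\<in>UNIV. borel) (\<lambda>\<omega>. \<lambda>p\<in>UNIV. X p \<omega>) = (\<Pi>\<^sub>M p\<in>UNIV. std_normal)"
    using indep_vars_iff_distr_eq_PiM[where I=UNIV and M'="\<lambda>_. borel" and X=X] ind by (simp add: d)
  also have "distr (\<Pi>\<^sub>M p\<in>UNIV. std_normal) borel (\<lambda>f. \<Sum>b\<in>Basis. f (k b) *\<^sub>R b) = (std_gauss :: (real ^ 'c ^ 'r) measure)"
    using inj by (intro std_gauss_reindex) simp_all
  finally show "distr \<Omega> borel R = std_gauss" .
qed

text \<open>Polar coordinates: the two measures agree on the half-lines \<open>{..r}\<close> by the
  volume of balls, and these sets generate the Borel sets.\<close>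

lemma distr_lborel_norm:
  "distr (lborel :: 'a::euclidean_space measure) borel norm =
     density lborel (\<lambda>r. ennreal (unit_ball_vol (DIM('a)) * DIM('a) * r ^ (DIM('a) - 1)) * indicator {0..} r)"
  (is "?L = ?R")
proof -
  let ?v = "unit_ball_vol (real DIM('a))"
  have v: "0 \<le> ?v" by simp
  have L: "emeasure ?L {..r} = ennreal (if 0 \<le> r then ?v * r ^ DIM('a) else 0)" for r
  proof -
    have "emeasure ?L {..r} = emeasure lborel {x :: 'a. norm x \<le> r}"
      by (subst emeasure_distr) (auto intro!: arg_cong2[where f=emeasure])
    also have "{x :: 'a. norm x \<le> r} = (if 0 \<le> r then cball 0 r else {})"
      by (auto simp: order_trans[OF norm_ge_zero])
    finally show ?thesis by (auto simp: emeasure_cball)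
  qed
  have R: "emeasure ?R {..r} = ennreal (if 0 \<le> r then ?v * r ^ DIM('a) else 0)" for r
  proof (cases "0 \<le> r")
    case True
    have "emeasure ?R {..r} = (\<integral>\<^sup>+s. ennreal (?v * DIM('a) * s ^ (DIM('a) - 1)) * indicator {0..} s * indicator {..r} s \<partial>lborel)"
      by (subst emeasure_density) simp_all
    also have "\<dots> = (\<integral>\<^sup>+s. ennreal (?v * DIM('a) * s ^ (DIM('a) - 1)) * indicator {0..r} s \<partial>lborel)"
      by (intro nn_integral_cong) (auto simp: indicator_def)
    also have "\<dots> = ennreal (?v * r ^ DIM('a) - ?v * 0 ^ DIM('a))"
    proof (rule nn_integral_FTC_Icc[where F="\<lambda>s. ?v * s ^ DIM('a)"])
      show "((\<lambda>s. ?v * s ^ DIM('a)) has_real_derivative ?v * DIM('a) * s ^ (DIM('a) - 1)) (at s)" for s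
        by (auto intro!: derivative_eq_intros simp: mult_ac)
    qed (use True in auto)
    finally show ?thesis using True by simp
  next
    case False
    have "emeasure ?R {..r} = (\<integral>\<^sup>+s. ennreal (?v * DIM('a) * s ^ (DIM('a) - 1)) * indicator {0..} s * indicator {..r} s \<partial>lborel)"
      by (subst emeasure_density) simp_all
    also have "\<dots> = (\<integral>\<^sup>+s. 0 \<partial>(lborel :: real measure))"
      using False by (intro nn_integral_cong) (auto simp: indicator_def)
    finally show ?thesis using False by simp
  qed
  show ?thesis
  proof (rule measure_eqI_generator_eq[where E="range atMost" and \<Omega>=UNIV and A="\<lambda>n. {..real n}"])
    show "Int_stable (range (atMost :: real \<Rightarrow> real set))"
      by (auto simp: Int_stable_def)
    show "sets ?L = sigma_sets UNIV (range atMost)" "sets ?R = sigma_sets UNIV (range atMost)"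
      by (simp_all add: borel_eq_atMost)
    show "(\<Union>i. {..real i}) = UNIV" by (auto simp: real_arch_simple)
    show "emeasure ?L {..real n} \<noteq> \<infinity>" for n unfolding L by simp
  qed (use L R in auto)
qed

lemma nn_integral_radial:
  fixes h :: "real \<Rightarrow> ennreal"
  assumes [measurable]: "h \<in> borel_measurable borel"
  shows "(\<integral>\<^sup>+x. h (norm x) \<partial>(lborel :: 'a::euclidean_space measure)) =
    (\<integral>\<^sup>+r. ennreal (unit_ball_vol (DIM('a)) * DIM('a) * r ^ (DIM('a) - 1)) * indicator {0..} r * h r \<partial>lborel)"
proof -
  have "(\<integral>\<^sup>+x. h (norm x) \<partial>(lborel :: 'a measure)) = (\<integral>\<^sup>+r. h r \<partial>distr (lborel :: 'a measure) borel norm)"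
    by (subst nn_integral_distr) simp_all
  also have "\<dots> = (\<integral>\<^sup>+r. ennreal (unit_ball_vol (DIM('a)) * DIM('a) * r ^ (DIM('a) - 1)) * indicator {0..} r * h r \<partial>lborel)"
    unfolding distr_lborel_norm by (subst nn_integral_density) simp_all
  finally show ?thesis .
qed

text \<open>The sphere area 4 pi r^2 on the half-line is spread as 2 pi r^2 over the whole line, by
  the radial formula in dimension one. Integrals over the real normal distribution then become
  applicable.\<close>

lemma nn_integral_radial_3:
  fixes h :: "real \<Rightarrow> ennreal"
  assumes [measurable]: "h \<in> borel_measurable borel"
  shows "(\<integral>\<^sup>+x. h (norm x) \<partial>(lborel :: (real ^ 3) measure)) = (\<integral>\<^sup>+r. ennreal (2 * pi * r\<^sup>2) * h \<bar>r\<bar> \<partial>lborel)"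
proof -
  have "(\<integral>\<^sup>+r. ennreal (2 * pi * r\<^sup>2) * h \<bar>r\<bar> \<partial>lborel) = (\<integral>\<^sup>+r. ennreal (2 * pi * (norm r)\<^sup>2) * h (norm r) \<partial>(lborel :: real measure))"
    by simp
  also have "\<dots> = (\<integral>\<^sup>+r. ennreal 2 * indicator {0..} r * (ennreal (2 * pi * r\<^sup>2) * h r) \<partial>lborel)"
    by (subst nn_integral_radial[of "\<lambda>r. ennreal (2 * pi * r\<^sup>2) * h r"]) simp_all
  also have "\<dots> = (\<integral>\<^sup>+r. ennreal (4 / 3 * pi * 3 * r\<^sup>2) * indicator {0..} r * h r \<partial>lborel)"
  proof (rule nn_integral_cong)
    fix r :: real
    have "ennreal (4 / 3 * pi * 3 * r\<^sup>2) = ennreal 2 * ennreal (2 * pi * r\<^sup>2)"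
      by (subst ennreal_mult[symmetric]) (auto simp: mult_ac)
    then show "ennreal 2 * indicator {0..} r * (ennreal (2 * pi * r\<^sup>2) * h r) = ennreal (4 / 3 * pi * 3 * r\<^sup>2) * indicator {0..} r * h r"
      by (simp add: mult_ac)
  qed
  also have "\<dots> = (\<integral>\<^sup>+x. h (norm x) \<partial>(lborel :: (real ^ 3) measure))"
  proof -
    have "unit_ball_vol 3 = 4 / 3 * pi"
      by (simp add: unit_ball_vol_numeral fact_numeral eval_nat_numeral)
    then show ?thesis by (subst nn_integral_radial) simp_all
  qed
  finally show ?thesis by simp
qed

text \<open>The factor 2 pi r^2 cancels the two extra normalising constants and leaves r^2, so
  moment m in dimension three is the absolute moment m + 2 of a real normal variable.\<close>

lemma std_gauss_norm_moment:
  assumes "has_bochner_integral lborel (\<lambda>g. std_normal_density g * \<bar>g\<bar> ^ (m + 2)) c"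
  shows "has_bochner_integral (std_gauss :: (real ^ 3) measure) (\<lambda>x. norm x ^ m) c"
proof (rule has_bochner_integral_nn_integral)
  have "c = (\<integral>g. std_normal_density g * \<bar>g\<bar> ^ (m + 2) \<partial>lborel)"
    using assms by (simp add: has_bochner_integral_iff)
  also have "\<dots> \<ge> 0" by (rule Bochner_Integration.integral_nonneg) simp
  finally have c: "c \<ge> 0" .
  then show "0 \<le> c" .
  define s where "s = 1 / sqrt (2 * pi)"
  have s: "s > 0" "s\<^sup>2 = 1 / (2 * pi)" by (simp_all add: s_def power_one_over)
  have "(\<integral>\<^sup>+x. ennreal (norm x ^ m) \<partial>(std_gauss :: (real ^ 3) measure)) =
    (\<integral>\<^sup>+x. ennreal (s ^ 3 * exp (- (norm x)\<^sup>2 / 2)) * ennreal (norm x ^ m) \<partial>(lborel :: (real ^ 3) measure))"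
    unfolding std_gauss_eq_density s_def[symmetric] by (subst nn_integral_density) simp_all
  also have "\<dots> = (\<integral>\<^sup>+r. ennreal (2 * pi * r\<^sup>2) * (ennreal (s ^ 3 * exp (- \<bar>r\<bar>\<^sup>2 / 2)) * ennreal (\<bar>r\<bar> ^ m)) \<partial>lborel)"
    by (rule nn_integral_radial_3) simp
  also have "\<dots> = (\<integral>\<^sup>+r. ennreal (std_normal_density r * \<bar>r\<bar> ^ (m + 2)) \<partial>lborel)"
  proof (rule nn_integral_cong)
    fix r :: real
    have "2 * pi * r\<^sup>2 * (s ^ 3 * exp (- \<bar>r\<bar>\<^sup>2 / 2) * \<bar>r\<bar> ^ m) = (2 * pi * s\<^sup>2) * (s * exp (- r\<^sup>2 / 2)) * \<bar>r\<bar> ^ (m + 2)"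
      by (simp add: power_add eval_nat_numeral)
    also have "\<dots> = std_normal_density r * \<bar>r\<bar> ^ (m + 2)"
      using s by (simp add: std_normal_density_def s_def)
    finally show "ennreal (2 * pi * r\<^sup>2) * (ennreal (s ^ 3 * exp (- \<bar>r\<bar>\<^sup>2 / 2)) * ennreal (\<bar>r\<bar> ^ m)) =
      ennreal (std_normal_density r * \<bar>r\<bar> ^ (m + 2))"
      using s by (simp add: ennreal_mult[symmetric])
  qed
  also have "\<dots> = ennreal c"
    using assms by (subst nn_integral_eq_integral) (auto simp: has_bochner_integral_iff)
  finally show "(\<integral>\<^sup>+x. ennreal (norm x ^ m) \<partial>(std_gauss :: (real ^ 3) measure)) = ennreal c" .
qed simp_all

lemma std_gauss_norm_moments:
  "has_bochner_integral (std_gauss :: (real ^ 3) measure) (\<lambda>x. norm x ^ 1) (2 * sqrt (2 / pi))"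
  "has_bochner_integral (std_gauss :: (real ^ 3) measure) (\<lambda>x. norm x ^ 3) (8 * sqrt (2 / pi))"
  "has_bochner_integral (std_gauss :: (real ^ 3) measure) (\<lambda>x. norm x ^ 2) 3"
  "has_bochner_integral (std_gauss :: (real ^ 3) measure) (\<lambda>x. norm x ^ 4) 15"
  "has_bochner_integral (std_gauss :: (real ^ 3) measure) (\<lambda>x. norm x ^ 6) 105"
proof -
  have *: "has_bochner_integral (std_gauss :: (real ^ 3) measure) (\<lambda>x. norm x ^ m) c"
    if "m + 2 = k" "has_bochner_integral lborel (\<lambda>g. std_normal_density g * \<bar>g\<bar> ^ k) c" for m k c
    using std_gauss_norm_moment[of m c] that(2) unfolding that(1)[symmetric] by blast
  show "has_bochner_integral (std_gauss :: (real ^ 3) measure) (\<lambda>x. norm x ^ 1) (2 * sqrt (2 / pi))"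
    by (rule *[of 1 3]) (use std_normal_moment_abs_odd[of 1] in \<open>simp_all add: mult_ac\<close>)
  show "has_bochner_integral (std_gauss :: (real ^ 3) measure) (\<lambda>x. norm x ^ 3) (8 * sqrt (2 / pi))"
    by (rule *[of 3 5]) (use std_normal_moment_abs_odd[of 2] in \<open>simp_all add: mult_ac\<close>)
  show "has_bochner_integral (std_gauss :: (real ^ 3) measure) (\<lambda>x. norm x ^ 2) 3"
    by (rule *[of 2 4]) (use std_normal_moment_even[of 2] in \<open>simp_all add: fact_numeral power_even_abs\<close>)
  show "has_bochner_integral (std_gauss :: (real ^ 3) measure) (\<lambda>x. norm x ^ 4) 15"
    by (rule *[of 4 6]) (use std_normal_moment_even[of 3] in \<open>simp_all add: fact_numeral power_even_abs\<close>)
  show "has_bochner_integral (std_gauss :: (real ^ 3) measure) (\<lambda>x. norm x ^ 6) 105"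
    by (rule *[of 6 8]) (use std_normal_moment_even[of 4] in \<open>simp_all add: fact_numeral power_even_abs\<close>)
qed

lemma std_gauss_integral_odd:
  fixes f :: "'a::euclidean_space \<Rightarrow> 'b::{banach, second_countable_topology}"
  assumes [measurable]: "f \<in> borel_measurable borel" and odd: "\<And>x. f (- x) = - f x"
  shows "integral\<^sup>L std_gauss f = 0"
proof -
  have "distr std_gauss borel uminus = (std_gauss :: 'a measure)"
    by (rule distr_std_gauss_isometry) (auto intro: linearI)
  then have "integral\<^sup>L std_gauss f = (\<integral>x. f x \<partial>distr std_gauss borel uminus)" by simp
  also have "\<dots> = (\<integral>x. f (- x) \<partial>std_gauss)"
    by (rule integral_distr) simp_all
  also have "\<dots> = - integral\<^sup>L std_gauss f" by (simp add: odd)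
  finally have "2 *\<^sub>R integral\<^sup>L std_gauss f = 0"
    unfolding scaleR_2 by (simp only: eq_neg_iff_add_eq_0)
  then show ?thesis by simp
qed

lemma std_gauss_real: "(std_gauss :: real measure) = std_normal"
  unfolding std_gauss_eq_density by (rule arg_cong[where f="density lborel"]) (simp add: std_normal_density_def fun_eq_iff)

lemma std_gauss_inner_square:
  fixes u :: "'a::euclidean_space"
  shows "has_bochner_integral std_gauss (\<lambda>y. (u \<bullet> y)\<^sup>2) ((norm u)\<^sup>2)"
proof (cases "u = 0")
  case False
  define e where "e = u /\<^sub>R norm u"
  have "norm e = 1" using False by (simp add: e_def)
  have "distr std_gauss borel (\<lambda>y. e \<bullet> y) = (std_gauss :: real measure)"
    by (rule distr_std_gauss_coisometry[where J="\<lambda>r. r *\<^sub>R e"])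
      (auto intro!: linearI simp: \<open>norm e = 1\<close> algebra_simps inner_commute)
  then have d: "distr std_gauss borel (\<lambda>y. e \<bullet> y) = std_normal" by (simp add: std_gauss_real)
  have "has_bochner_integral std_normal (\<lambda>r. r\<^sup>2) 1"
  proof -
    have "has_bochner_integral lborel (\<lambda>x. std_normal_density x *\<^sub>R x\<^sup>2) 1"
      using std_normal_moment_even[of 1] by simp
    then show ?thesis by (subst has_bochner_integral_density) simp_all
  qed
  then have "has_bochner_integral (distr std_gauss borel (\<lambda>y. e \<bullet> y)) (\<lambda>r. r\<^sup>2) 1"
    unfolding d .
  then have "has_bochner_integral std_gauss (\<lambda>y. (e \<bullet> y)\<^sup>2) 1"
    by (simp add: has_bochner_integral_iff integrable_distr_eq integral_distr)
  then have "has_bochner_integral std_gauss (\<lambda>y. (norm u)\<^sup>2 * (e \<bullet> y)\<^sup>2) ((norm u)\<^sup>2 * 1)"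
    by (intro has_bochner_integral_mult_right) 
  moreover have "(norm u)\<^sup>2 * (e \<bullet> y)\<^sup>2 = (u \<bullet> y)\<^sup>2" for y
    using False by (simp add: e_def power_mult_distrib power_inverse)
  ultimately show ?thesis by simp
qed (simp add: has_bochner_integral_zero)

lemma std_gauss_inner_inner:
  fixes u w :: "'a::euclidean_space"
  shows "has_bochner_integral std_gauss (\<lambda>y. (u \<bullet> y) * (w \<bullet> y)) (u \<bullet> w)"
proof -
  have "has_bochner_integral std_gauss (\<lambda>y. (((u + w) \<bullet> y)\<^sup>2 - ((u - w) \<bullet> y)\<^sup>2) / 4)
      (((norm (u + w))\<^sup>2 - (norm (u - w))\<^sup>2) / 4)"
    by (intro has_bochner_integral_divide_zero has_bochner_integral_diff std_gauss_inner_square)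
  moreover have "(((u + w) \<bullet> y)\<^sup>2 - ((u - w) \<bullet> y)\<^sup>2) / 4 = (u \<bullet> y) * (w \<bullet> y)" for y
    by (simp add: power2_eq_square inner_add_left inner_diff_left field_simps)
  moreover have "((norm (u + w))\<^sup>2 - (norm (u - w))\<^sup>2) / 4 = u \<bullet> w"
    unfolding power2_norm_eq_inner by (simp add: inner_add_left inner_diff_left inner_add_right inner_diff_right inner_commute)
  ultimately show ?thesis by simp
qed

lemma integrable_std_gauss_norm_power:
  "integrable (std_gauss :: (real ^ 3) measure) (\<lambda>x. norm x ^ m)"
proof -
  have "has_bochner_integral lborel (\<lambda>g. std_normal_density g * \<bar>g\<bar> ^ (m + 2)) (\<integral>g. std_normal_density g * \<bar>g\<bar> ^ (m + 2) \<partial>lborel)"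
    by (rule has_bochner_integral_integrable[OF integrable_std_normal_moment_abs])
  from std_gauss_norm_moment[OF this] show ?thesis by (simp add: has_bochner_integral_iff)
qed

lemma std_gauss_odd_pieces:
  fixes q :: "real ^ 3"
  shows "has_bochner_integral std_gauss (\<lambda>y. q \<bullet> y) 0"
    "has_bochner_integral std_gauss (\<lambda>y. (norm y)\<^sup>2 * (q \<bullet> y)) 0"
proof -
  have "integrable std_gauss (\<lambda>y :: real ^ 3. norm q * norm y ^ 1)" "integrable std_gauss (\<lambda>y :: real ^ 3. norm q * norm y ^ 3)"
    by (intro integrable_mult_right integrable_std_gauss_norm_power)+
  then have "integrable std_gauss (\<lambda>y. q \<bullet> y)" "integrable std_gauss (\<lambda>y. (norm y)\<^sup>2 * (q \<bullet> y))"
  proof -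
    have "norm (q \<bullet> y) \<le> norm (norm q * norm y ^ 1)" for y
      using Cauchy_Schwarz_ineq2[of q y] by simp
    then show "integrable std_gauss (\<lambda>y :: real ^ 3. norm q * norm y ^ 1) \<Longrightarrow> integrable std_gauss (\<lambda>y. q \<bullet> y)"
      by (elim Bochner_Integration.integrable_bound) auto
    have "norm ((norm y)\<^sup>2 * (q \<bullet> y)) \<le> norm (norm q * norm y ^ 3)" for y
      using mult_left_mono[OF Cauchy_Schwarz_ineq2[of q y], of "(norm y)\<^sup>2"]
      by (simp add: abs_mult eval_nat_numeral mult_ac)
    then show "integrable std_gauss (\<lambda>y :: real ^ 3. norm q * norm y ^ 3) \<Longrightarrow> integrable std_gauss (\<lambda>y. (norm y)\<^sup>2 * (q \<bullet> y))"
      by (elim Bochner_Integration.integrable_bound) auto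
  qed
  then show "has_bochner_integral std_gauss (\<lambda>y. q \<bullet> y) 0"
    "has_bochner_integral std_gauss (\<lambda>y. (norm y)\<^sup>2 * (q \<bullet> y)) 0"
    by (auto simp: has_bochner_integral_iff intro!: std_gauss_integral_odd)
qed

text \<open>The rotation-equivariant cubic Hermite polynomial, up to scaling. The constant 5 makes
  it orthogonal to the linear one: the fourth moment of the norm is 15, five times the
  second.\<close>

definition hermite3 :: "real ^ 3 \<Rightarrow> real ^ 3" where
  "hermite3 x = ((norm x)\<^sup>2 - 5) *\<^sub>R x"

text \<open>For an independent Gaussian y, t x + s y is a copy with correlation t to x. Averaging
  over y is the noise operator, of which this polynomial is an eigenfunction.\<close>

lemma integral_hermite3_mehler:
  fixes q x :: "real ^ 3"
  assumes "t\<^sup>2 + s\<^sup>2 = 1"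
  shows "(\<integral>y. q \<bullet> hermite3 (t *\<^sub>R x + s *\<^sub>R y) \<partial>std_gauss) = t ^ 3 * (q \<bullet> hermite3 x)"
proof -
  interpret prob_space "std_gauss :: (real ^ 3) measure" by (rule prob_space_std_gauss)
  have prob_UNIV: "prob UNIV = 1" using prob_space by simp
  have n: "(norm (t *\<^sub>R x + s *\<^sub>R y))\<^sup>2 = t\<^sup>2 * (norm x)\<^sup>2 + 2 * t * s * (x \<bullet> y) + s\<^sup>2 * (norm y)\<^sup>2" for y
    unfolding power2_norm_eq_inner
    by (simp add: inner_add_left inner_add_right inner_commute power2_eq_square algebra_simps)
  have "q \<bullet> hermite3 (t *\<^sub>R x + s *\<^sub>R y) =
    (t\<^sup>2 * (norm x)\<^sup>2 - 5) * t * (q \<bullet> x) + ((t\<^sup>2 * (norm x)\<^sup>2 - 5) * s) * (q \<bullet> y) +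
    (2 * t\<^sup>2 * s * (q \<bullet> x)) * (x \<bullet> y) + (2 * t * s\<^sup>2) * ((x \<bullet> y) * (q \<bullet> y)) +
    (t * s\<^sup>2 * (q \<bullet> x)) * norm y ^ 2 + s ^ 3 * ((norm y)\<^sup>2 * (q \<bullet> y))" for y
    unfolding hermite3_def n by (simp add: inner_add_right power2_eq_square power3_eq_cube algebra_simps)
  moreover have "has_bochner_integral std_gauss (\<lambda>y.
    (t\<^sup>2 * (norm x)\<^sup>2 - 5) * t * (q \<bullet> x) + ((t\<^sup>2 * (norm x)\<^sup>2 - 5) * s) * (q \<bullet> y) +
    (2 * t\<^sup>2 * s * (q \<bullet> x)) * (x \<bullet> y) + (2 * t * s\<^sup>2) * ((x \<bullet> y) * (q \<bullet> y)) +
    (t * s\<^sup>2 * (q \<bullet> x)) * norm y ^ 2 + s ^ 3 * ((norm y)\<^sup>2 * (q \<bullet> y)))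
    ((t\<^sup>2 * (norm x)\<^sup>2 - 5) * t * (q \<bullet> x) + ((t\<^sup>2 * (norm x)\<^sup>2 - 5) * s) * 0 +
    (2 * t\<^sup>2 * s * (q \<bullet> x)) * 0 + (2 * t * s\<^sup>2) * (x \<bullet> q) +
    (t * s\<^sup>2 * (q \<bullet> x)) * 3 + s ^ 3 * 0)"
    by (intro has_bochner_integral_add has_bochner_integral_mult_right std_gauss_inner_inner
        std_gauss_odd_pieces std_gauss_norm_moments(3))
      (auto simp: has_bochner_integral_iff prob_UNIV)
  ultimately have "(\<integral>y. q \<bullet> hermite3 (t *\<^sub>R x + s *\<^sub>R y) \<partial>std_gauss) =
    (t\<^sup>2 * (norm x)\<^sup>2 - 5) * t * (q \<bullet> x) + (2 * t * s\<^sup>2) * (x \<bullet> q) + (t * s\<^sup>2 * (q \<bullet> x)) * 3"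
    by (simp add: has_bochner_integral_iff)
  also have "\<dots> = t ^ 3 * (q \<bullet> hermite3 x)"
  proof -
    \<comment> \<open>The two second-order terms contribute (2 + 3) t s^2, which turns - 5 t into -
      5 t^3.\<close>
    have s2: "s\<^sup>2 = 1 - t\<^sup>2" using assms by simp
    show ?thesis
      unfolding s2 hermite3_def inner_scaleR_right inner_commute[of x q]
      by (simp add: power2_eq_square power3_eq_cube algebra_simps)
  qed
  finally show ?thesis .
qed

lemma integral_linear_mehler:
  fixes q x :: "real ^ 3"
  shows "(\<integral>y. q \<bullet> (t *\<^sub>R x + s *\<^sub>R y) \<partial>std_gauss) = t * (q \<bullet> x)"
proof -
  interpret prob_space "std_gauss :: (real ^ 3) measure" by (rule prob_space_std_gauss)
  have prob_UNIV: "prob UNIV = 1" using prob_space by simp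
  have "has_bochner_integral std_gauss (\<lambda>y. t * (q \<bullet> x) + s * (q \<bullet> y)) (t * (q \<bullet> x) + s * 0)"
    by (intro has_bochner_integral_add has_bochner_integral_mult_right std_gauss_odd_pieces)
      (auto simp: has_bochner_integral_iff prob_UNIV)
  then show ?thesis by (simp add: has_bochner_integral_iff inner_add_right)
qed

section \<open>Gaussian rounding\<close>

definition square_integrable_gauss :: "(real ^ 3 \<Rightarrow> real ^ 3) \<Rightarrow> bool" where
  "square_integrable_gauss q \<longleftrightarrow> q \<in> borel_measurable borel \<and> integrable std_gauss (\<lambda>x. (norm (q x))\<^sup>2)"

lemma square_integrable_gauss_add:
  assumes "square_integrable_gauss p" "square_integrable_gauss q"
  shows "square_integrable_gauss (\<lambda>x. p x + q x)"
proof -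
  have [measurable]: "p \<in> borel_measurable borel" "q \<in> borel_measurable borel"
    using assms by (auto simp: square_integrable_gauss_def)
  have "integrable std_gauss (\<lambda>x. 2 * (norm (p x))\<^sup>2 + 2 * (norm (q x))\<^sup>2)"
    using assms by (simp add: square_integrable_gauss_def)
  moreover have "norm ((norm (p x + q x))\<^sup>2) \<le> norm (2 * (norm (p x))\<^sup>2 + 2 * (norm (q x))\<^sup>2)" for x
  proof -
    have "(norm (p x + q x))\<^sup>2 \<le> (norm (p x) + norm (q x))\<^sup>2"
      by (intro power_mono norm_triangle_ineq) simp
    also have "\<dots> \<le> 2 * (norm (p x))\<^sup>2 + 2 * (norm (q x))\<^sup>2"
      using zero_le_power2[of "norm (p x) - norm (q x)"] by (simp add: power2_eq_square algebra_simps)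
    finally show ?thesis by simp
  qed
  ultimately have "integrable std_gauss (\<lambda>x. (norm (p x + q x))\<^sup>2)"
    by (elim Bochner_Integration.integrable_bound) auto
  then show ?thesis by (simp add: square_integrable_gauss_def)
qed

lemma square_integrable_gauss_scaleR:
  "square_integrable_gauss p \<Longrightarrow> square_integrable_gauss (\<lambda>x. c *\<^sub>R p x)"
  by (auto simp: square_integrable_gauss_def power_mult_distrib)

lemma square_integrable_gauss_diff:
  "square_integrable_gauss p \<Longrightarrow> square_integrable_gauss q \<Longrightarrow> square_integrable_gauss (\<lambda>x. p x - q x)"
  using square_integrable_gauss_add[of p "\<lambda>x. (- 1) *\<^sub>R q x"] square_integrable_gauss_scaleR[of q "- 1"] by simp

lemma square_integrable_gauss_ident: "square_integrable_gauss (\<lambda>x. x)"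
  using integrable_std_gauss_norm_power[of 2] by (simp add: square_integrable_gauss_def)

lemma hermite3_norm_square: "(norm (hermite3 x))\<^sup>2 = norm x ^ 6 - 10 * norm x ^ 4 + 25 * norm x ^ 2"
  by (simp add: hermite3_def power_mult_distrib) (simp add: eval_nat_numeral algebra_simps)

lemma square_integrable_gauss_hermite3: "square_integrable_gauss hermite3"
  unfolding square_integrable_gauss_def hermite3_norm_square
  using integrable_std_gauss_norm_power by (simp add: hermite3_def[abs_def])

text \<open>On vectors \<open>sgn\<close> is normalisation with value 0 at 0, the same convention as
  in \<open>rounded\<close>.\<close>

lemma square_integrable_gauss_sgn: "square_integrable_gauss sgn"
proof -
  interpret prob_space "std_gauss :: (real ^ 3) measure" by (rule prob_space_std_gauss)
  have [measurable]: "(sgn :: real ^ 3 \<Rightarrow> _) \<in> borel_measurable borel"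
    unfolding sgn_div_norm[abs_def] by measurable
  have "integrable std_gauss (\<lambda>x :: real ^ 3. (norm (sgn x))\<^sup>2)"
    by (rule integrable_const_bound[of _ 1]) (auto simp: norm_sgn)
  then show ?thesis by (simp add: square_integrable_gauss_def)
qed

text \<open>Supplies a Gaussian direction independent of two given ones, for which three dimensions
  are enough.\<close>

lemma ex_unit_orthogonal_pair:
  fixes a b :: "'a::euclidean_space"
  assumes "DIM('a) \<ge> 3"
  shows "\<exists>u. norm u = 1 \<and> u \<bullet> a = 0 \<and> u \<bullet> b = 0"
proof -
  have "dim {a, b} \<le> card {a, b}" by (intro dim_le_card') simp
  also have "\<dots> \<le> 2" by (cases "a = b") auto
  finally have "dim {a, b} < DIM('a)" using assms by simp
  then obtain x where x: "x \<noteq> 0" "\<And>y. y \<in> span {a, b} \<Longrightarrow> orthogonal x y"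
    using orthogonal_to_subspace_exists by blast
  then have "x \<bullet> a = 0" "x \<bullet> b = 0" by (simp_all add: orthogonal_def span_base)
  then show ?thesis using x(1) by (intro exI[of _ "x /\<^sub>R norm x"]) simp
qed

context
  fixes \<Omega> :: "'w measure" and R :: "'w \<Rightarrow> real ^ 'k::finite ^ 3"
  assumes prob: "prob_space \<Omega>" and gauss: "gaussian_matrix \<Omega> R" and card3: "CARD('k) \<ge> 3"
begin

lemma R_measurable [measurable]: "R \<in> borel_measurable \<Omega>"
  by (rule gaussian_matrix_std_gauss(1)[OF prob gauss])

lemma R_mult_measurable [measurable]: "(\<lambda>\<omega>. R \<omega> *v a) \<in> borel_measurable \<Omega>"
proof -
  have "continuous_on UNIV (\<lambda>A :: real ^ 'k ^ 3. A *v a)"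
    by (intro linear_continuous_on linear_linear[THEN iffD2] linearI)
      (auto simp: vec_eq_iff matrix_vector_mult_def sum.distrib sum_distrib_left algebra_simps)
  then have "(\<lambda>A :: real ^ 'k ^ 3. A *v a) \<in> borel_measurable borel"
    by (rule borel_measurable_continuous_onI)
  then show ?thesis by measurable
qed

lemma distr_R_coisometry:
  fixes L :: "real ^ 'k ^ 3 \<Rightarrow> 'b::euclidean_space"
  assumes J: "linear J" "\<And>x. J x \<bullet> J x = x \<bullet> x" and L: "\<And>x y. L x \<bullet> y = x \<bullet> J y"
  shows "distr \<Omega> borel (\<lambda>\<omega>. L (R \<omega>)) = std_gauss"
proof -
  have "linear L"
  proof (rule linearI)
    fix x y r
    have "\<forall>z. L (x + y) \<bullet> z = (L x + L y) \<bullet> z" "\<forall>z. L (r *\<^sub>R x) \<bullet> z = (r *\<^sub>R L x) \<bullet> z"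
      by (simp_all add: L inner_add_left)
    then show "L (x + y) = L x + L y" "L (r *\<^sub>R x) = r *\<^sub>R L x"
      by (simp_all only: vector_eq_rdot)
  qed
  then have "L \<in> borel_measurable borel"
    by (intro borel_measurable_continuous_onI linear_continuous_on linear_linear[THEN iffD2])
  then have "distr \<Omega> borel (\<lambda>\<omega>. L (R \<omega>)) = distr (distr \<Omega> borel R) borel L"
    by (subst distr_distr) (simp_all add: comp_def)
  also have "\<dots> = std_gauss"
    unfolding gaussian_matrix_std_gauss(2)[OF prob gauss]
    by (rule distr_std_gauss_coisometry[OF J(1) _ L]) (simp add: norm_eq J(2))
  finally show ?thesis .
qed

text \<open>The adjoint of applying a matrix to \<open>a\<close> sends y to the matrix with rows
  \<open>y $ i\<close> times \<open>a\<close>, an isometry for unit \<open>a\<close>. For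
  orthonormal vectors the same argument gives independent Gaussian vectors in the next two
  lemmas.\<close>

lemma law_1:
  assumes "norm a = 1"
  shows "distr \<Omega> borel (\<lambda>\<omega>. R \<omega> *v a) = std_gauss"
proof (rule distr_R_coisometry[where J="\<lambda>y. \<chi> i. y $ i *\<^sub>R a"])
  show "linear (\<lambda>y :: real ^ 3. \<chi> i. y $ i *\<^sub>R a)"
    by (rule linearI) (simp_all add: vec_eq_iff algebra_simps)
  have "a \<bullet> a = 1" using assms by (simp add: dot_square_norm)
  then show "(\<chi> i. y $ i *\<^sub>R a) \<bullet> (\<chi> i. y $ i *\<^sub>R a) = y \<bullet> y" for y :: "real ^ 3"
    by (simp add: inner_vec_def[of "vec_lambda _"] inner_vec_def[of y])
  show "(x *v a) \<bullet> y = x \<bullet> (\<chi> i. y $ i *\<^sub>R a)" for x :: "real ^ 'k ^ 3" and y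
    by (simp add: inner_vec_def[of "x *v a"] inner_vec_def[of x] matrix_vector_mul_component mult.commute)
qed

lemma law_2:
  assumes "norm a = 1" "norm b = 1" "a \<bullet> b = 0"
  shows "distr \<Omega> borel (\<lambda>\<omega>. (R \<omega> *v a, R \<omega> *v b)) = std_gauss \<Otimes>\<^sub>M std_gauss"
  unfolding std_gauss_prod[symmetric]
proof (rule distr_R_coisometry[where J="\<lambda>y. \<chi> i. fst y $ i *\<^sub>R a + snd y $ i *\<^sub>R b"])
  show "linear (\<lambda>y :: (real ^ 3) \<times> (real ^ 3). \<chi> i. fst y $ i *\<^sub>R a + snd y $ i *\<^sub>R b)"
    by (rule linearI) (simp_all add: vec_eq_iff algebra_simps)
  have "a \<bullet> a = 1" "b \<bullet> b = 1" using assms by (simp_all add: dot_square_norm)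
  then show "(\<chi> i. fst y $ i *\<^sub>R a + snd y $ i *\<^sub>R b) \<bullet> (\<chi> i. fst y $ i *\<^sub>R a + snd y $ i *\<^sub>R b) = y \<bullet> y"
    for y :: "(real ^ 3) \<times> (real ^ 3)"
    using assms(3)
    by (simp add: inner_vec_def[of "vec_lambda _"] inner_prod_def inner_vec_def[of "fst y"] inner_vec_def[of "snd y"]
      inner_add_left inner_add_right inner_commute[of b a] sum.distrib)
  show "(x *v a, x *v b) \<bullet> y = x \<bullet> (\<chi> i. fst y $ i *\<^sub>R a + snd y $ i *\<^sub>R b)" for x :: "real ^ 'k ^ 3" and y
    by (simp add: inner_prod_def inner_vec_def[of "x *v _"] inner_vec_def[of x] matrix_vector_mul_component
      inner_add_right sum.distrib mult.commute)
qed

lemma law_3: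
  assumes "norm a = 1" "norm b = 1" "norm c = 1" "a \<bullet> b = 0" "a \<bullet> c = 0" "b \<bullet> c = 0"
  shows "distr \<Omega> borel (\<lambda>\<omega>. (R \<omega> *v a, R \<omega> *v b, R \<omega> *v c)) = std_gauss \<Otimes>\<^sub>M (std_gauss \<Otimes>\<^sub>M std_gauss)"
  unfolding std_gauss_prod[symmetric]
proof (rule distr_R_coisometry[where J="\<lambda>y. \<chi> i. fst y $ i *\<^sub>R a + fst (snd y) $ i *\<^sub>R b + snd (snd y) $ i *\<^sub>R c"])
  show "linear (\<lambda>y :: (real ^ 3) \<times> (real ^ 3) \<times> (real ^ 3). \<chi> i. fst y $ i *\<^sub>R a + fst (snd y) $ i *\<^sub>R b + snd (snd y) $ i *\<^sub>R c)"
    by (rule linearI) (simp_all add: vec_eq_iff algebra_simps)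
  have "a \<bullet> a = 1" "b \<bullet> b = 1" "c \<bullet> c = 1" using assms by (simp_all add: dot_square_norm)
  then show "(\<chi> i. fst y $ i *\<^sub>R a + fst (snd y) $ i *\<^sub>R b + snd (snd y) $ i *\<^sub>R c) \<bullet>
      (\<chi> i. fst y $ i *\<^sub>R a + fst (snd y) $ i *\<^sub>R b + snd (snd y) $ i *\<^sub>R c) = y \<bullet> y"
    for y :: "(real ^ 3) \<times> (real ^ 3) \<times> (real ^ 3)"
    using assms(4-6)
    by (simp add: inner_vec_def[of "vec_lambda _"] inner_prod_def inner_vec_def[of "fst _"] inner_vec_def[of "snd _"]
      inner_add_left inner_add_right inner_commute[of b a] inner_commute[of c a] inner_commute[of c b] sum.distrib)
  show "(x *v a, x *v b, x *v c) \<bullet> y = x \<bullet> (\<chi> i. fst y $ i *\<^sub>R a + fst (snd y) $ i *\<^sub>R b + snd (snd y) $ i *\<^sub>R c)"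
    for x :: "real ^ 'k ^ 3" and y
    by (simp add: inner_prod_def inner_vec_def[of "x *v _"] inner_vec_def[of x] matrix_vector_mul_component
      inner_add_right sum.distrib mult.commute)
qed

lemma integrable_R_square:
  assumes "square_integrable_gauss q" "norm a = 1"
  shows "integrable \<Omega> (\<lambda>\<omega>. (norm (q (R \<omega> *v a)))\<^sup>2)"
proof -
  have [measurable]: "q \<in> borel_measurable borel" using assms(1) by (simp add: square_integrable_gauss_def)
  have "integrable (distr \<Omega> borel (\<lambda>\<omega>. R \<omega> *v a)) (\<lambda>x. (norm (q x))\<^sup>2)"
    unfolding law_1[OF assms(2)] using assms(1) by (simp add: square_integrable_gauss_def)
  then show ?thesis by (subst (asm) integrable_distr_eq) simp_all
qed

lemma integrable_R_inner:
  assumes q: "square_integrable_gauss q" and p: "square_integrable_gauss p" and "norm a = 1" "norm b = 1"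
  shows "integrable \<Omega> (\<lambda>\<omega>. q (R \<omega> *v a) \<bullet> p (R \<omega> *v b))"
proof -
  have [measurable]: "q \<in> borel_measurable borel" "p \<in> borel_measurable borel"
    using q p by (simp_all add: square_integrable_gauss_def)
  have "integrable \<Omega> (\<lambda>\<omega>. (norm (q (R \<omega> *v a)))\<^sup>2 + (norm (p (R \<omega> *v b)))\<^sup>2)"
    using assms by (intro Bochner_Integration.integrable_add integrable_R_square)
  moreover have "norm (q x \<bullet> p y) \<le> norm ((norm (q x))\<^sup>2 + (norm (p y))\<^sup>2)" for x y
  proof -
    have "2 * (norm (q x) * norm (p y)) \<le> (norm (q x))\<^sup>2 + (norm (p y))\<^sup>2"
      using zero_le_power2[of "norm (q x) - norm (p y)"] by (simp add: power2_eq_square algebra_simps)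
    moreover have "\<bar>q x \<bullet> p y\<bar> \<le> norm (q x) * norm (p y)" by (rule Cauchy_Schwarz_ineq2)
    moreover have "0 \<le> norm (q x) * norm (p y)" by simp
    ultimately show ?thesis unfolding real_norm_def by linarith
  qed
  ultimately show ?thesis by (elim Bochner_Integration.integrable_bound) auto
qed

text \<open>Writing \<open>b\<close> as \<open>t\<close> times \<open>a\<close> plus
  \<open>s\<close> times a unit vector orthogonal to \<open>a\<close> turns the pair into a Gaussian
  and its noisy copy. The premise \<open>mehler\<close> says that \<open>p\<close> is an
  eigenfunction of the noise operator with eigenvalue \<open>l\<close>.\<close>

lemma integral_R_mehler:
  assumes q: "square_integrable_gauss q" and p: "square_integrable_gauss p" and ab: "norm a = 1" "norm b = 1"
    and mehler: "\<And>s z x. (a \<bullet> b)\<^sup>2 + s\<^sup>2 = 1 \<Longrightarrow> (\<integral>y. z \<bullet> p ((a \<bullet> b) *\<^sub>R x + s *\<^sub>R y) \<partial>std_gauss) = l * (z \<bullet> p x)"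
  shows "(\<integral>\<omega>. q (R \<omega> *v a) \<bullet> p (R \<omega> *v b) \<partial>\<Omega>) = l * (\<integral>x. q x \<bullet> p x \<partial>std_gauss)"
proof -
  interpret P: pair_sigma_finite "std_gauss :: (real ^ 3) measure" "std_gauss :: (real ^ 3) measure"
    by (intro pair_sigma_finite.intro prob_space_imp_sigma_finite prob_space_std_gauss)
  have [measurable]: "q \<in> borel_measurable borel" "p \<in> borel_measurable borel"
    using q p by (simp_all add: square_integrable_gauss_def)
  define t where "t = a \<bullet> b"
  have aa: "a \<bullet> a = 1" and bb: "b \<bullet> b = 1" using ab by (simp_all add: dot_square_norm)
  define d where "d = b - t *\<^sub>R a"
  have dd: "d \<bullet> d = 1 - t\<^sup>2"
    using aa bb by (simp add: d_def t_def inner_diff_left inner_diff_right inner_commute power2_eq_square)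
  have ad: "a \<bullet> d = 0" using aa by (simp add: d_def t_def inner_diff_right)
  define s where "s = norm d"
  have s: "t\<^sup>2 + s\<^sup>2 = 1" using dd by (simp add: s_def power2_norm_eq_inner)
  obtain c where c: "norm c = 1" "a \<bullet> c = 0" "d = s *\<^sub>R c"
  \<comment> \<open>If \<open>b\<close> is \<open>a\<close> or its negative, then
    \<open>s = 0\<close> and any unit vector orthogonal to \<open>a\<close> serves as
    \<open>c\<close>.\<close>
  proof (cases "d = 0")
    case True
    obtain u where "norm u = 1" "u \<bullet> a = 0"
      using ex_unit_orthogonal_pair[of a a] card3 by auto
    then show thesis using True by (intro that[of u]) (auto simp: s_def inner_commute)
  next
    case False
    then show thesis using ad by (intro that[of "d /\<^sub>R norm d"]) (auto simp: s_def)
  qed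
  then have b: "b = t *\<^sub>R a + s *\<^sub>R c" by (simp add: d_def diff_eq_eq add.commute)
  have Rb: "R \<omega> *v b = t *\<^sub>R (R \<omega> *v a) + s *\<^sub>R (R \<omega> *v c)" for \<omega>
    unfolding b by (simp add: matrix_vector_right_distrib matrix_vector_mult_scaleR)
  define h where "h z = q (fst z) \<bullet> p (t *\<^sub>R fst z + s *\<^sub>R snd z)" for z
  have [measurable]: "h \<in> borel_measurable borel" unfolding h_def borel_prod[symmetric] by measurable
  note law = law_2[OF ab(1) c(1,2)]
  have hR: "q (R \<omega> *v a) \<bullet> p (R \<omega> *v b) = h (R \<omega> *v a, R \<omega> *v c)" for \<omega>
    by (simp add: h_def Rb)
  have pm [measurable]: "(\<lambda>\<omega>. (R \<omega> *v a, R \<omega> *v c)) \<in> borel_measurable \<Omega>"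
    unfolding borel_prod[symmetric] by measurable
  have "integrable \<Omega> (\<lambda>\<omega>. h (R \<omega> *v a, R \<omega> *v c))"
    using integrable_R_inner[OF q p ab] by (simp add: hR)
  then have int: "integrable (std_gauss \<Otimes>\<^sub>M std_gauss) h"
    unfolding law[symmetric] by (subst integrable_distr_eq) simp_all
  have "(\<integral>\<omega>. q (R \<omega> *v a) \<bullet> p (R \<omega> *v b) \<partial>\<Omega>) = integral\<^sup>L (std_gauss \<Otimes>\<^sub>M std_gauss) h"
    unfolding law[symmetric] hR by (subst integral_distr) simp_all
  also have "\<dots> = (\<integral>x. (\<integral>y. h (x, y) \<partial>std_gauss) \<partial>std_gauss)"
    by (rule P.integral_fst'[OF int, symmetric])
  also have "\<dots> = (\<integral>x. l * (q x \<bullet> p x) \<partial>std_gauss)"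
    using mehler s by (simp add: h_def t_def)
  finally show ?thesis by simp
qed

text \<open>Conditionally on the common component, the two arguments of \<open>g\<close> are independent and identically
  distributed.\<close>

lemma integral_R_nonneg:
  assumes g: "square_integrable_gauss g" and ab: "norm a = 1" "norm b = 1" "a \<bullet> b \<ge> 0"
  shows "(\<integral>\<omega>. g (R \<omega> *v a) \<bullet> g (R \<omega> *v b) \<partial>\<Omega>) \<ge> 0"
proof -
  interpret P: pair_sigma_finite "std_gauss :: (real ^ 3) measure" "std_gauss :: (real ^ 3) measure"
    by (intro pair_sigma_finite.intro prob_space_imp_sigma_finite prob_space_std_gauss)
  interpret PP: pair_sigma_finite "std_gauss :: (real ^ 3) measure" "(std_gauss :: (real ^ 3) measure) \<Otimes>\<^sub>M (std_gauss :: (real ^ 3) measure)"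
    unfolding std_gauss_prod[symmetric]
    by (intro pair_sigma_finite.intro prob_space_imp_sigma_finite prob_space_std_gauss)
  have [measurable]: "g \<in> borel_measurable borel"
    using g by (simp add: square_integrable_gauss_def)
  define t where "t = a \<bullet> b"
  have aa: "a \<bullet> a = 1" and bb: "b \<bullet> b = 1" using ab by (simp_all add: dot_square_norm)
  have t: "0 \<le> t" "t \<le> 1"
    using ab Cauchy_Schwarz_ineq2[of a b] by (simp_all add: t_def)
  show ?thesis
  \<comment> \<open>For \<open>t = 1\<close> the vectors below would be divided by
    \<open>s = 0\<close>, but then \<open>a = b\<close> and the integrand is a square.\<close>
  proof (cases "t = 1")
    case True
    have "(a - b) \<bullet> (a - b) = 0"
      using True aa bb by (simp add: t_def inner_diff_left inner_diff_right inner_commute)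
    then have "a = b" by simp
    then show ?thesis by simp
  next
    case False
    then have t1: "t < 1" using t by simp
    obtain u where u: "norm u = 1" "u \<bullet> a = 0" "u \<bullet> b = 0"
      using ex_unit_orthogonal_pair[of a b] card3 by auto
    have uu: "u \<bullet> u = 1" using u by (simp add: dot_square_norm)
    \<comment> \<open>A common component \<open>e\<close> has to be a unit vector whose inner
      products with \<open>a\<close> and \<open>b\<close> are both sqrt t, so that the residuals are
      orthogonal. The inner products determine \<open>\<alpha>\<close>, the unit length determines
      \<open>\<beta>\<close>.\<close>
    define \<alpha> where "\<alpha> = sqrt t / (1 + t)"
    define \<beta> where "\<beta> = sqrt ((1 - t) / (1 + t))"
    define e where "e = \<alpha> *\<^sub>R (a + b) + \<beta> *\<^sub>R u"
    define r where "r = sqrt t"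
    define s where "s = sqrt (1 - t)"
    have r2: "r * r = t" and s2: "s * s = 1 - t" and s0: "s > 0" using t t1 by (simp_all add: r_def s_def)
    have \<alpha>: "\<alpha> * (1 + t) = r" using t by (simp add: \<alpha>_def r_def)
    have \<beta>2: "\<beta> * \<beta> * (1 + t) = 1 - t" using t by (simp add: \<beta>_def)
    have ea: "e \<bullet> a = r" and eb: "e \<bullet> b = r"
      using aa bb u \<alpha> by (simp_all add: e_def inner_add_left t_def[symmetric] inner_commute[of b a] algebra_simps)
    have "e \<bullet> e = \<alpha> * (e \<bullet> a + e \<bullet> b) + \<beta> * (e \<bullet> u)"
      by (subst (2) e_def) (simp add: inner_add_right)
    also have "e \<bullet> u = \<beta>"
      using u uu by (simp add: e_def inner_add_left inner_commute[of a u] inner_commute[of b u])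
    finally have "(e \<bullet> e) * (1 + t) = 2 * r * (\<alpha> * (1 + t)) + \<beta> * \<beta> * (1 + t)"
      by (simp add: ea eb algebra_simps)
    also have "\<dots> = 1 + t" by (simp only: \<alpha> \<beta>2) (simp add: r2 mult.assoc)
    finally have ee: "e \<bullet> e = 1" using t by simp
    define c where "c = (1 / s) *\<^sub>R (a - r *\<^sub>R e)"
    define d where "d = (1 / s) *\<^sub>R (b - r *\<^sub>R e)"
    have "s *\<^sub>R c = a - r *\<^sub>R e" "s *\<^sub>R d = b - r *\<^sub>R e" using s0 by (simp_all add: c_def d_def)
    then have a: "a = r *\<^sub>R e + s *\<^sub>R c" and b: "b = r *\<^sub>R e + s *\<^sub>R d" by simp_all
    have "(a - r *\<^sub>R e) \<bullet> (a - r *\<^sub>R e) = s * s" "(b - r *\<^sub>R e) \<bullet> (b - r *\<^sub>R e) = s * s"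
      using aa bb ea eb ee r2 s2
      by (simp_all add: inner_diff_left inner_diff_right inner_commute[of a e] inner_commute[of b e] mult.assoc[symmetric])
    then have "c \<bullet> c = 1" "d \<bullet> d = 1" using s0 by (simp_all add: c_def d_def)
    then have cd: "norm c = 1" "norm d = 1" "norm e = 1" using ee by (simp_all add: norm_eq_1)
    have "(a - r *\<^sub>R e) \<bullet> (b - r *\<^sub>R e) = 0"
      using ea eb ee r2
      by (simp add: inner_diff_left inner_diff_right inner_commute[of a e] inner_commute[of b e] t_def[symmetric]
         mult.assoc[symmetric])
    then have cd0: "c \<bullet> d = 0" by (simp add: c_def d_def)
    have ecd: "e \<bullet> c = 0" "e \<bullet> d = 0"
      using ea eb ee by (simp_all add: c_def d_def inner_diff_right)
    have Ra: "R \<omega> *v a = r *\<^sub>R (R \<omega> *v e) + s *\<^sub>R (R \<omega> *v c)" for \<omega>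
      by (subst a) (simp add: matrix_vector_right_distrib matrix_vector_mult_scaleR)
    have Rb: "R \<omega> *v b = r *\<^sub>R (R \<omega> *v e) + s *\<^sub>R (R \<omega> *v d)" for \<omega>
      by (subst b) (simp add: matrix_vector_right_distrib matrix_vector_mult_scaleR)
    define h where "h z = g (r *\<^sub>R fst z + s *\<^sub>R fst (snd z)) \<bullet> g (r *\<^sub>R fst z + s *\<^sub>R snd (snd z))" for z
    have [measurable]: "h \<in> borel_measurable borel" unfolding h_def borel_prod[symmetric] by measurable
    note law = law_3[OF cd(3,1,2) ecd cd0]
    have hR: "g (R \<omega> *v a) \<bullet> g (R \<omega> *v b) = h (R \<omega> *v e, R \<omega> *v c, R \<omega> *v d)" for \<omega>
      by (simp add: h_def Ra Rb)
    have pm [measurable]: "(\<lambda>\<omega>. (R \<omega> *v e, R \<omega> *v c, R \<omega> *v d)) \<in> borel_measurable \<Omega>"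
      unfolding borel_prod[symmetric] by measurable
    have "integrable \<Omega> (\<lambda>\<omega>. h (R \<omega> *v e, R \<omega> *v c, R \<omega> *v d))"
      using integrable_R_inner[OF g g ab(1,2)] by (simp add: hR)
    then have int: "integrable (std_gauss \<Otimes>\<^sub>M (std_gauss \<Otimes>\<^sub>M std_gauss)) h"
      unfolding law[symmetric] by (subst integrable_distr_eq) simp_all
    define k where "k z = (norm (g (r *\<^sub>R fst z + s *\<^sub>R snd z)))\<^sup>2" for z
    have [measurable]: "k \<in> borel_measurable borel" unfolding k_def borel_prod[symmetric] by measurable
    have pm2 [measurable]: "(\<lambda>\<omega>. (R \<omega> *v e, R \<omega> *v c)) \<in> borel_measurable \<Omega>"
      unfolding borel_prod[symmetric] by measurable
    have "integrable \<Omega> (\<lambda>\<omega>. k (R \<omega> *v e, R \<omega> *v c))"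
      using integrable_R_square[OF g ab(1)] by (simp add: k_def Ra)
    then have intk: "integrable (std_gauss \<Otimes>\<^sub>M std_gauss) k"
      unfolding law_2[OF cd(3,1) ecd(1), symmetric] by (subst integrable_distr_eq) simp_all
    \<comment> \<open>For fixed x the inner integral is the mean of \<open>g\<close> paired with
      itself. Fubini grants the integrability needed for this only almost everywhere.\<close>
    have "AE x in std_gauss. 0 \<le> (\<integral>y. h (x, y) \<partial>(std_gauss \<Otimes>\<^sub>M std_gauss))"
      using PP.AE_integrable_fst'[OF int] P.AE_integrable_fst'[OF intk]
    proof eventually_elim
      case (elim x)
      interpret prob_space "std_gauss :: (real ^ 3) measure" by (rule prob_space_std_gauss)
      have "integrable std_gauss (\<lambda>y. g (r *\<^sub>R x + s *\<^sub>R y))"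
      proof (rule Bochner_Integration.integrable_bound)
        show "integrable std_gauss (\<lambda>y. 1 + k (x, y))" using elim(2) by simp
        have "z \<le> 1 + z\<^sup>2" for z :: real
          using zero_le_power2[of "z - 1 / 2"] by (simp add: power2_eq_square algebra_simps)
        then show "AE y in std_gauss. norm (g (r *\<^sub>R x + s *\<^sub>R y)) \<le> norm (1 + k (x, y))"
          by (intro AE_I2) (simp add: k_def)
      qed simp
      note ig = this
      have "(\<integral>y. h (x, y) \<partial>(std_gauss \<Otimes>\<^sub>M std_gauss)) = (\<integral>y. (\<integral>z. h (x, y, z) \<partial>std_gauss) \<partial>std_gauss)"
        using P.integral_fst'[OF elim(1)] by simp
      also have "\<dots> = (\<integral>y. g (r *\<^sub>R x + s *\<^sub>R y) \<bullet> (\<integral>z. g (r *\<^sub>R x + s *\<^sub>R z) \<partial>std_gauss) \<partial>std_gauss)"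
        using ig by (simp add: h_def)
      also have "\<dots> = (\<integral>z. g (r *\<^sub>R x + s *\<^sub>R z) \<partial>std_gauss) \<bullet> (\<integral>z. g (r *\<^sub>R x + s *\<^sub>R z) \<partial>std_gauss)"
        using ig by simp
      finally show ?case by simp
    qed
    then have "0 \<le> (\<integral>x. (\<integral>y. h (x, y) \<partial>(std_gauss \<Otimes>\<^sub>M std_gauss)) \<partial>std_gauss)"
      by (rule integral_nonneg_AE)
    also have "\<dots> = integral\<^sup>L (std_gauss \<Otimes>\<^sub>M (std_gauss \<Otimes>\<^sub>M std_gauss)) h"
      by (rule PP.integral_fst'[OF int])
    also have "\<dots> = (\<integral>\<omega>. g (R \<omega> *v a) \<bullet> g (R \<omega> *v b) \<partial>\<Omega>)"
      unfolding law[symmetric] hR by (subst integral_distr) simp_all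
    finally show ?thesis .
  qed
qed

end

text \<open>All integrands are polynomials in the norm. The entries arise as - 2 = 8 - 10 and 30 =
  105 - 150 + 75, and the mixed terms vanish by 15 - 5 * 3 = 0.\<close>

lemma std_gauss_hermite_moments:
  fixes \<alpha> \<beta> :: real
  shows "(\<integral>x. sgn x \<bullet> x \<partial>(std_gauss :: (real ^ 3) measure)) = 2 * sqrt (2 / pi)"
    "(\<integral>x. sgn x \<bullet> hermite3 x \<partial>std_gauss) = - 2 * sqrt (2 / pi)"
    "(\<integral>x. (\<alpha> *\<^sub>R x + \<beta> *\<^sub>R hermite3 x) \<bullet> x \<partial>std_gauss) = 3 * \<alpha>"
    "(\<integral>x. (\<alpha> *\<^sub>R x + \<beta> *\<^sub>R hermite3 x) \<bullet> hermite3 x \<partial>std_gauss) = 30 * \<beta>"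
proof -
  note hbi = std_gauss_norm_moments
  have sx: "sgn x \<bullet> x = norm x" for x :: "real ^ 3"
    by (cases "x = 0") (simp_all add: sgn_div_norm dot_square_norm power2_eq_square)
  have xx: "x \<bullet> x = norm x ^ 2" for x :: "real ^ 3"
    by (simp add: dot_square_norm)
  show "(\<integral>x. sgn x \<bullet> x \<partial>(std_gauss :: (real ^ 3) measure)) = 2 * sqrt (2 / pi)"
    using hbi(1) by (simp add: sx has_bochner_integral_iff)
  have "sgn x \<bullet> hermite3 x = norm x ^ 3 - 5 * norm x ^ 1" for x
    by (simp add: hermite3_def sx power2_eq_square power3_eq_cube algebra_simps)
  moreover have "has_bochner_integral std_gauss (\<lambda>x :: real ^ 3. norm x ^ 3 - 5 * norm x ^ 1)
      (8 * sqrt (2 / pi) - 5 * (2 * sqrt (2 / pi)))"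
    by (intro has_bochner_integral_diff has_bochner_integral_mult_right hbi)
  ultimately show "(\<integral>x. sgn x \<bullet> hermite3 x \<partial>std_gauss) = - 2 * sqrt (2 / pi)"
    by (simp add: has_bochner_integral_iff)
  have "(\<alpha> *\<^sub>R x + \<beta> *\<^sub>R hermite3 x) \<bullet> x = \<alpha> * norm x ^ 2 + \<beta> * (norm x ^ 4 - 5 * norm x ^ 2)" for x
    by (simp add: hermite3_def inner_add_left xx) (simp add: eval_nat_numeral algebra_simps)
  moreover have "has_bochner_integral std_gauss (\<lambda>x :: real ^ 3. \<alpha> * norm x ^ 2 + \<beta> * (norm x ^ 4 - 5 * norm x ^ 2))
      (\<alpha> * 3 + \<beta> * (15 - 5 * 3))"
    by (intro has_bochner_integral_diff has_bochner_integral_add has_bochner_integral_mult_right hbi)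
  ultimately show "(\<integral>x. (\<alpha> *\<^sub>R x + \<beta> *\<^sub>R hermite3 x) \<bullet> x \<partial>std_gauss) = 3 * \<alpha>"
    by (simp add: has_bochner_integral_iff)
  have "(\<alpha> *\<^sub>R x + \<beta> *\<^sub>R hermite3 x) \<bullet> hermite3 x =
      \<alpha> * (norm x ^ 4 - 5 * norm x ^ 2) + \<beta> * (norm x ^ 6 - 10 * norm x ^ 4 + 25 * norm x ^ 2)" for x
    by (simp add: hermite3_def inner_add_left xx) (simp add: eval_nat_numeral algebra_simps)
  moreover have "has_bochner_integral std_gauss (\<lambda>x :: real ^ 3.
      \<alpha> * (norm x ^ 4 - 5 * norm x ^ 2) + \<beta> * (norm x ^ 6 - 10 * norm x ^ 4 + 25 * norm x ^ 2))
      (\<alpha> * (15 - 5 * 3) + \<beta> * (105 - 10 * 15 + 25 * 3))"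
    by (intro has_bochner_integral_diff has_bochner_integral_add has_bochner_integral_mult_right hbi)
  ultimately show "(\<integral>x. (\<alpha> *\<^sub>R x + \<beta> *\<^sub>R hermite3 x) \<bullet> hermite3 x \<partial>std_gauss) = 30 * \<beta>"
    by (simp add: has_bochner_integral_iff)
qed

context
  fixes \<Omega> :: "'w measure" and R :: "'w \<Rightarrow> real ^ 'k::finite ^ 3"
  assumes prob: "prob_space \<Omega>" and gauss: "gaussian_matrix \<Omega> R" and card3: "CARD('k) \<ge> 3"
begin

lemmas int_inner = integrable_R_inner[OF prob gauss card3]

text \<open>The Gaussian noise operator is diagonal on Hermite polynomials, with eigenvalues \<open>t\<close> and \<open>t\<^sup>3\<close>
  on the two that are used here.\<close>

lemma integral_R_hermite_remainder:
  fixes \<alpha> \<beta> :: real and a b :: "real ^ 'k"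
  assumes ab: "norm a = 1" "norm b = 1"
  defines "t \<equiv> a \<bullet> b" and "m \<equiv> 2 * sqrt (2 / pi)"
    and "g \<equiv> \<lambda>x. sgn x - (\<alpha> *\<^sub>R x + \<beta> *\<^sub>R hermite3 x)"
  shows "(\<integral>\<omega>. g (R \<omega> *v a) \<bullet> g (R \<omega> *v b) \<partial>\<Omega>) =
    (\<integral>\<omega>. sgn (R \<omega> *v a) \<bullet> sgn (R \<omega> *v b) \<partial>\<Omega>) -
    2 * (\<alpha> * (t * m) - \<beta> * (t ^ 3 * m)) + (\<alpha> * (t * (3 * \<alpha>)) + \<beta> * (t ^ 3 * (30 * \<beta>)))"
proof -
  define P where "P x = \<alpha> *\<^sub>R x + \<beta> *\<^sub>R hermite3 x" for x
  note sq = square_integrable_gauss_sgn square_integrable_gauss_ident square_integrable_gauss_hermite3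
  have sP: "square_integrable_gauss P"
    unfolding P_def[abs_def] by (intro square_integrable_gauss_add square_integrable_gauss_scaleR sq)
  have lin: "(\<integral>\<omega>. q (R \<omega> *v a) \<bullet> (R \<omega> *v b) \<partial>\<Omega>) = (a \<bullet> b) * (\<integral>x. q x \<bullet> x \<partial>std_gauss)"
    if "square_integrable_gauss q" "norm a = 1" "norm b = 1" for q and a b :: "real ^ 'k"
    using integral_R_mehler[OF prob gauss card3 that(1) sq(2) that(2,3)] by (simp add: integral_linear_mehler)
  have cub: "(\<integral>\<omega>. q (R \<omega> *v a) \<bullet> hermite3 (R \<omega> *v b) \<partial>\<Omega>) = (a \<bullet> b) ^ 3 * (\<integral>x. q x \<bullet> hermite3 x \<partial>std_gauss)"
    if "square_integrable_gauss q" "norm a = 1" "norm b = 1" for q and a b :: "real ^ 'k"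
    using integral_R_mehler[OF prob gauss card3 that(1) sq(3) that(2,3)] by (simp add: integral_hermite3_mehler)
  have P: "(\<integral>\<omega>. q (R \<omega> *v a) \<bullet> P (R \<omega> *v b) \<partial>\<Omega>) =
      \<alpha> * ((a \<bullet> b) * (\<integral>x. q x \<bullet> x \<partial>std_gauss)) + \<beta> * ((a \<bullet> b) ^ 3 * (\<integral>x. q x \<bullet> hermite3 x \<partial>std_gauss))"
    if q: "square_integrable_gauss q" "norm a = 1" "norm b = 1" for q and a b :: "real ^ 'k"
    using int_inner[OF q(1) sq(2) q(2,3)] int_inner[OF q(1) sq(3) q(2,3)]
    by (simp add: P_def inner_add_right lin[OF q] cub[OF q])
  have fP: "(\<integral>\<omega>. sgn (R \<omega> *v a) \<bullet> P (R \<omega> *v b) \<partial>\<Omega>) = \<alpha> * (t * m) - \<beta> * (t ^ 3 * m)"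
    using P[OF sq(1) ab] by (simp add: std_gauss_hermite_moments m_def t_def)
  \<comment> \<open>\<open>P\<close> holds for arbitrary unit vectors, so it also covers
    \<open>a\<close> and \<open>b\<close> exchanged.\<close>
  have Pf: "(\<integral>\<omega>. P (R \<omega> *v a) \<bullet> sgn (R \<omega> *v b) \<partial>\<Omega>) = \<alpha> * (t * m) - \<beta> * (t ^ 3 * m)"
    using P[OF sq(1) ab(2,1)]
    by (simp add: std_gauss_hermite_moments m_def t_def inner_commute[of "P _"] inner_commute[of b a])
  have PP: "(\<integral>\<omega>. P (R \<omega> *v a) \<bullet> P (R \<omega> *v b) \<partial>\<Omega>) = \<alpha> * (t * (3 * \<alpha>)) + \<beta> * (t ^ 3 * (30 * \<beta>))"
    using P[OF sP ab] unfolding P_def by (simp only: std_gauss_hermite_moments t_def)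
  have "(\<integral>\<omega>. g (R \<omega> *v a) \<bullet> g (R \<omega> *v b) \<partial>\<Omega>) =
    (\<integral>\<omega>. sgn (R \<omega> *v a) \<bullet> sgn (R \<omega> *v b) - sgn (R \<omega> *v a) \<bullet> P (R \<omega> *v b)
      - P (R \<omega> *v a) \<bullet> sgn (R \<omega> *v b) + P (R \<omega> *v a) \<bullet> P (R \<omega> *v b) \<partial>\<Omega>)"
    by (rule Bochner_Integration.integral_cong)
      (simp_all add: g_def P_def[symmetric] inner_diff_left inner_diff_right)
  also have "\<dots> = (\<integral>\<omega>. sgn (R \<omega> *v a) \<bullet> sgn (R \<omega> *v b) \<partial>\<Omega>) - (\<integral>\<omega>. sgn (R \<omega> *v a) \<bullet> P (R \<omega> *v b) \<partial>\<Omega>)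
      - (\<integral>\<omega>. P (R \<omega> *v a) \<bullet> sgn (R \<omega> *v b) \<partial>\<Omega>) + (\<integral>\<omega>. P (R \<omega> *v a) \<bullet> P (R \<omega> *v b) \<partial>\<Omega>)"
    using int_inner[OF sq(1) sq(1) ab] int_inner[OF sq(1) sP ab] int_inner[OF sP sq(1) ab] int_inner[OF sP sP ab]
    by simp
  finally show ?thesis by (simp add: fP Pf PP)
qed

lemma square_integrable_remainder:
  "square_integrable_gauss (\<lambda>x. sgn x - (\<alpha> *\<^sub>R x + \<beta> *\<^sub>R hermite3 x))"
  by (intro square_integrable_gauss_diff square_integrable_gauss_add square_integrable_gauss_scaleR
      square_integrable_gauss_sgn square_integrable_gauss_ident square_integrable_gauss_hermite3)

text \<open>The coefficients \<open>m / 3\<close> and \<open>- m / 30\<close> are those of the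
  orthogonal projection of \<open>sgn\<close>: its moments \<open>m\<close> and \<open>- m\<close>
  divided by the squared norms 3 and 30. The nonnegative remainder is then the correlation minus m^2
  (t / 3 + t^3 / 30), with m^2 = 8 / pi.\<close>

lemma rounding_lower_bound:
  fixes a b :: "real ^ 'k"
  assumes ab: "norm a = 1" "norm b = 1" "a \<bullet> b \<ge> 0"
  shows "(\<integral>\<omega>. sgn (R \<omega> *v a) \<bullet> sgn (R \<omega> *v b) \<partial>\<Omega>) \<ge> 8 / (3 * pi) * ((a \<bullet> b) + (a \<bullet> b) ^ 3 / 10)"
proof -
  define t where "t = a \<bullet> b"
  define m where "m = 2 * sqrt (2 / pi)"
  have "m * m = 8 / pi" by (simp add: m_def)
  have "0 \<le> (\<integral>\<omega>. sgn (R \<omega> *v a) \<bullet> sgn (R \<omega> *v b) \<partial>\<Omega>) -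
    2 * ((m / 3) * (t * m) - (- m / 30) * (t ^ 3 * m)) + ((m / 3) * (t * (3 * (m / 3))) + (- m / 30) * (t ^ 3 * (30 * (- m / 30))))"
    using integral_R_nonneg[OF prob gauss card3 square_integrable_remainder[of "m / 3" "- m / 30"] ab]
    unfolding integral_R_hermite_remainder[OF ab(1,2)] by (simp add: t_def m_def)
  also have "\<dots> = (\<integral>\<omega>. sgn (R \<omega> *v a) \<bullet> sgn (R \<omega> *v b) \<partial>\<Omega>) - (m * m) * (t / 3 + t ^ 3 / 30)"
    by (simp add: field_simps)
  finally show ?thesis unfolding \<open>m * m = 8 / pi\<close> t_def[symmetric] by (simp add: field_simps)
qed

text \<open>Removes only the linear part and bounds the correlation of the remainders by their
  squared norm. It is weaker than the cubic bound for negative inner products but gives an upper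
  bound for positive ones, where positivity of the remainder gives only a lower bound.\<close>

lemma rounding_crude_bound:
  fixes a b :: "real ^ 'k"
  assumes ab: "norm a = 1" "norm b = 1"
  shows "\<bar>(\<integral>\<omega>. sgn (R \<omega> *v a) \<bullet> sgn (R \<omega> *v b) \<partial>\<Omega>) - 8 / (3 * pi) * (a \<bullet> b)\<bar> \<le> 1 - 8 / (3 * pi)"
proof -
  interpret prob_space \<Omega> by (rule prob)
  define m where "m = 2 * sqrt (2 / pi)"
  have mm: "m * m = 8 / pi" by (simp add: m_def)
  define g where "g x = sgn x - ((m / 3) *\<^sub>R x + 0 *\<^sub>R hermite3 x)" for x
  have g: "square_integrable_gauss g"
    unfolding g_def[abs_def] by (rule square_integrable_remainder)
  have rem: "(\<integral>\<omega>. g (R \<omega> *v a) \<bullet> g (R \<omega> *v b) \<partial>\<Omega>) =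
      (\<integral>\<omega>. sgn (R \<omega> *v a) \<bullet> sgn (R \<omega> *v b) \<partial>\<Omega>) - 8 / (3 * pi) * (a \<bullet> b)"
    if ab: "norm a = 1" "norm b = 1" for a b :: "real ^ 'k"
  proof -
    have "(\<integral>\<omega>. g (R \<omega> *v a) \<bullet> g (R \<omega> *v b) \<partial>\<Omega>) =
      (\<integral>\<omega>. sgn (R \<omega> *v a) \<bullet> sgn (R \<omega> *v b) \<partial>\<Omega>) - (m * m) * ((a \<bullet> b) / 3)"
      unfolding g_def integral_R_hermite_remainder[OF ab] by (simp add: m_def[symmetric] field_simps)
    then show ?thesis by (simp add: mm)
  qed
  \<comment> \<open>An inequality suffices because \<open>sgn\<close> has norm at most 1 everywhere,
    so the null event at 0 needs no treatment.\<close>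
  have sq: "(\<integral>\<omega>. g (R \<omega> *v a) \<bullet> g (R \<omega> *v a) \<partial>\<Omega>) \<le> 1 - 8 / (3 * pi)" if a: "norm a = 1" for a :: "real ^ 'k"
  proof -
    have "(\<integral>\<omega>. sgn (R \<omega> *v a) \<bullet> sgn (R \<omega> *v a) \<partial>\<Omega>) \<le> (\<integral>\<omega>. 1 \<partial>\<Omega>)"
      using int_inner[OF square_integrable_gauss_sgn square_integrable_gauss_sgn a a]
      by (intro integral_mono) (auto simp: dot_square_norm norm_sgn)
    then show ?thesis using rem[OF a a] a by (simp add: prob_space dot_square_norm)
  qed
  have "\<bar>2 * (\<integral>\<omega>. g (R \<omega> *v a) \<bullet> g (R \<omega> *v b) \<partial>\<Omega>)\<bar> \<le>
     (\<integral>\<omega>. g (R \<omega> *v a) \<bullet> g (R \<omega> *v a) + g (R \<omega> *v b) \<bullet> g (R \<omega> *v b) \<partial>\<Omega>)"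
  proof -
    have "\<bar>2 * (x \<bullet> y)\<bar> \<le> x \<bullet> x + y \<bullet> y" for x y :: "real ^ 3"
      using inner_ge_zero[of "x + y"] inner_ge_zero[of "x - y"]
      by (simp add: inner_add_left inner_add_right inner_diff_left inner_diff_right inner_commute)
    then have "norm (2 * (g (R \<omega> *v a) \<bullet> g (R \<omega> *v b))) \<le> g (R \<omega> *v a) \<bullet> g (R \<omega> *v a) + g (R \<omega> *v b) \<bullet> g (R \<omega> *v b)" for \<omega>
      by simp
    then have "norm (\<integral>\<omega>. 2 * (g (R \<omega> *v a) \<bullet> g (R \<omega> *v b)) \<partial>\<Omega>) \<le>
      (\<integral>\<omega>. g (R \<omega> *v a) \<bullet> g (R \<omega> *v a) + g (R \<omega> *v b) \<bullet> g (R \<omega> *v b) \<partial>\<Omega>)"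
      using int_inner[OF g g ab(1) ab(1)] int_inner[OF g g ab(2) ab(2)] int_inner[OF g g ab]
      by (intro order_trans[OF integral_norm_bound] integral_mono) auto
    then show ?thesis by simp
  qed
  also have "\<dots> = (\<integral>\<omega>. g (R \<omega> *v a) \<bullet> g (R \<omega> *v a) \<partial>\<Omega>) + (\<integral>\<omega>. g (R \<omega> *v b) \<bullet> g (R \<omega> *v b) \<partial>\<Omega>)"
    using int_inner[OF g g ab(1) ab(1)] int_inner[OF g g ab(2) ab(2)] by simp
  also have "\<dots> \<le> 2 * (1 - 8 / (3 * pi))" using sq[OF ab(1)] sq[OF ab(2)] by simp
  finally show ?thesis using rem[OF ab] by simp
qed

text \<open>\<open>sgn\<close> and the cubic bound are odd, so replacing \<open>a\<close> by
  \<open>- a\<close> reverses the inequality.\<close>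

lemma rounding_upper_bound:
  fixes a b :: "real ^ 'k"
  assumes ab: "norm a = 1" "norm b = 1" "a \<bullet> b \<le> 0"
  shows "(\<integral>\<omega>. sgn (R \<omega> *v a) \<bullet> sgn (R \<omega> *v b) \<partial>\<Omega>) \<le> 8 / (3 * pi) * ((a \<bullet> b) + (a \<bullet> b) ^ 3 / 10)"
proof -
  have "R \<omega> *v (- a) = - (R \<omega> *v a)" for \<omega>
    by (simp add: vec_eq_iff matrix_vector_mult_def sum_negf)
  then show ?thesis using rounding_lower_bound[of "- a" b] ab by (simp add: sgn_minus field_simps)
qed

end

section \<open>The approximation ratio\<close>

text \<open>Otherwise 0.5236 would be at most pi / 6 and its sine at most 1/2, contradicting the
  Taylor polynomial of degree five with its error bound.\<close>

lemma pi_less_3142: "pi < 3.142"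
proof (rule ccontr)
  assume "\<not> pi < 3.142"
  define x :: real where "x = 0.5236"
  have x: "x \<le> pi / 6" using \<open>\<not> pi < 3.142\<close> by (simp add: x_def)
  have "sin x \<le> sin (pi / 6)"
    using x pi_gt_zero by (intro sin_monotone_2pi_le) (auto simp: x_def)
  then have "sin x \<le> 1 / 2" by (simp add: sin_30)
  moreover have "\<bar>sin x - (\<Sum>m<7. sin_coeff m * x ^ m)\<bar> \<le> inverse (fact 7) * \<bar>x\<bar> ^ 7"
    by (rule Maclaurin_sin_bound)
  moreover have "(\<Sum>m<7. sin_coeff m * x ^ m) = x - x ^ 3 / 6 + x ^ 5 / 120"
  proof -
    have "{..<7 :: nat} = {0, 1, 2, 3, 4, 5, 6}" by auto
    then show ?thesis by (simp add: sin_coeff_def fact_numeral)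
  qed
  moreover have "x - x ^ 3 / 6 + x ^ 5 / 120 - inverse (fact 7) * \<bar>x\<bar> ^ 7 > 1 / 2"
    by (simp add: x_def eval_nat_numeral fact_numeral)
  ultimately show False by linarith
qed

text \<open>The cubic is replaced by its tangents at \<open>- 1 / 3\<close> and at \<open>- 0.435\<close>, close to the points where
  the inequality is tightest.\<close>

lemma edge_ratio:
  fixes F t c :: real
  assumes t: "- 1 \<le> t" "t \<le> 1 / 3" and c: "0.8487 \<le> c"
    and crude: "\<bar>F - c * t\<bar> \<le> 1 - c"
    and fine: "t \<le> 0 \<Longrightarrow> F \<le> c * (t + t ^ 3 / 10)"
  shows "0.595 * (1 - 3 * t) \<le> 0.6715 * (1 - F) + 0.3285 * (1 + 2.4 * max 0 (- (1 + 3 * t) / 2))"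
proof -
  consider "t \<ge> 0" | "- 1 / 3 \<le> t" "t \<le> 0" | "t \<le> - 1 / 3" by linarith
  then show ?thesis
  proof cases
    case 1
    \<comment> \<open>For nonnegative \<open>t\<close> the crude bound leaves ample room.\<close>
    have "c * (1 - t) \<ge> 0.8487 * (1 - t)" using c t by (intro mult_right_mono) auto
    then have "1 - F \<ge> 0.8487 * (1 - t)" using crude by (simp add: algebra_simps)
    then show ?thesis using 1 t by (simp add: field_simps max_def)
  next
    case 2
    \<comment> \<open>A cubic minus its tangent at p factors as (t - p)^2 (t + 2 p), because it has
      no quadratic term.\<close>
    have "(t + 1 / 3)\<^sup>2 * (t - 2 / 3) \<le> 0" using 2 by (intro mult_nonneg_nonpos) auto
    then have "t ^ 3 \<le> t / 3 + 2 / 27" by (simp add: power2_eq_square power3_eq_cube field_simps)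
    then have tt: "t + t ^ 3 / 10 \<le> t + (t / 3 + 2 / 27) / 10" by simp
    \<comment> \<open>The factor multiplying \<open>c\<close> is nonpositive, so the lower bound on
      \<open>c\<close> yields an upper bound on the product.\<close>
    have "t ^ 3 \<le> 0" using 2 by (simp add: power3_eq_cube mult_nonpos_nonpos mult_nonneg_nonpos)
    then have "t + t ^ 3 / 10 \<le> 0" using 2 by linarith
    then have "c * (t + t ^ 3 / 10) \<le> 0.8487 * (t + t ^ 3 / 10)"
      by (intro mult_right_mono_neg c)
    also have "\<dots> \<le> 0.8487 * (t + (t / 3 + 2 / 27) / 10)" using tt by (intro mult_left_mono) simp_all
    finally have "F \<le> 0.8487 * (t + (t / 3 + 2 / 27) / 10)" using fine 2 by linarith
    then show ?thesis using 2 by (simp add: field_simps max_def)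
  next
    case 3
    \<comment> \<open>On this range both sides grow at nearly the same rate as \<open>t\<close>
      decreases; their slopes agree close to - 0.435, where the slack is smallest.\<close>
    have "(t + 0.435)\<^sup>2 * (t - 0.87) \<le> 0" using 3 by (intro mult_nonneg_nonpos) auto
    then have "t ^ 3 \<le> 3 * 0.435 ^ 2 * t + 2 * 0.435 ^ 3" by (simp add: power2_eq_square power3_eq_cube field_simps)
    then have tt: "t + t ^ 3 / 10 \<le> t + (3 * 0.435 ^ 2 * t + 2 * 0.435 ^ 3) / 10" by simp
    have "t ^ 3 \<le> 0" using 3 by (simp add: power3_eq_cube mult_nonpos_nonpos mult_nonneg_nonpos)
    then have "t + t ^ 3 / 10 \<le> 0" using 3 by linarith
    then have "c * (t + t ^ 3 / 10) \<le> 0.8487 * (t + t ^ 3 / 10)"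
      by (intro mult_right_mono_neg c)
    also have "\<dots> \<le> 0.8487 * (t + (3 * 0.435 ^ 2 * t + 2 * 0.435 ^ 3) / 10)" using tt by (intro mult_left_mono) simp_all
    finally have "F \<le> 0.8487 * (t + (3 * 0.435 ^ 2 * t + 2 * 0.435 ^ 3) / 10)" using fine 3 by linarith
    moreover have "max 0 (- (1 + 3 * t) / 2) = - (1 + 3 * t) / 2" using 3 by simp
    ultimately show ?thesis using 3 t by (simp add: power2_eq_square power3_eq_cube field_simps)
  qed
qed

text \<open>In terms of correlations, x is \<open>- (1 + corr v i j) / 2\<close>; the star bound
  limits the degrees of its positive part, and a triangle in the support would violate the triangle
  bound.\<close>

lemma lasserre2_matching_weight:
  fixes v :: "('n::finite) sdp_family"
  assumes G: "weighted_graph E w" and feas: "lasserre2_feasible v" and M: "max_weight_matching E w M"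
  shows "4 / 5 * (\<Sum>(i, j)\<in>E. w i j * max 0 (- (1 + corr v i j) / 2)) \<le> matching_weight E w M"
proof -
  define y where "y i j = (if (i, j) \<in> E \<or> (j, i) \<in> E then max 0 (- (1 + corr v i j) / 2) else 0)" for i j
  have ne: "i \<noteq> j" if "(i, j) \<in> E \<or> (j, i) \<in> E" for i j
    using G that by (auto simp: weighted_graph_def)
  have pos: "((i, j) \<in> E \<or> (j, i) \<in> E) \<and> corr v i j < - 1 \<and> y i j = - (1 + corr v i j) / 2" if "y i j > 0" for i j
    using that by (auto simp: y_def max_def split: if_splits)
  have nonneg: "y i j \<ge> 0" for i j by (simp add: y_def)
  have "\<exists>M'. matching E M' \<and> 4 / 5 * (\<Sum>(i, j)\<in>E. w i j * y i j) \<le> matching_weight E w M'"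
  proof (rule fractional_matching_rounding[OF G nonneg])
    show "y i j = y j i" for i j
    proof (cases "(i, j) \<in> E \<or> (j, i) \<in> E")
      case True
      then show ?thesis using corr_sym[OF ne[OF True], of v] by (simp add: y_def disj_commute)
    next
      case False
      then show ?thesis by (simp add: y_def disj_commute)
    qed
    show "(i, j) \<in> E \<or> (j, i) \<in> E" if "y i j > 0" for i j using pos[OF that] by blast
    show "(\<Sum>j\<in>UNIV. y i j) \<le> 1" for i
    proof -
      \<comment> \<open>The star bound holds for every set of leaves, so it may be applied to those
        where the positive part is active.\<close>
      define J where "J = {j. y i j > 0}"
      have iJ: "i \<notin> J" using pos[of i i] ne[of i i] by (auto simp: J_def)
      have "(\<Sum>j\<in>UNIV. y i j) = (\<Sum>j\<in>J. y i j)"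
        using nonneg by (intro sum.mono_neutral_right) (auto simp: J_def less_le)
      also have "\<dots> = (\<Sum>j\<in>J. - (1 + corr v i j) / 2)"
        using pos by (intro sum.cong) (auto simp: J_def)
      also have "\<dots> = - (real (card J) + (\<Sum>j\<in>J. corr v i j)) / 2"
        by (simp add: sum_divide_distrib[symmetric] sum_negf sum.distrib sum_subtractf)
      also have "\<dots> \<le> 1" using star_bound[OF feas iJ] by simp
      finally show ?thesis .
    qed
    show False if "y i j > 0" "y j k > 0" "y k i > 0" for i j k
    proof -
      have "i \<noteq> j" "i \<noteq> k" "j \<noteq> k" using pos that ne by metis+
      then have "corr v i j + corr v j k + corr v k i \<ge> - 3" by (rule triangle_bound[OF feas])
      moreover have "corr v i j < - 1" "corr v j k < - 1" "corr v k i < - 1" using pos that by blast+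
      ultimately show False by linarith
    qed
  qed
  then obtain M' where "matching E M'" "4 / 5 * (\<Sum>(i, j)\<in>E. w i j * y i j) \<le> matching_weight E w M'"
    by blast
  moreover have "(\<Sum>(i, j)\<in>E. w i j * y i j) = (\<Sum>(i, j)\<in>E. w i j * max 0 (- (1 + corr v i j) / 2))"
    by (intro sum.cong) (auto simp: y_def)
  ultimately show ?thesis using M by (force simp: max_weight_matching_def)
qed

theorem theorem2:
  fixes E :: "('n::finite \<times> 'n) set" and w :: "'n \<Rightarrow> 'n \<Rightarrow> real"
    and v :: "'n sdp_family" and M :: "'n \<times> 'n \<Rightarrow> nat"
    and \<Omega> :: "'w measure" and R :: "'w \<Rightarrow> real ^ (3 \<times> 'n pauli2) ^ 3"
  assumes graph: "weighted_graph E w"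
    and sdp: "lasserre2_optimal E w v"
    and matching: "max_weight_matching E w M"
    and prob: "prob_space \<Omega>"
    and gauss: "gaussian_matrix \<Omega> R"
  shows "(\<integral>\<omega>. energy (qmc_hamiltonian E w) (algorithm_output E w v M (R \<omega>)) \<partial>\<Omega>)
           \<ge> 0.595 * lambda_max (qmc_hamiltonian E w)"
proof -
  interpret prob_space \<Omega> by (rule prob)
  let ?H = "qmc_hamiltonian E w"
  let ?p = "0.6715 :: real"
  have feas: "lasserre2_feasible v" using sdp by (simp add: lasserre2_optimal_def)
  have M: "matching E M" using matching by (simp add: max_weight_matching_def)
  have ne: "fst e \<noteq> snd e" and wpos: "w (fst e) (snd e) > 0" if "e \<in> E" for e
    using graph that by (auto simp: weighted_graph_def)
  have card3: "CARD(3 \<times> 'n pauli2) \<ge> 3"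
    using zero_less_card_finite[where 'a="'n pauli2"] by (simp add: Suc_le_eq)
  note norm1 = stacked_norm[OF feas]
  \<comment> \<open>\<open>sgn\<close> agrees with \<open>rounded\<close> also on the null event, so
    the energy identities hold for every outcome.\<close>
  define X where "X i j \<omega> = sgn (R \<omega> *v stacked v i) \<bullet> sgn (R \<omega> *v stacked v j)" for i j \<omega>
  define F where "F i j = (\<integral>\<omega>. X i j \<omega> \<partial>\<Omega>)" for i j
  have intX: "integrable \<Omega> (X i j)" for i j
    unfolding X_def[abs_def]
    by (rule integrable_R_inner[OF prob gauss card3 square_integrable_gauss_sgn square_integrable_gauss_sgn norm1 norm1])
  define e1 where "e1 \<omega> = (\<Sum>(i, j)\<in>E. w i j / 4 * (1 - X i j \<omega>))" for \<omega>
  define e2 where "e2 = (\<Sum>(i, j)\<in>E. w i j * (1 / 4 + 3 / 4 * M (i, j)))"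
  have e1: "energy ?H (product_state (rounded v (R \<omega>))) = e1 \<omega>" for \<omega>
    by (simp add: energy_product_state[OF graph] e1_def X_def rounded_def sgn_div_norm)
  have e2: "energy ?H (matching_state E M) = e2"
    by (simp add: energy_matching_state[OF graph M] e2_def)
  have out: "energy ?H (algorithm_output E w v M (R \<omega>)) = max (e1 \<omega>) e2" for \<omega>
    by (simp add: algorithm_output_def Let_def e1 e2 max_def)
  have int1: "integrable \<Omega> e1"
    unfolding e1_def[abs_def] case_prod_unfold using intX by simp
  have E1: "(\<integral>\<omega>. e1 \<omega> \<partial>\<Omega>) = (\<Sum>(i, j)\<in>E. w i j / 4 * (1 - F i j))"
    unfolding e1_def F_def case_prod_unfold using intX by (simp add: prob_space)
  \<comment> \<open>The maximum dominates every convex combination pointwise, which replaces it by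
    an expression that is linear in the edges.\<close>
  have "(\<integral>\<omega>. ?p * e1 \<omega> + (1 - ?p) * e2 \<partial>\<Omega>) \<le> (\<integral>\<omega>. max (e1 \<omega>) e2 \<partial>\<Omega>)"
  proof (rule integral_mono)
    show "?p * e1 \<omega> + (1 - ?p) * e2 \<le> max (e1 \<omega>) e2" for \<omega>
      by (simp add: max_def)
  qed (use int1 in simp_all)
  then have lower: "?p * (\<Sum>(i, j)\<in>E. w i j / 4 * (1 - F i j)) + (1 - ?p) * e2 \<le> (\<integral>\<omega>. max (e1 \<omega>) e2 \<partial>\<Omega>)"
    using int1 by (simp add: E1 prob_space)
  define y where "y i j = max 0 (- (1 + corr v i j) / 2)" for i j
  have "e2 = (\<Sum>(i, j)\<in>E. w i j) / 4 + 3 / 4 * matching_weight E w M"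
    by (simp add: e2_def matching_weight_def case_prod_unfold sum_distrib_left sum_divide_distrib
        sum.distrib algebra_simps)
  \<comment> \<open>Measured in units of \<open>w i j / 4\<close>, matching an edge gains 3, and the
    factor 4/5 makes this the 2.4 below.\<close>
  also have "\<dots> \<ge> (\<Sum>(i, j)\<in>E. w i j) / 4 + 3 / 4 * (4 / 5 * (\<Sum>(i, j)\<in>E. w i j * y i j))"
    using lasserre2_matching_weight[OF graph feas matching] by (simp add: y_def)
  finally have "e2 \<ge> (\<Sum>(i, j)\<in>E. w i j / 4 * (1 + 2.4 * y i j))"
    by (simp add: case_prod_unfold sum_distrib_left sum_divide_distrib sum.distrib algebra_simps)
  then have "?p * (\<Sum>(i, j)\<in>E. w i j / 4 * (1 - F i j)) + (1 - ?p) * (\<Sum>(i, j)\<in>E. w i j / 4 * (1 + 2.4 * y i j))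
     \<le> (\<integral>\<omega>. max (e1 \<omega>) e2 \<partial>\<Omega>)"
    using lower by simp
  also have "?p * (\<Sum>(i, j)\<in>E. w i j / 4 * (1 - F i j)) + (1 - ?p) * (\<Sum>(i, j)\<in>E. w i j / 4 * (1 + 2.4 * y i j))
    = (\<Sum>(i, j)\<in>E. w i j / 4 * (?p * (1 - F i j) + 0.3285 * (1 + 2.4 * y i j)))"
    unfolding sum_distrib_left sum.distrib[symmetric]
    by (intro sum.cong refl) (simp add: case_prod_unfold field_simps)
  finally have mix: "(\<Sum>(i, j)\<in>E. w i j / 4 * (?p * (1 - F i j) + 0.3285 * (1 + 2.4 * y i j)))
    \<le> (\<integral>\<omega>. max (e1 \<omega>) e2 \<partial>\<Omega>)" .
  \<comment> \<open>The slope of the linear part of the rounded correlation, rounded down.\<close>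
  have c: "0.8487 \<le> 8 / (3 * pi)"
    using pi_less_3142 by (simp add: field_simps)
  have edge: "0.595 * (1 - corr v i j) \<le> ?p * (1 - F i j) + 0.3285 * (1 + 2.4 * y i j)" if ij: "i \<noteq> j" for i j
  proof -
    define t where "t = stacked v i \<bullet> stacked v j"
    have t: "corr v i j = 3 * t" by (simp add: t_def stacked_inner_eq_corr[OF feas ij])
    have "0.595 * (1 - 3 * t) \<le> ?p * (1 - F i j) + 0.3285 * (1 + 2.4 * max 0 (- (1 + 3 * t) / 2))"
    proof (rule edge_ratio[OF _ _ c])
      show "- 1 \<le> t" "t \<le> 1 / 3" using corr_ge[OF feas ij] corr_le_1[OF feas ij] t by simp_all
      show "\<bar>F i j - 8 / (3 * pi) * t\<bar> \<le> 1 - 8 / (3 * pi)"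
        unfolding F_def X_def t_def by (rule rounding_crude_bound[OF prob gauss card3 norm1 norm1])
      show "F i j \<le> 8 / (3 * pi) * (t + t ^ 3 / 10)" if "t \<le> 0"
        using that unfolding F_def X_def t_def by (rule rounding_upper_bound[OF prob gauss card3 norm1 norm1])
    qed
    then show ?thesis by (simp add: t y_def)
  qed
  have "0.595 * lambda_max ?H \<le> 0.595 * lasserre2_value E w v"
    using lambda_max_le_lasserre2_value[OF graph sdp] by simp
  also have "\<dots> = (\<Sum>(i, j)\<in>E. w i j / 4 * (0.595 * (1 - corr v i j)))"
    by (simp add: lasserre2_value_eq[OF feas] case_prod_unfold sum_distrib_left mult_ac)
  also have "\<dots> \<le> (\<Sum>(i, j)\<in>E. w i j / 4 * (?p * (1 - F i j) + 0.3285 * (1 + 2.4 * y i j)))"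
    unfolding case_prod_unfold
  proof (rule sum_mono)
    fix e assume e: "e \<in> E"
    show "w (fst e) (snd e) / 4 * (0.595 * (1 - corr v (fst e) (snd e))) \<le>
      w (fst e) (snd e) / 4 * (?p * (1 - F (fst e) (snd e)) + 0.3285 * (1 + 2.4 * y (fst e) (snd e)))"
      using wpos[OF e] by (intro mult_left_mono edge[OF ne[OF e]]) simp
  qed
  also note mix
  finally show ?thesis by (simp add: out)
qed

end
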